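(* Let $n\ge 2$, $q=2^n$, $h(y)=y^{q/2}+y^{q/4}+\dots+y^2+y$, and let $Y_2=\mathbb{F}_{q^2}(x,y)$ be the function field over $\mathbb{F}_{q^2}$ defined by $x^{q+1}=h(y)$. Let $\mathcal{D}=(P_{1,1},\dots,P_{1,q/2},P_{2,1},\dots,P_{q^2,q/2})$ be the ordered list of all rational places of $Y_2$ other than $P_\infty$, as described in the context. For every integer $m$ with $q+1\le m\le (q^3-3q-2)/2$, the automorphism group of the one-point code $C_m=C(\mathcal{D},mP_\infty)$ is isomorphic to $\mathrm{Aut}(Y_2/\mathbb{F}_{q^2})$.
   Context: $P_\infty$ is the unique common pole of $x$ and $y$ (a rational place). Enumerate $\mathbb{F}_{q^2}=\{x_1,\dots,x_{q^2}\}$; for each $j$ there are exactly $q/2$ elements $y_{j,1},\dots,y_{j,q/2}\in\mathbb{F}_{q^2}$ with $h(y_{j,\ell})=x_j^{q+1}$, and $P_{j,\ell}$ denotes the common zero of $x-x_j$ and $y-y_{j,\ell}$ in $Y_2$; these $q^3/2$ places together with $P_\infty$ are all rational places of $Y_2$. For a divisor $G$, $\mathcal{L}(G)=\{f\in Y_2^*:(f)+G\ge 0\}\cup\{0\}$. The code is $C(\mathcal{D},mP_\infty)=\{(f(P_{1,1}),f(P_{1,2}),\dots,f(P_{q^2,q/2})) : f\in\mathcal{L}(mP_\infty)\}\subseteq\mathbb{F}_{q^2}^{q^3/2}$. For a code $C\subseteq\mathbb{F}_{q^2}^{N}$, $\mathrm{Aut}(C)=\{\tau\in S_N:\tau(C)=C\}$,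 where $\tau(c_1,\dots,c_N)=(c_{\tau(1)},\dots,c_{\tau(N)})$. $\mathrm{Aut}(Y_2/\mathbb{F}_{q^2})$ is the group of $\mathbb{F}_{q^2}$-automorphisms of $Y_2$. *)

theory Defs
  imports
    "HOL-Computational_Algebra.Polynomial"
    "HOL-Algebra.Sym_Groups"
begin

text \<open>
  A function field is a type \<open>'a\<close> of class \<open>field\<close>, and its constant field is a subset
  \<open>K\<close> of that type. A place is represented by the maximal ideal of its valuation ring.
\<close>

definition is_subring :: "'a::field set \<Rightarrow> bool" where
  "is_subring R \<longleftrightarrow> 0 \<in> R \<and> 1 \<in> R \<and>
     (\<forall>a\<in>R. \<forall>b\<in>R. a - b \<in> R \<and> a * b \<in> R)"

definition is_subfield :: "'a::field set \<Rightarrow> bool" where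
  "is_subfield L \<longleftrightarrow> is_subring L \<and> (\<forall>a\<in>L. inverse a \<in> L)"

definition transcendental_over :: "'a::field set \<Rightarrow> 'a \<Rightarrow> bool" where
  "transcendental_over K t \<longleftrightarrow>
     (\<forall>p :: 'a poly. (\<forall>i. coeff p i \<in> K) \<longrightarrow> poly p t = 0 \<longrightarrow> p = 0)"

definition valuation_ring :: "'a::field set \<Rightarrow> 'a set \<Rightarrow> bool" where
  "valuation_ring K R \<longleftrightarrow> is_subring R \<and> K \<subset> R \<and> R \<subset> UNIV \<and>
     (\<forall>z. z \<in> R \<or> inverse z \<in> R)"

definition ring_units :: "'a::field set \<Rightarrow> 'a set" where
  "ring_units R = {z \<in> R. z \<noteq> 0 \<and> inverse z \<in> R}"

definition is_place :: "'a::field set \<Rightarrow> 'a set \<Rightarrow> bool" where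
  "is_place K P \<longleftrightarrow> (\<exists>R. valuation_ring K R \<and> P = R - ring_units R)"

text \<open>
  The valuation ring is recovered from \<open>P\<close>; zero is listed separately because
  \<open>inverse 0 = 0\<close> lies in \<open>P\<close>.
\<close>

definition place_ring :: "'a::field set \<Rightarrow> 'a set" where
  "place_ring P = {z. z = 0 \<or> inverse z \<notin> P}"

text \<open>The normalized discrete valuation; its value at \<open>0\<close> is never used.\<close>

definition place_val :: "'a::field set \<Rightarrow> 'a \<Rightarrow> int" where
  "place_val P z = (THE k. \<exists>t u. P = (\<lambda>w. t * w) ` place_ring P \<and>
     u \<in> ring_units (place_ring P) \<and> z = t powi k * u)"

definition zero_at :: "'a::field set \<Rightarrow> 'a \<Rightarrow> bool" where
  "zero_at P f \<longleftrightarrow> f \<noteq> 0 \<and> place_val P f > 0"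

definition pole_at :: "'a::field set \<Rightarrow> 'a \<Rightarrow> bool" where
  "pole_at P f \<longleftrightarrow> f \<noteq> 0 \<and> place_val P f < 0"

definition common_zero :: "'a::field set \<Rightarrow> 'a \<Rightarrow> 'a \<Rightarrow> 'a set" where
  "common_zero K f g = (THE P. is_place K P \<and> zero_at P f \<and> zero_at P g)"

definition common_pole :: "'a::field set \<Rightarrow> 'a \<Rightarrow> 'a \<Rightarrow> 'a set" where
  "common_pole K f g = (THE P. is_place K P \<and> pole_at P f \<and> pole_at P g)"

text \<open>The value \<open>f(P)\<close> at a rational place, its residue field being identified with \<open>K\<close>.\<close>

definition place_value :: "'a::field set \<Rightarrow> 'a set \<Rightarrow> 'a \<Rightarrow> 'a" where
  "place_value K P f = (THE c. c \<in> K \<and> f - c \<in> P)"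

text \<open>Divisors are integer-valued functions on places.\<close>

definition point_divisor :: "int \<Rightarrow> 'a::field set \<Rightarrow> 'a set \<Rightarrow> int" where
  "point_divisor m Q = (\<lambda>P. if P = Q then m else 0)"

definition principal_divisor :: "'a::field \<Rightarrow> 'a set \<Rightarrow> int" where
  "principal_divisor f = (\<lambda>P. place_val P f)"

definition RR_space :: "'a::field set \<Rightarrow> ('a set \<Rightarrow> int) \<Rightarrow> 'a set" where
  "RR_space K G =
     {f. f \<noteq> 0 \<and> (\<forall>P. is_place K P \<longrightarrow> principal_divisor f P + G P \<ge> 0)} \<union> {0}"

text \<open>Words of length \<open>N\<close> are extensional functions on \<open>{1..N}\<close>.\<close>

definition AG_code :: "'a::field set \<Rightarrow> 'a set list \<Rightarrow> ('a set \<Rightarrow> int) \<Rightarrow> (nat \<Rightarrow> 'a) set" where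
  "AG_code K Ps G =
     (\<lambda>f. restrict (\<lambda>i. place_value K (Ps ! (i - 1)) f) {1..length Ps}) ` RR_space K G"

definition code_Aut :: "nat \<Rightarrow> (nat \<Rightarrow> 'a) set \<Rightarrow> (nat \<Rightarrow> nat) monoid" where
  "code_Aut N C = (sym_group N)
     \<lparr>carrier := {\<tau> \<in> carrier (sym_group N). (\<lambda>c. c \<circ> \<tau>) ` C = C}\<rparr>"

definition field_Aut :: "'a::field set \<Rightarrow> ('a \<Rightarrow> 'a) monoid" where
  "field_Aut K = \<lparr>
     carrier = {\<sigma>. bij \<sigma> \<and> (\<forall>a b. \<sigma> (a + b) = \<sigma> a + \<sigma> b) \<and>
                  (\<forall>a b. \<sigma> (a * b) = \<sigma> a * \<sigma> b) \<and> (\<forall>c\<in>K. \<sigma> c = c)},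
     mult = (\<circ>), one = id\<rparr>"

text \<open>With \<open>q = 2 ^ n\<close> this is \<open>h(z) = z^(q/2) + z^(q/4) + ... + z^2 + z\<close>.\<close>

definition h_poly :: "nat \<Rightarrow> 'a::field \<Rightarrow> 'a" where
  "h_poly n z = (\<Sum>i<n. z ^ (2 ^ i))"

text \<open>
  The list \<open>P_{1,1}, ..., P_{1,s}, P_{2,1}, ..., P_{r,s}\<close>, where \<open>P_{j,l}\<close> is the common
  zero of \<open>x - a_j\<close> and \<open>y - b_{j,l}\<close>.
\<close>

definition place_list ::
  "'a::field set \<Rightarrow> 'a \<Rightarrow> 'a \<Rightarrow> nat \<Rightarrow> nat \<Rightarrow> (nat \<Rightarrow> 'a) \<Rightarrow> (nat \<Rightarrow> nat \<Rightarrow> 'a) \<Rightarrow> 'a set list"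
where
  "place_list K x y r s a b =
     concat (map (\<lambda>j. map (\<lambda>l. common_zero K (x - a j) (y - b j l)) [1..<Suc s]) [1..<Suc r])"

end

theory Submission
  imports Defs
begin

text \<open>
  Write \<open>q = 2 Q\<close>. The monomials \<open>x^i y^j\<close> with \<open>j < Q\<close> have pairwise distinct pole orders
  \<open>i Q + j (2 Q + 1)\<close> at infinity, and they form a basis of the ring of functions without affine
  poles: Lagrange interpolation at the conjugates \<open>y + e\<close>, \<open>h(e) = 0\<close>, whose differences are
  constants, reduces this to the statement for the rational function field. So
  \<open>L(m P\<^sub>\<infinity>)\<close> is spanned by the monomials of pole order at most \<open>m\<close>.

  A permutation preserving the code induces a bijection \<open>\<lambda>\<close> of \<open>L(m P\<^sub>\<infinity>)\<close> that is multiplicative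
  modulo functions vanishing at all \<open>4 Q^3\<close> points. A leading term count on \<open>\<lambda>(L((m - Q) P\<^sub>\<infinity>))\<close>, which has
  codimension at most \<open>Q\<close>, shows that the pole order of \<open>\<lambda>(x)\<close> plus \<open>m\<close> is below \<open>4 Q^3\<close>.
  Hence \<open>\<lambda>(x^i) = \<lambda>(x)^i\<close> holds exactly, which forces \<open>\<lambda>(x)\<close> and then \<open>\<lambda>(y)\<close> to have the pole
  orders of \<open>x\<close> and \<open>y\<close>, and \<open>\<lambda>\<close> extends to an automorphism of the function field.

  Conversely an automorphism fixes the place at infinity: otherwise it yields a function \<open>z\<close> whose
  only pole is at an affine rational place \<open>P\<close>, of order \<open>Q\<close>. Multiplying by a function with divisor
  \<open>(2 Q + 1) (P - P\<^sub>\<infinity>)\<close> gives a combination of \<open>1, x, x^2, y\<close> vanishing to order \<open>Q + 1 > 2\<close> at \<open>P\<close>,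
  so \<open>z\<close> is constant. Therefore it permutes the affine rational places and preserves \<open>L(m P\<^sub>\<infinity>)\<close>.
\<close>

text \<open>Places are handled through their valuation rings, on which field automorphisms act by
  preimages. A valuation ring is only defined by the dichotomy between \<open>z\<close> and
  \<open>inverse z\<close>, whereas \<open>place_val\<close> is a \<open>THE\<close> that
  presupposes a discrete valuation; so zero and pole orders become usable only after every valuation
  ring of the field is known to be discrete. This, and the determination of all functions without
  affine poles, is obtained with norms and characteristic polynomials down to \<open>K[x]\<close>;
  no genus and no Riemann-Roch theorem enter.

  The range of \<open>m\<close> is what the argument consumes. The lower bound
  \<open>m \<ge> q + 1 = 2 Q + 1\<close> puts \<open>x\<close> and \<open>y\<close> into the space
  of functions. The upper bound reads \<open>m + 3 Q + 1 \<le> 4 Q^3\<close>: functions are then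
  determined by their values at the \<open>4 Q^3\<close> points with \<open>3 Q\<close> to spare,
  and this margin is needed for the pole order of the image of \<open>x\<close>.\<close>

definition vring_max :: "'a::field set \<Rightarrow> 'a set" where
  "vring_max V = V - ring_units V"

abbreviation pval :: "'a::field set \<Rightarrow> 'a \<Rightarrow> int" where
  "pval V \<equiv> place_val (vring_max V)"

section \<open>Closure properties of subrings\<close>

lemma subring_zero: "is_subring R \<Longrightarrow> 0 \<in> R"
  and subring_one: "is_subring R \<Longrightarrow> 1 \<in> R"
  and subring_diff: "is_subring R \<Longrightarrow> a \<in> R \<Longrightarrow> b \<in> R \<Longrightarrow> a - b \<in> R"
  and subring_mult: "is_subring R \<Longrightarrow> a \<in> R \<Longrightarrow> b \<in> R \<Longrightarrow> a * b \<in> R"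
  by (auto simp: is_subring_def)

lemma subring_minus: "is_subring R \<Longrightarrow> a \<in> R \<Longrightarrow> - a \<in> R"
  using subring_diff[of R 0 a] by (simp add: subring_zero)

lemma subring_add: "is_subring R \<Longrightarrow> a \<in> R \<Longrightarrow> b \<in> R \<Longrightarrow> a + b \<in> R"
  using subring_diff[of R a "- b"] by (simp add: subring_minus)

lemma subring_power: "is_subring R \<Longrightarrow> a \<in> R \<Longrightarrow> a ^ k \<in> R"
  by (induction k) (auto intro: subring_one subring_mult)

lemma subring_sum: "is_subring R \<Longrightarrow> (\<And>i. i \<in> I \<Longrightarrow> f i \<in> R) \<Longrightarrow> sum f I \<in> R"
  by (induction I rule: infinite_finite_induct) (auto intro: subring_zero subring_add)

lemma subring_prod: "is_subring R \<Longrightarrow> (\<And>i. i \<in> I \<Longrightarrow> f i \<in> R) \<Longrightarrow> prod f I \<in> R"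
  by (induction I rule: infinite_finite_induct) (auto intro: subring_one subring_mult)

lemmas subring_intros = subring_zero subring_one subring_diff subring_mult subring_minus
  subring_add subring_power subring_sum subring_prod

lemma subring_poly:
  assumes "is_subring R" "\<And>i. coeff p i \<in> R" "z \<in> R"
  shows "poly p z \<in> R"
  unfolding poly_altdef by (intro subring_intros assms)

lemma subring_poly_mult:
  assumes "is_subring R" "\<And>i. coeff p i \<in> R" "\<And>i. coeff r i \<in> R"
  shows "coeff (p * r) i \<in> R"
  unfolding coeff_mult by (intro subring_intros assms)

lemma subring_poly_prod:
  assumes "is_subring R" "\<And>e i. e \<in> I \<Longrightarrow> coeff (f e) i \<in> R"
  shows "coeff (prod f I) i \<in> R"
proof -
  have "\<forall>i. coeff (prod f I) i \<in> R"
    using assms(2)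
  proof (induction I rule: infinite_finite_induct)
    case (insert e I)
    then show ?case using assms(1) by (auto intro!: subring_poly_mult)
  qed (auto simp: assms(1) subring_zero subring_one coeff_1)
  then show ?thesis by blast
qed

section \<open>Valuation rings\<close>

lemma vring_subring: "valuation_ring K V \<Longrightarrow> is_subring V"
  and vring_const: "valuation_ring K V \<Longrightarrow> c \<in> K \<Longrightarrow> c \<in> V"
  and vring_cases: "valuation_ring K V \<Longrightarrow> z \<in> V \<or> inverse z \<in> V"
  by (auto simp: valuation_ring_def)

lemma units_mult: "is_subring V \<Longrightarrow> a \<in> ring_units V \<Longrightarrow> b \<in> ring_units V \<Longrightarrow> a * b \<in> ring_units V"
  by (auto simp: ring_units_def intro: subring_mult)

lemma units_one: "is_subring V \<Longrightarrow> 1 \<in> ring_units V"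
  by (auto simp: ring_units_def intro: subring_one)

lemma units_inverse: "a \<in> ring_units V \<Longrightarrow> inverse a \<in> ring_units V"
  by (auto simp: ring_units_def)

lemma units_divide: "is_subring V \<Longrightarrow> a \<in> ring_units V \<Longrightarrow> b \<in> ring_units V \<Longrightarrow> a / b \<in> ring_units V"
  by (simp add: divide_inverse units_mult units_inverse)

lemma units_power: "is_subring V \<Longrightarrow> a \<in> ring_units V \<Longrightarrow> a ^ k \<in> ring_units V"
  by (induction k) (auto intro: units_one units_mult)

lemma units_powi: "is_subring V \<Longrightarrow> a \<in> ring_units V \<Longrightarrow> a powi k \<in> ring_units V"
  by (auto simp: power_int_def intro: units_power units_inverse)

lemma units_nonzero: "a \<in> ring_units V \<Longrightarrow> a \<noteq> 0"
  and units_mem: "a \<in> ring_units V \<Longrightarrow> a \<in> V"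
  by (auto simp: ring_units_def)

lemma units_const:
  assumes "is_subfield K" "valuation_ring K V" "c \<in> K" "c \<noteq> 0"
  shows "c \<in> ring_units V"
  using assms by (auto simp: ring_units_def is_subfield_def valuation_ring_def)

text \<open>In a valuation ring the nonzero nonunits are the elements whose inverse falls outside;
  zero is separate because \<open>inverse 0 = 0\<close> lies in the ring.\<close>

lemma vring_max_iff:
  assumes "valuation_ring K V"
  shows "z \<in> vring_max V \<longleftrightarrow> z = 0 \<or> inverse z \<notin> V"
  using assms vring_cases[OF assms, of z] subring_zero[OF vring_subring[OF assms]]
  by (auto simp: vring_max_def ring_units_def)

lemma vring_max_mem: "z \<in> vring_max V \<Longrightarrow> z \<in> V"
  by (simp add: vring_max_def)

lemma vring_max_not_unit: "z \<in> vring_max V \<Longrightarrow> z \<notin> ring_units V"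
  by (simp add: vring_max_def)

lemma vring_unit_or_max: "z \<in> V \<Longrightarrow> z \<in> ring_units V \<or> z \<in> vring_max V"
  by (simp add: vring_max_def)

lemma not_in_vring_inverse_max:
  "valuation_ring K V \<Longrightarrow> z \<notin> V \<Longrightarrow> inverse z \<in> vring_max V"
  by (simp add: vring_max_iff)

lemma vring_max_mult:
  assumes V: "valuation_ring K V" and "z \<in> vring_max V" "w \<in> V"
  shows "z * w \<in> vring_max V"
proof (cases "z = 0 \<or> w = 0")
  case True
  then show ?thesis using V by (auto simp: vring_max_iff)
next
  case False
  have "inverse (z * w) \<notin> V"
  proof
    assume "inverse (z * w) \<in> V"
    from subring_mult[OF vring_subring[OF V] this assms(3)] have "inverse z \<in> V"
      using False by (simp add: field_simps)
    with assms(2) False V show False by (simp add: vring_max_iff)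
  qed
  then show ?thesis using V by (simp add: vring_max_iff)
qed

text \<open>One of \<open>z / w\<close> and \<open>w / z\<close> lies in the ring, so the sum is a
  multiple, inside the ring, of one of the two summands.\<close>

lemma vring_max_add:
  assumes V: "valuation_ring K V" and "z \<in> vring_max V" "w \<in> vring_max V"
  shows "z + w \<in> vring_max V"
proof -
  have *: "z + w \<in> vring_max V" if "z / w \<in> V" "w \<in> vring_max V" "w \<noteq> 0" for z w
  proof -
    have "z + w = w * (z / w + 1)" using that by (simp add: field_simps)
    then show ?thesis
      using vring_max_mult[OF V that(2)] that vring_subring[OF V]
      by (simp add: subring_intros)
  qed
  show ?thesis
  proof (cases "z = 0 \<or> w = 0")
    case True then show ?thesis using assms by auto
  next
    case False
    have "z / w \<in> V \<or> w / z \<in> V" using vring_cases[OF V, of "z / w"] by simp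
    then show ?thesis using *[of z w] *[of w z] False assms by (auto simp: add.commute)
  qed
qed

lemma vring_max_zero: "valuation_ring K V \<Longrightarrow> 0 \<in> vring_max V"
  by (simp add: vring_max_iff)

lemma vring_max_minus:
  assumes V: "valuation_ring K V" and "z \<in> vring_max V" shows "- z \<in> vring_max V"
  using vring_max_mult[OF assms, of "-1"] vring_subring[OF V] by (simp add: subring_intros)

lemma vring_max_diff:
  assumes V: "valuation_ring K V" and "z \<in> vring_max V" "w \<in> vring_max V"
  shows "z - w \<in> vring_max V"
  using vring_max_add[OF V assms(2) vring_max_minus[OF V assms(3)]] by simp

lemma vring_max_sum:
  assumes V: "valuation_ring K V" and "\<And>i. i \<in> I \<Longrightarrow> f i \<in> vring_max V"
  shows "sum f I \<in> vring_max V"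
  using assms(2)
  by (induction I rule: infinite_finite_induct) (auto intro: vring_max_zero[OF V] vring_max_add[OF V])

lemma one_not_vring_max: "valuation_ring K V \<Longrightarrow> 1 \<notin> vring_max V"
  using subring_one[OF vring_subring, of K V] by (auto simp: vring_max_iff)

text \<open>Were the sum a nonunit, subtracting \<open>z\<close> would make \<open>u\<close> one.
  The leading-term arguments below end in this fact: a dominant unit absorbs any number of
  nonunits.\<close>

lemma unit_add_max:
  assumes V: "valuation_ring K V" and "u \<in> ring_units V" "z \<in> vring_max V"
  shows "u + z \<in> ring_units V"
proof (rule ccontr)
  assume "u + z \<notin> ring_units V"
  moreover have "u + z \<in> V"
    using assms vring_subring[OF V] by (auto intro: subring_add dest: vring_max_mem units_mem)
  ultimately have "u + z \<in> vring_max V" by (simp add: vring_max_def)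
  from vring_max_diff[OF V this assms(3)] assms(2) show False by (simp add: vring_max_def)
qed

lemma vring_max_prime:
  assumes V: "valuation_ring K V" and "z \<in> V" "w \<in> V" "z * w \<in> vring_max V"
  shows "z \<in> vring_max V \<or> w \<in> vring_max V"
  using assms units_mult[OF vring_subring[OF V], of z w] by (auto simp: vring_max_def)

lemma vring_max_prod:
  assumes V: "valuation_ring K V" and "finite I" "\<And>i. i \<in> I \<Longrightarrow> f i \<in> V" "prod f I \<in> vring_max V"
  shows "\<exists>i\<in>I. f i \<in> vring_max V"
  using assms(2-)
proof (induction I)
  case empty then show ?case using one_not_vring_max[OF V] by simp
next
  case (insert i I)
  then have "f i \<in> vring_max V \<or> prod f I \<in> vring_max V"
    using vring_max_prime[OF V, of "f i" "prod f I"] vring_subring[OF V]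
    by (auto intro: subring_prod)
  then show ?case using insert by auto
qed

text \<open>If \<open>z\<close> were outside, \<open>inverse z\<close> would be inside, and
  \<open>z\<close> is \<open>z ^ k\<close> times \<open>inverse z ^ (k - 1)\<close>.\<close>

lemma vring_power_mem:
  assumes V: "valuation_ring K V" and "z ^ k \<in> V" "k > 0"
  shows "z \<in> V"
proof (rule ccontr)
  assume nz: "z \<notin> V"
  then have i: "inverse z \<in> vring_max V" by (rule not_in_vring_inverse_max[OF V])
  have "inverse z ^ (k - 1) \<in> V" using i vring_max_mem subring_power vring_subring[OF V] by blast
  from subring_mult[OF vring_subring[OF V] assms(2) this]
  have "z ^ k * inverse z ^ (k - 1) \<in> V" .
  moreover have "z \<noteq> 0" using nz subring_zero[OF vring_subring[OF V]] by auto
  ultimately show False using nz \<open>k > 0\<close>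
    by (cases k) (auto simp: power_inverse field_simps)
qed

lemma is_place_vring_max: "valuation_ring K V \<Longrightarrow> is_place K (vring_max V)"
  by (auto simp: is_place_def vring_max_def)

lemma is_placeE:
  assumes "is_place K P" obtains V where "valuation_ring K V" "P = vring_max V"
  using assms by (auto simp: is_place_def vring_max_def)

lemma place_ring_vring_max:
  assumes "valuation_ring K V" shows "place_ring (vring_max V) = V"
  using vring_max_iff[OF assms] subring_zero[OF vring_subring[OF assms]]
  by (auto simp: place_ring_def)

lemma vring_max_inject:
  "valuation_ring K V \<Longrightarrow> valuation_ring K W \<Longrightarrow> vring_max V = vring_max W \<Longrightarrow> V = W"
  by (metis place_ring_vring_max)

section \<open>Discrete valuations\<close>

text \<open>The last clause asks more than that \<open>t\<close> generate the maximal ideal: it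
  contains the discreteness of the valuation, and it gives the \<open>THE\<close> in
  \<open>place_val\<close> a value for every nonzero element.\<close>

definition uniformizer :: "'a::field set \<Rightarrow> 'a \<Rightarrow> bool" where
  "uniformizer V t \<longleftrightarrow> t \<noteq> 0 \<and> t \<in> vring_max V \<and>
     (\<forall>z. z \<noteq> 0 \<longrightarrow> (\<exists>k u. u \<in> ring_units V \<and> z = t powi k * u))"

lemma powi_unit_iff:
  assumes V: "valuation_ring K V" and "t \<in> vring_max V" "t \<noteq> 0" "t powi k \<in> ring_units V"
  shows "k = 0"
proof -
  have *: "t ^ i \<in> vring_max V" if "i > 0" for i
    using that assms(2) vring_max_mult[OF V assms(2), of "t ^ (i - 1)"] vring_subring[OF V]
      vring_max_mem[OF assms(2)]
    by (cases i) (auto simp: subring_power)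
  have "\<bar>k\<bar> = int (nat \<bar>k\<bar>)" by simp
  have "t ^ nat \<bar>k\<bar> \<in> ring_units V"
    using assms(4) units_inverse[of "t powi k" V]
    by (auto simp: power_int_def power_inverse split: if_splits)
  then show ?thesis using *[of "nat \<bar>k\<bar>"] vring_max_not_unit by fastforce
qed

lemma uniformizer_generates:
  assumes V: "valuation_ring K V" and t: "uniformizer V t"
  shows "vring_max V = (\<lambda>w. t * w) ` V"
proof
  show "(\<lambda>w. t * w) ` V \<subseteq> vring_max V"
    using vring_max_mult[OF V] t by (auto simp: uniformizer_def)
  show "vring_max V \<subseteq> (\<lambda>w. t * w) ` V"
  proof
    fix z assume z: "z \<in> vring_max V"
    have tz: "t \<noteq> 0" "t \<in> vring_max V" using t by (auto simp: uniformizer_def)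
    have "z / t \<in> V"
    proof (cases "z = 0")
      case False
      then obtain k u where u: "u \<in> ring_units V" "z = t powi k * u"
        using t by (auto simp: uniformizer_def)
      have "k > 0"
      proof (rule ccontr)
        assume "\<not> k > 0"
        then have "inverse (t powi k) \<in> V"
          using tz vring_subring[OF V]
          by (auto simp: power_int_def power_inverse vring_max_mem intro!: subring_power subring_one
              split: if_splits)
        from subring_mult[OF vring_subring[OF V] this units_mem[OF units_inverse[OF u(1)]]]
        have "inverse z \<in> V" using u by simp
        then show False using z False V by (simp add: vring_max_iff)
      qed
      then obtain l where "k = int (Suc l)" by (metis gr0_conv_Suc zero_less_imp_eq_int)
      with u tz have "z / t = t ^ l * u"
        by (simp only: power_int_of_nat power_Suc mult.assoc) simp
      also have "\<dots> \<in> V"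
        by (intro subring_mult subring_power vring_subring[OF V] vring_max_mem[OF tz(2)] units_mem[OF u(1)])
      finally show ?thesis .
    qed (use subring_zero[OF vring_subring[OF V]] in auto)
    moreover have "z = t * (z / t)" using tz by simp
    ultimately show "z \<in> (\<lambda>w. t * w) ` V" by blast
  qed
qed

text \<open>Two generators of the maximal ideal divide each other, hence differ by a unit
  \<open>w\<close>, and \<open>powi_unit_iff\<close> forces equal exponents. So
  \<open>place_val\<close> may be computed with any chosen uniformizer.\<close>

lemma place_val_eqI:
  assumes V: "valuation_ring K V" and t: "uniformizer V t"
    and u: "u \<in> ring_units V" and z: "z = t powi k * u"
  shows "pval V z = k"
  unfolding place_val_def place_ring_vring_max[OF V]
proof (rule the_equality)
  show "\<exists>t u. vring_max V = (\<lambda>w. t * w) ` V \<and> u \<in> ring_units V \<and> z = t powi k * u"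
    using uniformizer_generates[OF V t] u z by blast
next
  fix k' assume "\<exists>t u. vring_max V = (\<lambda>w. t * w) ` V \<and> u \<in> ring_units V \<and> z = t powi k' * u"
  then obtain t' u' where t': "vring_max V = (\<lambda>w. t' * w) ` V" and u': "u' \<in> ring_units V"
    and z': "z = t' powi k' * u'" by blast
  have tz: "t \<noteq> 0" "t \<in> vring_max V" using t by (auto simp: uniformizer_def)
  have "t' * 1 \<in> vring_max V" unfolding t' using subring_one[OF vring_subring[OF V]] by blast
  then obtain w where w: "w \<in> V" "t' = t * w" using uniformizer_generates[OF V t] by auto
  obtain w' where w': "w' \<in> V" "t = t' * w'" using tz(2) unfolding t' by auto
  have "w * w' = 1" using w w' tz by (auto simp: mult.commute)
  then have "inverse w = w'" by (metis inverse_unique)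
  with w w' have wu: "w \<in> ring_units V" using \<open>w * w' = 1\<close> by (auto simp: ring_units_def)
  have "t powi k * u = t powi k' * (w powi k' * u')"
    using z' unfolding z w(2) by (simp add: power_int_mult_distrib mult.assoc)
  then have "t powi (k - k') = w powi k' * u' / u"
    using tz units_nonzero[OF u] by (simp add: power_int_diff field_simps)
  then have "t powi (k - k') \<in> ring_units V"
    using wu u u' vring_subring[OF V] by (simp add: units_mult units_powi units_divide)
  from powi_unit_iff[OF V tz(2,1) this] show "k' = k" by simp
qed

definition discrete :: "'a::field set \<Rightarrow> bool" where
  "discrete V \<longleftrightarrow> (\<exists>t. uniformizer V t)"

lemma place_val_decomp:
  assumes V: "valuation_ring K V" and t: "uniformizer V t" and "z \<noteq> 0"
  shows "\<exists>u\<in>ring_units V. z = t powi pval V z * u"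
  using assms place_val_eqI[OF V t] by (metis uniformizer_def)

context
  fixes K V :: "'a::field set"
  assumes V: "valuation_ring K V" and D: "discrete V"
begin

lemma place_val_mult:
  assumes "z \<noteq> 0" "w \<noteq> 0"
  shows "pval V (z * w) = pval V z + pval V w"
proof -
  obtain t where t: "uniformizer V t" using D by (auto simp: discrete_def)
  obtain u u' where u: "u \<in> ring_units V" "z = t powi pval V z * u"
    and u': "u' \<in> ring_units V" "w = t powi pval V w * u'"
    using place_val_decomp[OF V t] assms by metis
  have "t \<noteq> 0" using t by (auto simp: uniformizer_def)
  then have "z * w = t powi (pval V z + pval V w) * (u * u')"
    by (subst u(2), subst u'(2)) (simp add: power_int_add)
  from place_val_eqI[OF V t units_mult[OF vring_subring[OF V] u(1) u'(1)] this] show ?thesis .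
qed

lemma place_val_unit:
  assumes "u \<in> ring_units V" shows "pval V u = 0"
proof -
  obtain t where t: "uniformizer V t" using D by (auto simp: discrete_def)
  show ?thesis by (rule place_val_eqI[OF V t assms]) simp
qed

lemma place_val_one: "pval V 1 = 0"
  by (rule place_val_unit) (rule units_one[OF vring_subring[OF V]])

lemma place_val_power:
  assumes "z \<noteq> 0" shows "pval V (z ^ k) = int k * pval V z"
  by (induction k) (auto simp: place_val_one place_val_mult assms algebra_simps)

lemma place_val_inverse:
  assumes "z \<noteq> 0" shows "pval V (inverse z) = - pval V z"
  using place_val_mult[of z "inverse z"] assms by (simp add: place_val_one)

lemma place_val_divide:
  assumes "z \<noteq> 0" "w \<noteq> 0"
  shows "pval V (z / w) = pval V z - pval V w"
  using assms by (simp add: divide_inverse place_val_mult place_val_inverse)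

lemma place_val_pos_iff:
  assumes "z \<noteq> 0" shows "pval V z > 0 \<longleftrightarrow> z \<in> vring_max V"
proof -
  obtain t where t: "uniformizer V t" using D by (auto simp: discrete_def)
  then have tz: "t \<noteq> 0" "t \<in> vring_max V" by (auto simp: uniformizer_def)
  have *: "z \<in> vring_max V" if pos: "pval V z > 0" and "z \<noteq> 0" for z
  proof -
    obtain u where u: "u \<in> ring_units V" "z = t powi pval V z * u"
      using place_val_decomp[OF V t \<open>z \<noteq> 0\<close>] by blast
    obtain k where k: "pval V z = int (Suc k)"
      using pos by (metis gr0_conv_Suc zero_less_imp_eq_int)
    have "z = t * (t ^ k * u)" by (subst u(2)) (simp only: k power_int_of_nat power_Suc mult.assoc)
    also have "\<dots> \<in> vring_max V"
      by (intro vring_max_mult[OF V tz(2)] subring_mult subring_power vring_subring[OF V]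
          vring_max_mem[OF tz(2)] units_mem[OF u(1)])
    finally show ?thesis .
  qed
  show ?thesis
  proof
    assume z: "z \<in> vring_max V"
    show "pval V z > 0"
    proof (rule ccontr)
      assume "\<not> pval V z > 0"
      then consider "pval V z = 0" | "pval V (inverse z) > 0"
        using place_val_inverse[OF assms] by linarith
      then show False
      proof cases
        case 1
        then obtain u where "u \<in> ring_units V" "z = u"
          using place_val_decomp[OF V t assms] by auto
        then show ?thesis using z vring_max_not_unit by blast
      next
        case 2
        from *[OF this] assms z V show ?thesis by (auto simp: vring_max_iff vring_max_mem)
      qed
    qed
  qed (use * assms in auto)
qed

lemma place_val_nonneg_iff:
  assumes "z \<noteq> 0" shows "pval V z \<ge> 0 \<longleftrightarrow> z \<in> V"
  using place_val_pos_iff[of "inverse z"] assms vring_max_iff[OF V, of "inverse z"]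
  by (auto simp: place_val_inverse)

lemma place_val_const:
  assumes "is_subfield K" "c \<in> K" "c \<noteq> 0" shows "pval V c = 0"
  using assms by (intro place_val_unit units_const[OF assms(1) V])

text \<open>After division by \<open>t powi k\<close> the bound becomes membership in
  \<open>V\<close>, which is closed under addition. The disjuncts with zero are there because
  \<open>place_val\<close> means nothing at zero.\<close>

lemma place_val_add_ge:
  assumes "z + w \<noteq> 0" "z = 0 \<or> pval V z \<ge> k" "w = 0 \<or> pval V w \<ge> k"
  shows "pval V (z + w) \<ge> k"
proof -
  obtain t where t: "uniformizer V t" using D by (auto simp: discrete_def)
  then have tz: "t \<noteq> 0" "t \<in> vring_max V" by (auto simp: uniformizer_def)
  have vt: "pval V (t powi k) = k"
    by (rule place_val_eqI[OF V t units_one[OF vring_subring[OF V]]]) simp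
  have *: "z / t powi k \<in> V \<longleftrightarrow> z = 0 \<or> pval V z \<ge> k" for z
    using place_val_nonneg_iff[of "z / t powi k"] place_val_divide[of z "t powi k"] vt tz
      subring_zero[OF vring_subring[OF V]]
    by (cases "z = 0") auto
  have "(z + w) / t powi k \<in> V"
    using assms(2,3) * subring_add[OF vring_subring[OF V], of "z / t powi k" "w / t powi k"]
    by (simp add: add_divide_distrib)
  then show ?thesis using * assms(1) by blast
qed

lemma place_val_minus: "pval V (- z) = pval V z"
proof (cases "z = 0")
  case False
  have "-1 \<in> ring_units V" using vring_subring[OF V] by (auto simp: ring_units_def subring_intros)
  then show ?thesis using place_val_mult[of "-1" z] place_val_unit[of "-1"] False by simp
qed simp

text \<open>If the value of the sum were larger, then \<open>z\<close>, being the sum minus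
  \<open>w\<close>, would have a value larger than its own.\<close>

lemma place_val_add_eq:
  assumes "z \<noteq> 0" "w = 0 \<or> pval V w > pval V z"
  shows "z + w \<noteq> 0" "pval V (z + w) = pval V z"
proof -
  show nz: "z + w \<noteq> 0"
  proof
    assume "z + w = 0"
    then have "w = - z" by (simp add: add_eq_0_iff)
    then show False using assms place_val_minus[of z] by auto
  qed
  have ge: "pval V (z + w) \<ge> pval V z"
    using assms nz by (intro place_val_add_ge) auto
  have "\<not> pval V (z + w) > pval V z"
  proof
    assume gt: "pval V (z + w) > pval V z"
    have "pval V ((z + w) + (- w)) \<ge> pval V z + 1"
      using assms gt by (intro place_val_add_ge) (auto simp: place_val_minus)
    then show False by simp
  qed
  with ge show "pval V (z + w) = pval V z" by simp
qed

end

section \<open>Existence of places\<close>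

lemma subring_adjoin:
  assumes "is_subring B"
  shows "is_subring {poly p w | p. \<forall>i. coeff p i \<in> B}"
proof -
  let ?S = "{poly p w | p. \<forall>i. coeff p i \<in> B}"
  have "0 \<in> ?S" using assms by (intro CollectI exI[of _ 0]) (auto simp: subring_zero)
  moreover have "1 \<in> ?S"
    using assms by (intro CollectI exI[of _ 1]) (auto simp: subring_zero subring_one coeff_1)
  moreover have "u - v \<in> ?S" if uv: "u \<in> ?S" "v \<in> ?S" for u v
  proof -
    from uv obtain p r where pr: "u = poly p w" "v = poly r w"
      "\<forall>i. coeff p i \<in> B" "\<forall>i. coeff r i \<in> B" by blast
    then show ?thesis using assms by (intro CollectI exI[of _ "p - r"]) (auto simp: subring_diff)
  qed
  moreover have "u * v \<in> ?S" if uv: "u \<in> ?S" "v \<in> ?S" for u v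
  proof -
    from uv obtain p r where pr: "u = poly p w" "v = poly r w"
      "\<forall>i. coeff p i \<in> B" "\<forall>i. coeff r i \<in> B" by blast
    then show ?thesis using assms
      by (intro CollectI exI[of _ "p * r"]) (auto simp: subring_poly_mult)
  qed
  ultimately show ?thesis unfolding is_subring_def by blast
qed

lemma subring_adjoin_supset:
  assumes "is_subring B" shows "B \<subseteq> {poly p w | p. \<forall>i. coeff p i \<in> B}"
proof
  fix c assume "c \<in> B"
  then show "c \<in> {poly p w | p. \<forall>i. coeff p i \<in> B}" using assms
    by (intro CollectI exI[of _ "[:c:]"]) (auto simp: subring_zero coeff_pCons split: nat.split)
qed

lemma subring_adjoin_mem:
  assumes "is_subring B" shows "w \<in> {poly p w | p. \<forall>i. coeff p i \<in> B}"
  using assms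
  by (intro CollectI exI[of _ "[:0, 1:]"]) (auto simp: subring_intros coeff_pCons split: nat.split)


text \<open>
  A subring maximal among those containing \<open>A\<close> but not \<open>inverse t\<close> is a valuation ring.
\<close>

lemma place_exists:
  assumes K: "is_subfield K" and A: "is_subring A" "K \<subseteq> A" and t: "t \<in> A" "inverse t \<notin> A"
  shows "\<exists>V. valuation_ring K V \<and> A \<subseteq> V \<and> t \<in> vring_max V"
proof -
  define Z where "Z = {B. is_subring B \<and> A \<subseteq> B \<and> inverse t \<notin> B}"
  have "\<exists>M\<in>Z. \<forall>X\<in>Z. M \<subseteq> X \<longrightarrow> X = M"
  proof (rule subset_Zorn_nonempty)
    show "Z \<noteq> {}" using A t by (auto simp: Z_def)
    fix C assume C: "C \<noteq> {}" "subset.chain Z C"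
    have mem: "is_subring B" "A \<subseteq> B" "inverse t \<notin> B" if "B \<in> C" for B
      using C(2) that by (auto simp: Z_def subset.chain_def)
    have dir: "\<exists>B\<in>C. u \<in> B \<and> v \<in> B" if uv: "u \<in> \<Union>C" "v \<in> \<Union>C" for u v
      using C(2) uv unfolding subset.chain_def by blast
    have "is_subring (\<Union>C)"
      unfolding is_subring_def
    proof (intro conjI ballI)
      show "0 \<in> \<Union>C" "1 \<in> \<Union>C" using C(1) mem(1) by (auto intro: subring_zero subring_one)
      fix u v assume "u \<in> \<Union>C" "v \<in> \<Union>C"
      then obtain B where "B \<in> C" "u \<in> B" "v \<in> B" using dir by blast
      then show "u - v \<in> \<Union>C" "u * v \<in> \<Union>C"
        using mem(1) by (auto intro: subring_diff subring_mult)
    qed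
    moreover have "A \<subseteq> \<Union>C" using C(1) mem(2) by blast
    ultimately show "\<Union>C \<in> Z" using mem(3) by (auto simp: Z_def)
  qed
  then obtain B where BZ: "B \<in> Z" and maxZ: "\<forall>X\<in>Z. B \<subseteq> X \<longrightarrow> X = B" by blast
  then have B: "is_subring B" "A \<subseteq> B" "inverse t \<notin> B" by (auto simp: Z_def)
  have max: "X = B" if "is_subring X" "B \<subseteq> X" "inverse t \<notin> X" for X
    using maxZ that B(2) unfolding Z_def by blast
  have tB: "t \<in> B" using t B by auto
  have t0: "t \<noteq> 0" using B(3) subring_zero[OF B(1)] by auto
  \<comment> \<open>Maximality of \<open>B\<close>: adjoining any further element already produces
    \<open>inverse t\<close>.\<close>
  have adj: "inverse t \<in> {poly p w | p. \<forall>i. coeff p i \<in> B}" if "w \<notin> B" for w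
    using max[OF subring_adjoin[OF B(1)] subring_adjoin_supset[OF B(1)], of w]
      subring_adjoin_mem[OF B(1), of w] that by blast
  \<comment> \<open>So \<open>t\<close> lies in the Jacobson radical of \<open>B\<close>. All powers
    of \<open>r = 1 - t * c\<close> are 1 modulo \<open>t * B\<close>; clearing denominators in an
    expression of \<open>inverse t\<close> as a polynomial in \<open>inverse r\<close> then puts
    \<open>inverse t\<close> into \<open>B\<close>.\<close>
  have unit: "inverse (1 - t * c) \<in> B" if c: "c \<in> B" for c
  proof (rule ccontr)
    define r where "r = 1 - t * c"
    assume "inverse (1 - t * c) \<notin> B"
    then obtain p where p: "inverse t = poly p (inverse r)" "\<forall>i. coeff p i \<in> B"
      using adj unfolding r_def by blast
    have r0: "r \<noteq> 0"
    proof
      assume "r = 0"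
      then have "inverse t = c" using t0 by (simp add: r_def field_simps)
      then show False using c B by simp
    qed
    have rB: "r \<in> B" unfolding r_def using B(1) tB c by (intro subring_intros)
    have pow: "\<exists>c'\<in>B. r ^ d = 1 - t * c'" for d
    proof (induction d)
      case 0 show ?case using subring_zero[OF B(1)] by (intro bexI[of _ 0]) auto
    next
      case (Suc d)
      then obtain c' where "c' \<in> B" "r ^ d = 1 - t * c'" by blast
      then have "r ^ Suc d = r * (1 - t * c')" by simp
      also have "\<dots> = 1 - t * (c + c' - t * c * c')" by (simp add: r_def algebra_simps)
      finally have "r ^ Suc d = 1 - t * (c + c' - t * c * c')" .
      moreover have "c + c' - t * c * c' \<in> B"
        using B(1) tB c \<open>c' \<in> B\<close> by (intro subring_intros)
      ultimately show ?case by blast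
    qed
    obtain c' where c': "c' \<in> B" "r ^ degree p = 1 - t * c'" using pow by blast
    have "inverse t * r ^ degree p = (\<Sum>i\<le>degree p. coeff p i * r ^ (degree p - i))"
      unfolding p(1) poly_altdef sum_distrib_right
      by (intro sum.cong refl) (use r0 in \<open>auto simp: power_diff power_inverse field_simps\<close>)
    also have "\<dots> \<in> B" using B(1) p(2) rB by (intro subring_intros) auto
    finally have "inverse t - c' \<in> B" unfolding c'(2) using t0 by (simp add: field_simps)
    then have "inverse t - c' + c' \<in> B" using B(1) c'(1) by (intro subring_add)
    then show False using B(3) by simp
  qed
  define P where "P w d \<longleftrightarrow> (\<exists>c. (\<forall>i. c i \<in> B) \<and> inverse t = (\<Sum>i\<le>d. c i * w ^ i))" for w and d :: nat
  \<comment> \<open>The descent of Chevalley's extension theorem: the relation for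
    \<open>inverse w\<close>, divided by the invertible \<open>1 - t * r 0\<close>, expresses
    \<open>w ^ d\<close> by lower powers of \<open>w\<close>, and this shortens the relation for
    \<open>w\<close>.\<close>
  have reduce: "\<exists>d'<d. P w d'" if Pd: "P w d" and Pe: "P (inverse w) e" and "e \<le> d" and w0: "w \<noteq> 0" for w d e
  proof -
    obtain c where c: "\<And>i. c i \<in> B" "inverse t = (\<Sum>i\<le>d. c i * w ^ i)" using Pd by (auto simp: P_def)
    obtain r where r: "\<And>i. r i \<in> B" "inverse t = (\<Sum>i\<le>e. r i * inverse w ^ i)" using Pe by (auto simp: P_def)
    have e: "e > 0"
    proof (rule ccontr)
      assume "\<not> e > 0"
      then have "inverse t = r 0" using r by simp
      then show False using r(1) B(3) by simp
    qed
    define g where "g j = inverse (1 - t * r 0) * t * r j" for j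
    have gB: "g j \<in> B" for j unfolding g_def using B(1) tB r(1) unit[OF r(1)] by (intro subring_intros)
    have nz: "1 - t * r 0 \<noteq> 0"
    proof
      assume "1 - t * r 0 = 0"
      then have "inverse t = r 0" using t0 by (simp add: field_simps)
      then show False using r B by simp
    qed
    have split: "{..e} = insert 0 {1..e}" by auto
    have "1 = t * (\<Sum>i\<le>e. r i * inverse w ^ i)" unfolding r(2)[symmetric] using t0 by simp
    also have "\<dots> = t * r 0 + t * (\<Sum>i\<in>{1..e}. r i * inverse w ^ i)"
      unfolding split by (simp add: algebra_simps)
    finally have "1 - t * r 0 = t * (\<Sum>i\<in>{1..e}. r i * inverse w ^ i)" by (simp add: algebra_simps)
    then have "1 = inverse (1 - t * r 0) * (t * (\<Sum>i\<in>{1..e}. r i * inverse w ^ i))"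
      using nz by (metis left_inverse)
    also have "\<dots> = (\<Sum>i\<in>{1..e}. g i * inverse w ^ i)"
      by (simp add: g_def sum_distrib_left mult.assoc)
    finally have "w ^ d = (\<Sum>i\<in>{1..e}. g i * inverse w ^ i) * w ^ d" by simp
    also have "\<dots> = (\<Sum>i\<in>{1..e}. g i * w ^ (d - i))"
      unfolding sum_distrib_right
      by (intro sum.cong refl) (use w0 \<open>e \<le> d\<close> in \<open>auto simp: power_diff power_inverse field_simps\<close>)
    also have "\<dots> = (\<Sum>i\<in>{d - e..<d}. g (d - i) * w ^ i)"
      by (rule sum.reindex_bij_witness[of _ "\<lambda>i. d - i" "\<lambda>i. d - i"]) (use \<open>e \<le> d\<close> e in auto)
    also have "\<dots> = (\<Sum>i<d. (if d - e \<le> i then g (d - i) else 0) * w ^ i)"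
      by (rule sum.mono_neutral_cong_left) auto
    finally have wd: "w ^ d = (\<Sum>i<d. (if d - e \<le> i then g (d - i) else 0) * w ^ i)" .
    define c' where "c' i = c i + c d * (if d - e \<le> i then g (d - i) else 0)" for i
    have c'B: "c' i \<in> B" for i unfolding c'_def using B(1) c(1) gB by (auto intro!: subring_intros)
    obtain d' where d': "d = Suc d'" using e \<open>e \<le> d\<close> by (cases d) auto
    have "inverse t = (\<Sum>i<d. c i * w ^ i) + c d * w ^ d"
      unfolding c(2) by (simp add: d' lessThan_Suc_atMost)
    also have "\<dots> = (\<Sum>i<d. c' i * w ^ i)"
      by (subst wd) (simp add: c'_def sum_distrib_left algebra_simps sum.distrib)
    finally have "P w d'" using c'B unfolding P_def d' lessThan_Suc_atMost by blast
    then show ?thesis using d' by auto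
  qed
  have ex: "\<exists>d. P w d" if "w \<notin> B" for w
  proof -
    from adj[OF that] obtain p where "inverse t = poly p w" "\<forall>i. coeff p i \<in> B" by blast
    then show ?thesis unfolding P_def poly_altdef by (intro exI[of _ "degree p"] exI[of _ "coeff p"]) auto
  qed
  have val: "w \<in> B \<or> inverse w \<in> B" for w
  proof (rule ccontr)
    assume "\<not> (w \<in> B \<or> inverse w \<in> B)"
    then have w: "w \<notin> B" "inverse w \<notin> B" by auto
    then have w0: "w \<noteq> 0" using subring_zero[OF B(1)] by auto
    \<comment> \<open>With both lengths minimal, \<open>reduce\<close> contradicts the longer of the
      two relations.\<close>
    define d where "d = (LEAST d. P w d)"
    define e where "e = (LEAST d. P (inverse w) d)"
    have d: "P w d" "\<And>k. k < d \<Longrightarrow> \<not> P w k" using LeastI_ex[OF ex[OF w(1)]] not_less_Least by (auto simp: d_def)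
    have e: "P (inverse w) e" "\<And>k. k < e \<Longrightarrow> \<not> P (inverse w) k"
      using LeastI_ex[OF ex[OF w(2)]] not_less_Least by (auto simp: e_def)
    show False
    proof (cases "e \<le> d")
      case True
      from reduce[OF d(1) e(1) True w0] d(2) show False by blast
    next
      case False
      from reduce[OF e(1), of d] d(1) False w0 e(2) show False by auto
    qed
  qed
  have "t \<notin> K" using K t A by (auto simp: is_subfield_def)
  then have VB: "valuation_ring K B" using B A tB val by (auto simp: valuation_ring_def)
  then show ?thesis using B t0 by (auto simp: vring_max_iff)
qed

section \<open>The curve\<close>

text \<open>Here \<open>2 * Q\<close> is q. The assumption \<open>fibre\<close> supplies the
  rational points over each abscissa; for \<open>c = 0\<close> it places all zeros of
  \<open>h\<close> in \<open>K\<close>, which makes the field a Galois extension of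
  \<open>K(x)\<close>.\<close>

locale curve =
  fixes K :: "'a::field set" and x y :: 'a and n Q :: nat
  assumes n: "n \<ge> 2" and Q_eq: "Q = 2 ^ (n - 1)" and K: "is_subfield K"
    and card_K: "card K = 4 * Q ^ 2" and trans: "transcendental_over K x"
    and curve_eq: "x ^ (2 * Q + 1) = h_poly n y"
    and gen: "is_subfield hull (K \<union> {x, y}) = UNIV"
    and fibre: "\<And>c. c \<in> K \<Longrightarrow> card {d \<in> K. h_poly n d = c ^ (2 * Q + 1)} = Q"
begin

section \<open>Characteristic two and the additive polynomial \<open>h\<close>\<close>

lemma Q_ge: "Q \<ge> 2"
proof -
  obtain k where "n - 1 = Suc k" using n by (cases "n - 1") auto
  then show ?thesis by (simp add: Q_eq)
qed

lemma finite_K: "finite K"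
  using card_K Q_ge by (intro card_ge_0_finite) auto

lemma K_subring: "is_subring K"
  using K by (simp add: is_subfield_def)

lemma K_inverse: "c \<in> K \<Longrightarrow> inverse c \<in> K"
  using K by (simp add: is_subfield_def)

lemma K_divide: "c \<in> K \<Longrightarrow> d \<in> K \<Longrightarrow> c / d \<in> K"
  by (simp add: divide_inverse K_inverse subring_mult[OF K_subring])

lemmas K_intros = subring_intros[OF K_subring] K_inverse K_divide

text \<open>Translation by 1 permutes \<open>K\<close>, so comparing sums over \<open>K\<close>
  gives \<open>card K = 0\<close> in the field, and \<open>card K\<close> is a power of two.\<close>

lemma two_eq_zero: "(2 :: 'a) = 0"
proof -
  have "(\<Sum>c\<in>K. c) = (\<Sum>c\<in>K. c + 1)"
    by (rule sum.reindex_bij_witness[of _ "\<lambda>c. c + 1" "\<lambda>c. c - 1"]) (auto intro!: K_intros)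
  then have "of_nat (card K) = (0 :: 'a)" by (simp add: sum.distrib)
  moreover have "(of_nat (card K) :: 'a) = 2 ^ (2 + 2 * (n - 1))"
    by (simp add: card_K Q_eq power_add power_mult power2_eq_square mult.commute)
       (simp add: power_mult_distrib[symmetric])
  ultimately have "(2 :: 'a) ^ (2 + 2 * (n - 1)) = 0" by metis
  then show ?thesis by (metis power_not_zero)
qed

lemma add_self: "(a :: 'a) + a = 0"
  using two_eq_zero by (metis mult_2 mult_zero_left)

lemma minus_eq: "- (a :: 'a) = a"
  using add_self[of a] by (simp add: minus_unique)

lemma diff_eq: "(a :: 'a) - b = a + b"
  using minus_eq[of b] by (metis add_uminus_conv_diff)

lemma frobenius: "((a :: 'a) + b) ^ (2 ^ i) = a ^ (2 ^ i) + b ^ (2 ^ i)"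
proof (induction i)
  case (Suc i)
  have "(a + b) ^ (2 ^ Suc i) = ((a + b) ^ (2 ^ i)) ^ 2" by (simp add: power_mult[symmetric] mult.commute)
  also have "\<dots> = a ^ (2 ^ Suc i) + b ^ (2 ^ Suc i)"
    unfolding Suc.IH using two_eq_zero by (simp add: power2_sum power_mult[symmetric] mult.commute)
  finally show ?case .
qed simp

lemma h_add: "h_poly n (a + b) = h_poly n a + h_poly n (b :: 'a)"
  by (simp add: h_poly_def frobenius sum.distrib)

lemma h_zero: "h_poly n (0 :: 'a) = 0"
  by (simp add: h_poly_def power_0_left)

lemma h_top: "h_poly n (z :: 'a) = z ^ Q + (\<Sum>i<n - 1. z ^ (2 ^ i))"
proof -
  obtain k where k: "n = Suc k" using n by (cases n) auto
  show ?thesis by (simp add: h_poly_def Q_eq k)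
qed

text \<open>Splitting off the linear term serves at zeros of \<open>z\<close>, as
  \<open>h_top\<close> serves at poles: there the other factor is a unit by \<open>h_small\<close>,
  so \<open>h_poly n z\<close> and \<open>z\<close> vanish to the same order.\<close>

lemma h_bot: "h_poly n (z :: 'a) = z * (1 + (\<Sum>i\<in>{1..<n}. z ^ (2 ^ i - 1)))"
proof -
  have "h_poly n z = z + (\<Sum>i\<in>{1..<n}. z ^ (2 ^ i))"
  proof -
    have "{..<n} = insert 0 {1..<n}" using n by auto
    then show ?thesis by (simp add: h_poly_def)
  qed
  also have "(\<Sum>i\<in>{1..<n}. z ^ (2 ^ i)) = (\<Sum>i\<in>{1..<n}. z * z ^ (2 ^ i - 1))"
    by (intro sum.cong refl) (simp flip: power_Suc)
  finally show ?thesis by (simp add: algebra_simps sum_distrib_left)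
qed

lemma h_small:
  assumes V: "valuation_ring K V" and z: "z \<in> vring_max V"
  shows "1 + (\<Sum>i\<in>{1..<n}. z ^ (2 ^ i - 1)) \<in> ring_units V"
proof (rule unit_add_max[OF V units_one[OF vring_subring[OF V]] vring_max_sum[OF V]])
  fix i assume "i \<in> {1..<n}"
  then have "(2 :: nat) ^ 1 \<le> 2 ^ i" by (intro power_increasing) auto
  then obtain l where l: "(2 :: nat) ^ i - 1 = Suc l" by (cases "(2 :: nat) ^ i - 1") auto
  show "z ^ (2 ^ i - 1) \<in> vring_max V" unfolding l power_Suc
    by (rule vring_max_mult[OF V z subring_power[OF vring_subring[OF V] vring_max_mem[OF z]]])
qed

lemma pow2_less_Q: "i < n - 1 \<Longrightarrow> 2 ^ i < Q"
  by (simp add: Q_eq)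

text \<open>Multiplication by a nonzero \<open>c\<close> permutes the nonzero elements of
  \<open>K\<close>; comparing products gives \<open>c ^ (card K - 1) = 1\<close>.\<close>

lemma K_power: "c \<in> K \<Longrightarrow> c ^ (4 * Q ^ 2) = c"
proof (cases "c = 0")
  case False
  assume c: "c \<in> K"
  let ?K = "K - {0}"
  have "(\<Prod>d\<in>?K. d) = (\<Prod>d\<in>?K. c * d)"
    by (rule sym, rule prod.reindex_bij_witness[of _ "\<lambda>d. d / c" "\<lambda>d. c * d"])
       (use False c in \<open>auto intro!: K_intros\<close>)
  also have "\<dots> = c ^ card ?K * (\<Prod>d\<in>?K. d)" by (simp add: prod.distrib)
  finally have "c ^ card ?K = 1" using finite_K by (simp add: prod_zero_iff)
  moreover have "card K = Suc (card ?K)"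
    using finite_K subring_zero[OF K_subring] by (metis card.remove)
  ultimately show ?thesis by (metis card_K mult.right_neutral power_Suc)
qed (use Q_ge in auto)

text \<open>The translates \<open>y + e\<close> by this group are the conjugates of \<open>y\<close>
  over \<open>K(x)\<close>. By \<open>card_ker\<close> there are \<open>Q\<close> of them, the
  degree of \<open>h\<close>.\<close>

definition ker_h :: "'a set" where "ker_h = {e \<in> K. h_poly n e = 0}"

lemma ker_K: "e \<in> ker_h \<Longrightarrow> e \<in> K"
  and ker_h: "e \<in> ker_h \<Longrightarrow> h_poly n e = 0"
  and ker_0: "0 \<in> ker_h"
  and ker_add: "e \<in> ker_h \<Longrightarrow> e' \<in> ker_h \<Longrightarrow> e + e' \<in> ker_h"
  by (auto simp: ker_h_def h_zero h_add intro!: K_intros)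

lemma card_ker: "card ker_h = Q"
  using fibre[of 0] Q_ge subring_zero[OF K_subring] by (simp add: ker_h_def)

lemma finite_ker: "finite ker_h"
  using finite_K by (simp add: ker_h_def)

text \<open>The rewriting rule that brings every exponent of \<open>y\<close> below
  \<open>Q\<close>.\<close>

lemma y_power_Q: "y ^ Q = x ^ (2 * Q + 1) + (\<Sum>i<n - 1. y ^ (2 ^ i))"
  using h_top[of y] curve_eq by (simp add: add.assoc add_self)

section \<open>The affine coordinate ring\<close>

text \<open>The pole order of \<open>x^i y^j\<close> at infinity.\<close>

definition wt :: "nat \<times> nat \<Rightarrow> nat" where "wt k = fst k * Q + snd k * (2 * Q + 1)"

text \<open>The bound \<open>snd k < Q\<close> selects the monomials that are reduced modulo the
  curve equation; by \<open>wt_inj\<close> their pole orders are pairwise distinct.\<close>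

definition exps :: "nat \<Rightarrow> (nat \<times> nat) set" where "exps s = {k. snd k < Q \<and> wt k \<le> s}"

text \<open>The two functions are parameters because the same coefficients are used with
  \<open>x\<close> and \<open>y\<close>, with their images under a homomorphism, and with the
  coordinates of a point.\<close>

definition msum :: "(nat \<times> nat \<Rightarrow> 'a) \<Rightarrow> 'a \<Rightarrow> 'a \<Rightarrow> (nat \<times> nat) set \<Rightarrow> 'a" where
  "msum c f g M = (\<Sum>k\<in>M. c k * (f ^ fst k * g ^ snd k))"

text \<open>Introduced as a span, so that it can be computed with before any pole order is known;
  \<open>RR_space_eq\<close> identifies it with the Riemann-Roch space of the one-point
  divisor.\<close>

definition Lspace :: "nat \<Rightarrow> 'a set" where
  "Lspace s = {msum c x y (exps s) | c. \<forall>k. c k \<in> K}"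

definition aff :: "'a set" where "aff = (\<Union>s. Lspace s)"

lemma finite_exps: "finite (exps s)"
proof (rule finite_subset)
  show "exps s \<subseteq> {..s} \<times> {..<Q}"
  proof
    fix k assume k: "k \<in> exps s"
    have "fst k \<le> fst k * Q" using Q_ge by simp
    also have "\<dots> \<le> s" using k by (simp add: exps_def wt_def)
    finally have "fst k \<le> s" .
    then show "k \<in> {..s} \<times> {..<Q}" using k by (cases k) (auto simp: exps_def)
  qed
qed auto

text \<open>Division with remainder by \<open>Q\<close> recovers the exponents, since
  \<open>2 * Q + 1\<close> is 1 modulo \<open>Q\<close>.\<close>

lemma wt_div_mod:
  assumes "snd k < Q" shows "wt k mod Q = snd k" "wt k div Q = fst k + 2 * snd k"
proof -
  have "wt k = snd k + Q * (fst k + 2 * snd k)" by (simp add: wt_def algebra_simps)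
  then show "wt k mod Q = snd k" "wt k div Q = fst k + 2 * snd k" using assms by auto
qed

lemma wt_inj:
  assumes "snd k < Q" "snd k' < Q" "wt k = wt k'" shows "k = k'"
  using wt_div_mod[OF assms(1)] wt_div_mod[OF assms(2)] assms(3) by (cases k; cases k') auto

text \<open>The exponents are forced by \<open>wt_div_mod\<close>; the hypothesis keeps the
  subtraction in the exponent of \<open>x\<close> from being truncated.\<close>

lemma wt_ex:
  assumes "2 * (s mod Q) \<le> s div Q"
  shows "wt (s div Q - 2 * (s mod Q), s mod Q) = s"
proof -
  obtain i where i: "s div Q = i + 2 * (s mod Q)" using assms by (metis add.commute le_Suc_ex)
  have "s = Q * (s div Q) + s mod Q" by simp
  also have "\<dots> = Q * (i + 2 * (s mod Q)) + s mod Q" by (simp add: i)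
  finally show ?thesis by (simp add: wt_def i algebra_simps)
qed

lemma Lspace_mono:
  assumes "s \<le> s'" shows "Lspace s \<subseteq> Lspace s'"
proof
  fix z assume "z \<in> Lspace s"
  then obtain c where c: "\<forall>k. c k \<in> K" "z = msum c x y (exps s)" by (auto simp: Lspace_def)
  define c' where "c' k = (if k \<in> exps s then c k else 0)" for k
  have "z = msum c' x y (exps s')"
    unfolding c(2) msum_def
    by (rule sum.mono_neutral_cong_left) (use assms finite_exps in \<open>auto simp: c'_def exps_def\<close>)
  moreover have "\<forall>k. c' k \<in> K" using c(1) by (auto simp: c'_def intro: K_intros)
  ultimately show "z \<in> Lspace s'" by (auto simp: Lspace_def)
qed

lemma Lspace_add:
  assumes "u \<in> Lspace s" "v \<in> Lspace s" shows "u + v \<in> Lspace s"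
proof -
  obtain c d where c: "\<forall>k. c k \<in> K" "u = msum c x y (exps s)" "\<forall>k. d k \<in> K" "v = msum d x y (exps s)"
    using assms by (auto simp: Lspace_def)
  have "u + v = msum (\<lambda>k. c k + d k) x y (exps s)"
    unfolding c msum_def by (simp add: sum.distrib algebra_simps)
  moreover have "\<forall>k. c k + d k \<in> K" using c by (auto intro: K_intros)
  ultimately show ?thesis unfolding Lspace_def by blast
qed

lemma Lspace_scale:
  assumes "u \<in> Lspace s" "a \<in> K" shows "a * u \<in> Lspace s"
proof -
  obtain c where c: "\<forall>k. c k \<in> K" "u = msum c x y (exps s)"
    using assms by (auto simp: Lspace_def)
  have "a * u = msum (\<lambda>k. a * c k) x y (exps s)"
    unfolding c msum_def by (simp add: sum_distrib_left algebra_simps)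
  moreover have "\<forall>k. a * c k \<in> K" using c assms by (auto intro: K_intros)
  ultimately show ?thesis unfolding Lspace_def by blast
qed

lemma Lspace_zero: "0 \<in> Lspace s"
  unfolding Lspace_def by (rule CollectI, rule exI[of _ "\<lambda>_. 0"]) (auto simp: msum_def intro: K_intros)

lemma Lspace_diff: "u \<in> Lspace s \<Longrightarrow> v \<in> Lspace s \<Longrightarrow> u - v \<in> Lspace s"
  using Lspace_add by (simp add: diff_eq)

lemma Lspace_sum: "(\<And>i. i \<in> I \<Longrightarrow> f i \<in> Lspace s) \<Longrightarrow> sum f I \<in> Lspace s"
  by (induction I rule: infinite_finite_induct) (auto intro: Lspace_zero Lspace_add)

text \<open>Replacing \<open>y ^ Q\<close> by the curve equation keeps the weight in the term with
  \<open>x ^ (2 * Q + 1)\<close>, because both have weight \<open>Q * (2 * Q + 1)\<close>, and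
  lowers it in the other terms, while the exponent of \<open>y\<close> always decreases.\<close>

lemma monom_Lspace: "x ^ i * y ^ j \<in> Lspace (i * Q + j * (2 * Q + 1))"
proof (induction j arbitrary: i rule: less_induct)
  case (less j)
  let ?s = "i * Q + j * (2 * Q + 1)"
  show ?case
  proof (cases "j < Q")
    case True
    then have "(i, j) \<in> exps ?s" by (simp add: exps_def wt_def)
    then have "x ^ i * y ^ j = msum (\<lambda>k. if k = (i, j) then 1 else 0) x y (exps ?s)"
      using finite_exps by (simp add: msum_def if_distrib[of "\<lambda>u. u * _"] cong: if_cong)
    then show ?thesis unfolding Lspace_def
      by (intro CollectI exI[of _ "\<lambda>k. if k = (i, j) then 1 else 0"]) (auto intro: K_intros)
  next
    case False
    then obtain l where l: "j = l + Q" by (metis add.commute le_Suc_ex not_less)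
    have eq: "x ^ i * y ^ j = x ^ (i + 2 * Q + 1) * y ^ l + (\<Sum>d<n - 1. x ^ i * y ^ (l + 2 ^ d))"
      by (simp add: l power_add y_power_Q algebra_simps sum_distrib_left)
    have "x ^ (i + 2 * Q + 1) * y ^ l \<in> Lspace ((i + 2 * Q + 1) * Q + l * (2 * Q + 1))"
      using less.IH[of l "i + 2 * Q + 1"] l Q_ge by auto
    also have "(i + 2 * Q + 1) * Q + l * (2 * Q + 1) = ?s" by (simp add: l algebra_simps)
    finally have 1: "x ^ (i + 2 * Q + 1) * y ^ l \<in> Lspace ?s" .
    have 2: "x ^ i * y ^ (l + 2 ^ d) \<in> Lspace ?s" if "d < n - 1" for d
    proof -
      have d: "l + 2 ^ d < j" using pow2_less_Q[OF that] l by simp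
      have "i * Q + (l + 2 ^ d) * (2 * Q + 1) \<le> ?s" using d by (intro add_left_mono mult_right_mono) auto
      then show ?thesis using less.IH[OF d, of i] Lspace_mono by blast
    qed
    show ?thesis unfolding eq using 1 2 by (intro Lspace_add Lspace_sum) auto
  qed
qed

lemma Lspace_mult:
  assumes "u \<in> Lspace s" "v \<in> Lspace s'" shows "u * v \<in> Lspace (s + s')"
proof -
  obtain c d where c: "\<forall>k. c k \<in> K" "u = msum c x y (exps s)" "\<forall>k. d k \<in> K" "v = msum d x y (exps s')"
    using assms by (auto simp: Lspace_def)
  have "u * v = (\<Sum>k\<in>exps s. \<Sum>l\<in>exps s'. (c k * d l) * (x ^ (fst k + fst l) * y ^ (snd k + snd l)))"
    unfolding c msum_def sum_product by (simp add: power_add algebra_simps)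
  also have "\<dots> \<in> Lspace (s + s')"
  proof (intro Lspace_sum, rule Lspace_scale)
    fix k l assume kl: "k \<in> exps s" "l \<in> exps s'"
    have "(fst k + fst l) * Q + (snd k + snd l) * (2 * Q + 1) = wt k + wt l"
      by (simp add: wt_def algebra_simps)
    then have "(fst k + fst l) * Q + (snd k + snd l) * (2 * Q + 1) \<le> s + s'"
      using kl by (simp add: exps_def)
    then show "x ^ (fst k + fst l) * y ^ (snd k + snd l) \<in> Lspace (s + s')"
      using monom_Lspace Lspace_mono by blast
    show "c k * d l \<in> K" using c(1,3) by (blast intro: subring_mult[OF K_subring])
  qed
  finally show ?thesis .
qed

lemma Lspace_power:
  assumes "r \<in> Lspace s" shows "r ^ k \<in> Lspace (k * s)"
proof (induction k)
  case 0 then show ?case using monom_Lspace[of 0 0] by simp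
next
  case (Suc k) then show ?case using Lspace_mult[OF assms Suc.IH] by simp
qed

lemma const_Lspace: "c \<in> K \<Longrightarrow> c \<in> Lspace s"
  using Lspace_scale[of "x ^ 0 * y ^ 0" 0 c] monom_Lspace[of 0 0] Lspace_mono[of 0 s] by auto

lemma x_Lspace: "x \<in> Lspace Q" using monom_Lspace[of 1 0] by simp
lemma y_Lspace: "y \<in> Lspace (2 * Q + 1)" using monom_Lspace[of 0 1] by simp

lemma aff_common:
  assumes "u \<in> aff" "v \<in> aff" shows "\<exists>s. u \<in> Lspace s \<and> v \<in> Lspace s"
  using assms Lspace_mono unfolding aff_def by (metis UN_iff linear subsetD)

lemma aff_subring: "is_subring aff"
  unfolding is_subring_def
proof (intro conjI ballI)
  show "0 \<in> aff" "1 \<in> aff"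
    using Lspace_zero const_Lspace[of 1] subring_one[OF K_subring] by (auto simp: aff_def)
  fix u v assume "u \<in> aff" "v \<in> aff"
  then obtain s where "u \<in> Lspace s" "v \<in> Lspace s" using aff_common by blast
  then show "u - v \<in> aff" "u * v \<in> aff"
    using Lspace_diff[of u s v] Lspace_mult[of u s v s] by (auto simp: aff_def)
qed

lemmas aff_intros = subring_intros[OF aff_subring]

lemma K_aff: "c \<in> K \<Longrightarrow> c \<in> aff" using const_Lspace by (auto simp: aff_def)
lemma x_aff: "x \<in> aff" using x_Lspace by (auto simp: aff_def)
lemma y_aff: "y \<in> aff" using y_Lspace by (auto simp: aff_def)
lemma Lspace_aff: "u \<in> Lspace s \<Longrightarrow> u \<in> aff" by (auto simp: aff_def)

text \<open>Elements of \<open>aff\<close> are polynomials in \<open>x\<close> and \<open>y\<close>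
  over \<open>K\<close>. Membership in \<open>aff\<close> is supplied in the last two cases because
  the rules for evaluating at a point ask for it.\<close>

lemma aff_induct [consumes 1, case_names const x y add mult]:
  assumes "r \<in> aff" and c: "\<And>c. c \<in> K \<Longrightarrow> P c" and x: "P x" and y: "P y"
    and add: "\<And>u v. u \<in> aff \<Longrightarrow> v \<in> aff \<Longrightarrow> P u \<Longrightarrow> P v \<Longrightarrow> P (u + v)"
    and mult: "\<And>u v. u \<in> aff \<Longrightarrow> v \<in> aff \<Longrightarrow> P u \<Longrightarrow> P v \<Longrightarrow> P (u * v)"
  shows "P r"
proof -
  obtain s c where c': "\<forall>k. c k \<in> K" "r = msum c x y (exps s)"
    using assms(1) by (auto simp: aff_def Lspace_def)
  have pw: "u ^ i \<in> aff \<and> P (u ^ i)" if "u \<in> aff" "P u" for u i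
    using that assms(2)[of 1] mult by (induction i) (auto intro!: K_intros aff_intros)
  have "(\<Sum>k\<in>M. c k * (x ^ fst k * y ^ snd k)) \<in> aff \<and> P (\<Sum>k\<in>M. c k * (x ^ fst k * y ^ snd k))"
    if "finite M" for M
    using that
  proof (induction M)
    case empty then show ?case using assms(2)[of 0] by (auto intro!: K_intros aff_intros)
  next
    case (insert k M)
    have "x ^ fst k * y ^ snd k \<in> aff \<and> P (x ^ fst k * y ^ snd k)"
      using pw[OF x_aff x] pw[OF y_aff y] mult by (auto intro!: subring_mult[OF aff_subring])
    then have "c k * (x ^ fst k * y ^ snd k) \<in> aff \<and> P (c k * (x ^ fst k * y ^ snd k))"
      using mult[of "c k"] c'(1)[rule_format, of k] assms(2)[of "c k"] K_aff[of "c k"]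
      by (auto intro!: aff_intros)
    then show ?case using insert add by (auto intro!: aff_intros)
  qed
  then show ?thesis using finite_exps by (simp add: c'(2) msum_def)
qed

text \<open>The quotients form a subfield containing \<open>K\<close>, \<open>x\<close> and
  \<open>y\<close>, and by \<open>gen\<close> the only such subfield is the whole field.\<close>

lemma fraction: "\<exists>u\<in>aff. \<exists>w\<in>aff. w \<noteq> 0 \<and> (z :: 'a) = u / w"
proof -
  define F where "F = {u / w | u w. u \<in> aff \<and> w \<in> aff \<and> w \<noteq> 0}"
  have inF: "u / w \<in> F" if "u \<in> aff" "w \<in> aff" "w \<noteq> 0" for u w using that by (auto simp: F_def)
  have one: "1 \<in> aff" by (intro aff_intros)
  have aF: "u \<in> F" if "u \<in> aff" for u using inF[OF that one] by simp
  have "is_subfield F"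
    unfolding is_subfield_def is_subring_def
  proof (intro conjI ballI)
    show "0 \<in> F" "1 \<in> F" by (auto intro!: aF aff_intros)
    fix a assume "a \<in> F"
    then obtain u w where a: "a = u / w" "u \<in> aff" "w \<in> aff" "w \<noteq> 0" by (auto simp: F_def)
    show "inverse a \<in> F" using a inF[of w u] aF[of 0] by (cases "u = 0") (auto intro: aff_intros)
    fix b assume "b \<in> F"
    then obtain u' w' where b: "b = u' / w'" "u' \<in> aff" "w' \<in> aff" "w' \<noteq> 0" by (auto simp: F_def)
    have "a - b = (u * w' - u' * w) / (w * w')" using a(4) b(4) by (simp add: a(1) b(1) diff_frac_eq)
    also have "\<dots> \<in> F" using a b by (intro inF aff_intros) auto
    finally show "a - b \<in> F" .
    have "a * b = (u * u') / (w * w')" using a b by simp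
    also have "\<dots> \<in> F" using a b by (intro inF aff_intros) auto
    finally show "a * b \<in> F" .
  qed
  then have "is_subfield hull (K \<union> {x, y}) \<subseteq> F"
    using aF K_aff x_aff y_aff by (intro hull_minimal) auto
  then have "z \<in> F" using gen by auto
  then show ?thesis by (auto simp: F_def)
qed

section \<open>The place at infinity\<close>

text \<open>Distinct exponents have distinct weights, so once the largest power of
  \<open>inverse t\<close> is taken out, all other terms are nonunits. Pole orders are written as
  explicit powers of \<open>inverse t\<close>, since the discreteness at infinity is itself derived
  from this lemma.\<close>

lemma msum_lead:
  assumes V: "valuation_ring K V" and t: "t \<in> vring_max V" "t \<noteq> 0"
    and f: "u \<in> ring_units V" "f = inverse t ^ Q * u"
    and g: "v \<in> ring_units V" "g = inverse t ^ (2 * Q + 1) * v"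
    and M: "finite M" "\<And>k. k \<in> M \<Longrightarrow> snd k < Q" and c: "\<And>k. c k \<in> K"
    and k0: "k0 \<in> M" "c k0 \<noteq> 0" "\<And>k. k \<in> M \<Longrightarrow> c k \<noteq> 0 \<Longrightarrow> wt k \<le> wt k0"
  shows "\<exists>e\<in>ring_units V. msum c f g M = inverse t ^ wt k0 * e"
proof -
  define e where "e k = (if c k = 0 then 0 else t ^ (wt k0 - wt k) * (c k * (u ^ fst k * v ^ snd k)))" for k
  have V': "is_subring V" using V by (rule vring_subring)
  have unit: "c k * (u ^ fst k * v ^ snd k) \<in> ring_units V" if "c k \<noteq> 0" for k
    using that c by (intro units_mult units_power V' f(1) g(1) units_const[OF K V])
  have trm: "c k * (f ^ fst k * g ^ snd k) = inverse t ^ wt k0 * e k" if "k \<in> M" for k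
  proof (cases "c k = 0")
    case False
    have le: "wt k \<le> wt k0" using k0(3)[OF that False] .
    have "f ^ fst k * g ^ snd k = inverse t ^ wt k * (u ^ fst k * v ^ snd k)"
      by (simp add: f(2) g(2) power_mult_distrib wt_def power_add power_mult[symmetric] mult_ac)
    moreover have "inverse t ^ wt k = inverse t ^ wt k0 * t ^ (wt k0 - wt k)"
      using t(2) le by (simp add: power_diff power_inverse field_simps)
    ultimately show ?thesis using False by (simp add: e_def mult_ac)
  qed (simp add: e_def)
  have small: "e k \<in> vring_max V" if "k \<in> M" "k \<noteq> k0" for k
  proof (cases "c k = 0")
    case False
    have "wt k \<le> wt k0" using k0(3)[OF that(1) False] .
    moreover have "wt k \<noteq> wt k0" using wt_inj that M(2) k0(1) by blast
    ultimately obtain d where d: "wt k0 - wt k = Suc d" by (metis Suc_diff_Suc le_neq_implies_less)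
    have "e k = t * (t ^ d * (c k * (u ^ fst k * v ^ snd k)))" using False by (simp add: e_def d)
    also have "\<dots> \<in> vring_max V"
      by (rule vring_max_mult[OF V t(1) subring_mult[OF V' subring_power[OF V' vring_max_mem[OF t(1)]]
              units_mem[OF unit[OF False]]]])
    finally show ?thesis .
  qed (simp add: e_def vring_max_zero[OF V])
  have "msum c f g M = (\<Sum>k\<in>M. inverse t ^ wt k0 * e k)"
    unfolding msum_def by (intro sum.cong refl trm)
  also have "\<dots> = inverse t ^ wt k0 * (e k0 + (\<Sum>k\<in>M - {k0}. e k))"
    using M(1) k0(1) by (simp add: sum_distrib_left[symmetric] sum.remove)
  finally have eq: "msum c f g M = inverse t ^ wt k0 * (e k0 + (\<Sum>k\<in>M - {k0}. e k))" .
  have "e k0 + (\<Sum>k\<in>M - {k0}. e k) \<in> ring_units V"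
  proof (rule unit_add_max[OF V])
    show "e k0 \<in> ring_units V" using unit[OF k0(2)] k0(2) by (simp add: e_def)
    show "(\<Sum>k\<in>M - {k0}. e k) \<in> vring_max V" by (rule vring_max_sum[OF V]) (use small in auto)
  qed
  with eq show ?thesis by blast
qed

text \<open>At a pole the top term dominates: the other exponents are powers of two below
  \<open>Q\<close>.\<close>

lemma h_pole:
  assumes V: "valuation_ring K V" and z: "z \<notin> V"
  shows "\<exists>u\<in>ring_units V. h_poly n z = z ^ Q * u"
proof -
  have V': "is_subring V" using V by (rule vring_subring)
  have z0: "z \<noteq> 0" using z subring_zero[OF V'] by auto
  have iz: "inverse z \<in> vring_max V" using not_in_vring_inverse_max[OF V z] .
  have "z ^ 2 ^ i / z ^ Q \<in> vring_max V" if "i < n - 1" for i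
  proof -
    have "2 ^ i < Q" using that by (rule pow2_less_Q)
    then obtain d where d: "Q = 2 ^ i + Suc d" using less_iff_Suc_add by auto
    have "z ^ 2 ^ i / z ^ Q = inverse z * inverse z ^ d"
      using z0 by (simp add: d power_add field_simps power_inverse)
    then show ?thesis
      using vring_max_mult[OF V iz subring_power[OF V' vring_max_mem[OF iz]]] by simp
  qed
  then have "(\<Sum>i<n - 1. z ^ 2 ^ i / z ^ Q) \<in> vring_max V" by (intro vring_max_sum[OF V]) auto
  from unit_add_max[OF V units_one[OF V'] this]
  have "1 + (\<Sum>i<n - 1. z ^ 2 ^ i / z ^ Q) \<in> ring_units V" .
  moreover have "h_poly n z = z ^ Q * (1 + (\<Sum>i<n - 1. z ^ 2 ^ i / z ^ Q))"
    using z0 by (simp add: h_top distrib_left sum_distrib_left)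
  ultimately show ?thesis by blast
qed

text \<open>If \<open>y\<close> is finite, so is a power of \<open>x\<close>. If \<open>y\<close>
  had a pole where \<open>x\<close> is finite, \<open>h_pole\<close> would make \<open>y ^ Q\<close>
  a unit times a power of \<open>x\<close>, hence finite.\<close>

lemma y_mem_iff:
  assumes V: "valuation_ring K V" shows "y \<in> V \<longleftrightarrow> x \<in> V"
proof -
  have V': "is_subring V" using V by (rule vring_subring)
  show ?thesis
  proof
    assume "y \<in> V"
    then have "x ^ (2 * Q + 1) \<in> V" unfolding curve_eq h_poly_def by (intro subring_intros V')
    then show "x \<in> V" by (rule vring_power_mem[OF V]) simp
  next
    assume xV: "x \<in> V"
    show "y \<in> V"
    proof (rule ccontr)
      assume yV: "y \<notin> V"
      then obtain u where u: "u \<in> ring_units V" "x ^ (2 * Q + 1) = y ^ Q * u"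
        using h_pole[OF V yV] curve_eq by auto
      have "y ^ Q = x ^ (2 * Q + 1) * inverse u" using u(2) units_nonzero[OF u(1)] by (simp add: field_simps)
      also have "\<dots> \<in> V" using xV units_mem[OF units_inverse[OF u(1)]] by (intro subring_intros V')
      finally have "y \<in> V" using vring_power_mem[OF V, of y Q] Q_ge by simp
      then show False using yV by simp
    qed
  qed
qed

lemma x_nonzero: "x \<noteq> 0"
proof
  assume "x = 0"
  then have "poly [:0, 1:] x = 0" by simp
  moreover have "coeff [:0, 1 :: 'a:] i \<in> K" for i by (auto simp: coeff_pCons K_intros split: nat.split)
  ultimately show False using trans unfolding transcendental_over_def by (metis pCons_eq_0_iff zero_neq_one)
qed

text \<open>A uniformizer at infinity, since \<open>2 Q - (2 Q + 1) = -1\<close>.\<close>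

definition tinf :: 'a where "tinf = x ^ 2 / y"

text \<open>With \<open>u\<close> the unit of \<open>h_pole\<close>, the curve equation gives
  \<open>x * tinf ^ Q = u\<close> and \<open>y * tinf ^ (2 * Q + 1) = u ^ 2\<close>.\<close>

lemma infinity_param:
  assumes V: "valuation_ring K V" and xV: "x \<notin> V"
  shows "tinf \<noteq> 0" "tinf \<in> vring_max V"
    "\<exists>u\<in>ring_units V. x = inverse tinf ^ Q * u"
    "\<exists>u\<in>ring_units V. y = inverse tinf ^ (2 * Q + 1) * u"
proof -
  have V': "is_subring V" using V by (rule vring_subring)
  have yV: "y \<notin> V" using y_mem_iff[OF V] xV by simp
  have nz: "x \<noteq> 0" "y \<noteq> 0" using yV x_nonzero subring_zero[OF V'] by auto
  show t0: "tinf \<noteq> 0" using nz by (simp add: tinf_def)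
  obtain u where u: "u \<in> ring_units V" "x ^ (2 * Q + 1) = y ^ Q * u"
    using h_pole[OF V yV] curve_eq by auto
  have "x * tinf ^ Q = x ^ (2 * Q + 1) / y ^ Q"
    by (simp add: tinf_def power_divide power_mult[symmetric] mult.commute)
  also have "\<dots> = u" using u(2) nz by simp
  finally have x: "x = inverse tinf ^ Q * u" using t0 by (simp add: field_simps power_inverse)
  then show "\<exists>u\<in>ring_units V. x = inverse tinf ^ Q * u" using u(1) by blast
  have "y * tinf ^ (2 * Q + 1) = (x ^ (2 * Q + 1)) ^ 2 / (y ^ Q) ^ 2"
    using nz by (simp add: tinf_def power_divide power_mult[symmetric] mult.commute power_add
        power_mult_distrib)
  also have "\<dots> = u ^ 2" using u(2) nz by (simp add: power_mult_distrib)
  finally have y: "y = inverse tinf ^ (2 * Q + 1) * u ^ 2"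
    using t0 by (simp add: field_simps power_inverse)
  then show "\<exists>u\<in>ring_units V. y = inverse tinf ^ (2 * Q + 1) * u" using units_power[OF V' u(1)] by blast
  show "tinf \<in> vring_max V"
  proof (rule ccontr)
    assume "tinf \<notin> vring_max V"
    then have "inverse tinf \<in> V" using vring_max_iff[OF V] t0 by auto
    then have "inverse tinf ^ Q * u \<in> V" using units_mem[OF u(1)] by (intro subring_intros V')
    then show False using x xV by simp
  qed
qed

lemma msum_mem_Lspace:
  assumes "\<And>k. c k \<in> K" "finite M" "\<And>k. k \<in> M \<Longrightarrow> c k \<noteq> 0 \<Longrightarrow> wt k \<le> s"
  shows "msum c x y M \<in> Lspace s"
  unfolding msum_def
proof (rule Lspace_sum)
  fix k assume k: "k \<in> M"
  show "c k * (x ^ fst k * y ^ snd k) \<in> Lspace s"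
  proof (cases "c k = 0")
    case False
    then show ?thesis
      using assms(3)[OF k] Lspace_mono[of "wt k" s] monom_Lspace[of "fst k" "snd k"]
      by (intro Lspace_scale[OF _ assms(1)]) (auto simp: wt_def)
  qed (simp add: Lspace_zero)
qed

lemma msum_max_wt:
  assumes "finite M" "msum c f g M \<noteq> 0"
  shows "\<exists>l\<in>M. c l \<noteq> 0 \<and> (\<forall>m\<in>M. c m \<noteq> 0 \<longrightarrow> wt m \<le> wt l)"
proof -
  let ?M = "{l \<in> M. c l \<noteq> 0}"
  have "?M \<noteq> {}"
  proof
    assume "?M = {}"
    then have "c l = 0" if "l \<in> M" for l using that by blast
    then show False using assms(2) by (simp add: msum_def)
  qed
  moreover have "finite ?M" using assms(1) by simp
  ultimately have "\<exists>l\<in>?M. \<forall>m\<in>?M. wt m \<le> wt l"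
    using Max_in[of "wt ` ?M"] Max_ge[of "wt ` ?M"] by fastforce
  then show ?thesis by blast
qed

text \<open>If \<open>x\<close> were a polynomial in \<open>inverse x\<close>, clearing denominators
  would give a monic equation for \<open>x\<close> over \<open>K\<close>. So
  \<open>place_exists\<close> applies to \<open>K[1/x]\<close> with
  \<open>t = inverse x\<close>.\<close>

lemma infinity_exists: "\<exists>V. valuation_ring K V \<and> x \<notin> V"
proof -
  let ?A = "{poly p (inverse x) | p. \<forall>i. coeff p i \<in> K}"
  have "x \<notin> ?A"
  proof
    assume "x \<in> ?A"
    then obtain p where p: "x = poly p (inverse x)" "\<forall>i. coeff p i \<in> K" by blast
    define d where "d = degree p"
    define r where "r = monom 1 (Suc d) - (\<Sum>i\<le>d. monom (coeff p i) (d - i))"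
    have "x * x ^ d = (\<Sum>i\<le>d. coeff p i * inverse x ^ i) * x ^ d"
      using p(1) by (simp add: poly_altdef d_def)
    also have "\<dots> = (\<Sum>i\<le>d. coeff p i * x ^ (d - i))"
      unfolding sum_distrib_right
      by (intro sum.cong refl) (use x_nonzero in \<open>auto simp: power_diff power_inverse field_simps\<close>)
    finally have "poly r x = 0" by (simp add: r_def poly_monom poly_sum)
    moreover have "coeff r i \<in> K" for i
      using p(2) by (auto simp: r_def coeff_sum intro!: K_intros)
    ultimately have "r = 0" using trans by (auto simp: transcendental_over_def)
    moreover have "coeff r (Suc d) = 1" by (auto simp: r_def coeff_sum intro!: sum.neutral)
    ultimately show False by simp
  qed
  then show ?thesis
    using place_exists[OF K subring_adjoin[OF K_subring] subring_adjoin_supset[OF K_subring]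
        subring_adjoin_mem[OF K_subring], of "inverse x"] x_nonzero
    by (auto simp: vring_max_iff)
qed

definition Vinf :: "'a set" where "Vinf = (SOME V. valuation_ring K V \<and> x \<notin> V)"

lemma Vinf: "valuation_ring K Vinf" and x_notin_Vinf: "x \<notin> Vinf"
  using someI_ex[OF infinity_exists] by (auto simp: Vinf_def)

lemma aff_lead:
  assumes "r \<in> aff" "r \<noteq> 0"
  shows "\<exists>c s k. (\<forall>k. c k \<in> K) \<and> r = msum c x y (exps s) \<and> k \<in> exps s \<and> c k \<noteq> 0 \<and>
     (\<forall>l\<in>exps s. c l \<noteq> 0 \<longrightarrow> wt l \<le> wt k)"
proof -
  obtain s c where c: "\<forall>k. c k \<in> K" "r = msum c x y (exps s)"
    using assms(1) by (auto simp: aff_def Lspace_def)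
  have "msum c x y (exps s) \<noteq> 0" using assms(2) c(2) by simp
  from msum_max_wt[OF finite_exps this]
  show ?thesis using c by blast
qed

text \<open>The exponent is chosen before the valuation ring, because it is read off from the
  leading monomial alone. This order of quantifiers yields the uniqueness of the place at
  infinity.\<close>

lemma aff_infinity:
  assumes "r \<in> aff" "r \<noteq> 0"
  shows "\<exists>w. \<forall>V. valuation_ring K V \<longrightarrow> x \<notin> V \<longrightarrow> (\<exists>e\<in>ring_units V. r = inverse tinf ^ w * e)"
proof -
  obtain c s k where c: "\<forall>k. c k \<in> K" "r = msum c x y (exps s)" "k \<in> exps s" "c k \<noteq> 0"
    "\<forall>l\<in>exps s. c l \<noteq> 0 \<longrightarrow> wt l \<le> wt k" using aff_lead[OF assms] by blast
  have "\<exists>e\<in>ring_units V. r = inverse tinf ^ wt k * e" if V: "valuation_ring K V" "x \<notin> V" for V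
  proof -
    obtain u v where "u \<in> ring_units V" "x = inverse tinf ^ Q * u"
      "v \<in> ring_units V" "y = inverse tinf ^ (2 * Q + 1) * v"
      using infinity_param(3,4)[OF V] by blast
    from msum_lead[OF V(1) infinity_param(2,1)[OF V] this finite_exps, of s c k] c
    show ?thesis by (auto simp: exps_def)
  qed
  then show ?thesis by blast
qed

lemma infinity_uniformizer:
  assumes V: "valuation_ring K V" and xV: "x \<notin> V" shows "uniformizer V tinf"
  unfolding uniformizer_def
proof (intro conjI allI impI infinity_param[OF V xV])
  fix z :: 'a assume z: "z \<noteq> 0"
  obtain u w where uw: "u \<in> aff" "w \<in> aff" "w \<noteq> 0" "z = u / w" using fraction by blast
  then have "u \<noteq> 0" using z by auto
  obtain i e where i: "e \<in> ring_units V" "u = inverse tinf ^ i * e"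
    using aff_infinity[OF uw(1) \<open>u \<noteq> 0\<close>] V xV by blast
  obtain j e' where j: "e' \<in> ring_units V" "w = inverse tinf ^ j * e'"
    using aff_infinity[OF uw(2,3)] V xV by blast
  have "z = tinf powi (int j - int i) * (e / e')"
    using infinity_param(1)[OF V xV] units_nonzero[OF i(1)] units_nonzero[OF j(1)]
    by (simp add: uw(4) i(2) j(2) power_int_diff power_inverse field_simps)
  then show "\<exists>k u. u \<in> ring_units V \<and> z = tinf powi k * u"
    using units_divide[OF vring_subring[OF V] i(1) j(1)] by blast
qed

text \<open>Every function is a quotient from \<open>aff\<close>, so its value, and hence its
  membership in the ring, is determined by the values on \<open>aff\<close>.\<close>

lemma vring_eqI:
  assumes V: "valuation_ring K V" and DV: "discrete V" and W: "valuation_ring K W" and DW: "discrete W"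
    and eq: "\<And>r. r \<in> aff \<Longrightarrow> r \<noteq> 0 \<Longrightarrow> pval V r = pval W r"
  shows "V = W"
proof -
  have "z \<in> V \<longleftrightarrow> z \<in> W" for z
  proof (cases "z = 0")
    case True
    then show ?thesis
      using subring_zero[OF vring_subring[OF V]] subring_zero[OF vring_subring[OF W]] by simp
  next
    case False
    obtain u w where uw: "u \<in> aff" "w \<in> aff" "w \<noteq> 0" "z = u / w" using fraction by blast
    then have u0: "u \<noteq> 0" using False by auto
    have "pval V z = pval W z"
      using eq[OF uw(1) u0] eq[OF uw(2,3)] uw(3) u0
      by (simp add: uw(4) place_val_divide[OF V DV] place_val_divide[OF W DW])
    then show ?thesis
      using place_val_nonneg_iff[OF V DV False] place_val_nonneg_iff[OF W DW False] by simp
  qed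
  then show ?thesis by blast
qed

lemma infinity_unique:
  assumes V: "valuation_ring K V" and xV: "x \<notin> V" and W: "valuation_ring K W" and xW: "x \<notin> W"
  shows "V = W"
proof -
  have DV: "discrete V" using infinity_uniformizer[OF V xV] by (auto simp: discrete_def)
  have DW: "discrete W" using infinity_uniformizer[OF W xW] by (auto simp: discrete_def)
  have "pval V r = pval W r" if r: "r \<in> aff" "r \<noteq> 0" for r
  proof -
    obtain w where w: "\<And>V. valuation_ring K V \<Longrightarrow> x \<notin> V \<Longrightarrow> \<exists>e\<in>ring_units V. r = inverse tinf ^ w * e"
      using aff_infinity[OF r] by blast
    have "pval V r = - int w" if V: "valuation_ring K V" and xV: "x \<notin> V" for V
    proof -
      obtain e where e: "e \<in> ring_units V" "r = inverse tinf ^ w * e" using w[OF V xV] by blast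
      show ?thesis
        by (rule place_val_eqI[OF V infinity_uniformizer[OF V xV] e(1)])
           (simp add: e(2) power_int_minus power_inverse)
    qed
    then show ?thesis using V xV W xW by simp
  qed
  then show ?thesis by (rule vring_eqI[OF V DV W DW])
qed

lemma Vinf_unique: "valuation_ring K V \<Longrightarrow> x \<notin> V \<Longrightarrow> V = Vinf"
  using infinity_unique Vinf x_notin_Vinf by blast

lemma Vinf_discrete: "discrete Vinf"
  using infinity_uniformizer[OF Vinf x_notin_Vinf] by (auto simp: discrete_def)

text \<open>The pole order at infinity; its value at \<open>0\<close> is junk.\<close>

definition pord :: "'a \<Rightarrow> int" where "pord z = - pval Vinf z"

lemma pord_mult: "z \<noteq> 0 \<Longrightarrow> w \<noteq> 0 \<Longrightarrow> pord (z * w) = pord z + pord w"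
  by (simp add: pord_def place_val_mult[OF Vinf Vinf_discrete])

lemma pord_power: "z \<noteq> 0 \<Longrightarrow> pord (z ^ k) = int k * pord z"
  by (simp add: pord_def place_val_power[OF Vinf Vinf_discrete])

lemma pord_const: "c \<in> K \<Longrightarrow> c \<noteq> 0 \<Longrightarrow> pord c = 0"
  by (simp add: pord_def place_val_const[OF Vinf Vinf_discrete K])

lemma pord_add_le: "z + w \<noteq> 0 \<Longrightarrow> z = 0 \<or> pord z \<le> k \<Longrightarrow> w = 0 \<or> pord w \<le> k \<Longrightarrow> pord (z + w) \<le> k"
  using place_val_add_ge[OF Vinf Vinf_discrete, of z w "- k"] by (auto simp: pord_def)

lemma pord_add_eq:
  assumes "z \<noteq> 0" "w = 0 \<or> pord w < pord z" shows "z + w \<noteq> 0" "pord (z + w) = pord z"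
  using place_val_add_eq[OF Vinf Vinf_discrete, of z w] assms by (auto simp: pord_def)

lemma pord_decomp:
  assumes "z \<noteq> 0" "pord z = int k" shows "\<exists>e\<in>ring_units Vinf. z = inverse tinf ^ k * e"
proof -
  have "pval Vinf z = - int k" using assms(2) by (simp add: pord_def)
  then show ?thesis
    using place_val_decomp[OF Vinf infinity_uniformizer[OF Vinf x_notin_Vinf] assms(1)]
    by (simp add: power_int_minus power_inverse)
qed

lemma pord_eqI: "e \<in> ring_units Vinf \<Longrightarrow> z = inverse tinf ^ k * e \<Longrightarrow> pord z = int k"
  using place_val_eqI[OF Vinf infinity_uniformizer[OF Vinf x_notin_Vinf], of e z "- int k"]
  by (simp add: pord_def power_int_minus power_inverse)

lemma y_nonzero: "y \<noteq> 0"
  using y_mem_iff[OF Vinf] x_notin_Vinf subring_zero[OF vring_subring[OF Vinf]] by auto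

lemma pord_x: "pord x = int Q"
  using infinity_param(3)[OF Vinf x_notin_Vinf] pord_eqI by blast

lemma pord_y: "pord y = int (2 * Q + 1)"
  using infinity_param(4)[OF Vinf x_notin_Vinf] pord_eqI by blast

lemma pord_msum:
  assumes f: "f \<noteq> 0" "pord f = int Q" and g: "g \<noteq> 0" "pord g = int (2 * Q + 1)"
    and M: "finite M" "\<And>k. k \<in> M \<Longrightarrow> snd k < Q" and c: "\<And>k. c k \<in> K"
    and k0: "k0 \<in> M" "c k0 \<noteq> 0" "\<And>k. k \<in> M \<Longrightarrow> c k \<noteq> 0 \<Longrightarrow> wt k \<le> wt k0"
  shows "msum c f g M \<noteq> 0" "pord (msum c f g M) = int (wt k0)"
proof -
  obtain u v where "u \<in> ring_units Vinf" "f = inverse tinf ^ Q * u"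
    "v \<in> ring_units Vinf" "g = inverse tinf ^ (2 * Q + 1) * v"
    using pord_decomp[OF f] pord_decomp[OF g] by blast
  from msum_lead[OF Vinf infinity_param(2,1)[OF Vinf x_notin_Vinf] this M, where c = c and ?k0.0 = k0] c k0
  obtain e where e: "e \<in> ring_units Vinf" "msum c f g M = inverse tinf ^ wt k0 * e" by blast
  show "pord (msum c f g M) = int (wt k0)" using pord_eqI[OF e] .
  show "msum c f g M \<noteq> 0"
    using e units_nonzero infinity_param(1)[OF Vinf x_notin_Vinf] by auto
qed

lemma msum_nonzero:
  assumes fg: "f \<noteq> 0" "pord f = int Q" "g \<noteq> 0" "pord g = int (2 * Q + 1)"
    and M: "finite M" "\<And>k. k \<in> M \<Longrightarrow> snd k < Q" and c: "\<And>k. c k \<in> K" and k: "k \<in> M" "c k \<noteq> 0"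
  shows "msum c f g M \<noteq> 0 \<and> (\<exists>k\<in>M. pord (msum c f g M) = int (wt k))"
proof -
  let ?A = "{k \<in> M. c k \<noteq> 0}"
  have "k \<in> ?A" "finite ?A" using k M(1) by simp_all
  then have "?A \<noteq> {}" "finite ?A" by blast+
  then have "\<exists>l\<in>?A. \<forall>m\<in>?A. wt m \<le> wt l" using Max_in[of "wt ` ?A"] Max_ge[of "wt ` ?A"] by fastforce
  then obtain l where l: "l \<in> M" "c l \<noteq> 0" "\<And>m. m \<in> M \<Longrightarrow> c m \<noteq> 0 \<Longrightarrow> wt m \<le> wt l" by blast
  then show ?thesis using pord_msum[OF fg M, where c = c and ?k0.0 = l] c by blast
qed

text \<open>Since weights are distinct, the monomial of largest weight alone decides the pole order,
  and removing it lowers the order strictly.\<close>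

lemma aff_decomp:
  assumes "r \<in> aff" "r \<noteq> 0"
  shows "\<exists>c k r'. c \<in> K \<and> c \<noteq> 0 \<and> snd k < Q \<and> pord r = int (wt k) \<and> r \<in> Lspace (wt k) \<and>
    r = c * (x ^ fst k * y ^ snd k) + r' \<and> r' \<in> aff \<and> (r' = 0 \<or> pord r' < pord r)"
proof -
  obtain c s k where c: "\<forall>k. c k \<in> K" "r = msum c x y (exps s)" "k \<in> exps s" "c k \<noteq> 0"
    "\<forall>l\<in>exps s. c l \<noteq> 0 \<longrightarrow> wt l \<le> wt k" using aff_lead[OF assms] by blast
  have sQ: "snd l < Q" if "l \<in> exps s" for l using that by (simp add: exps_def)
  have r: "pord r = int (wt k)"
    unfolding c(2) using c sQ
    by (intro pord_msum[OF x_nonzero pord_x y_nonzero pord_y finite_exps]) auto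
  have rL: "r \<in> Lspace (wt k)" unfolding c(2) using c finite_exps by (intro msum_mem_Lspace) auto
  define r' where "r' = msum c x y (exps s - {k})"
  have req: "r = c k * (x ^ fst k * y ^ snd k) + r'"
    unfolding c(2) r'_def msum_def using c(3) finite_exps by (simp add: sum.remove)
  have r'L: "r' \<in> aff" unfolding r'_def
    by (rule Lspace_aff[of _ s], rule msum_mem_Lspace) (use c finite_exps in \<open>auto simp: exps_def\<close>)
  have "r' = 0 \<or> pord r' < pord r"
  proof (cases "r' = 0")
    case False
    then have "msum c x y (exps s - {k}) \<noteq> 0" by (simp add: r'_def)
    from msum_max_wt[OF _ this] finite_exps
    obtain l where l: "l \<in> exps s - {k}" "c l \<noteq> 0" "\<And>m. m \<in> exps s - {k} \<Longrightarrow> c m \<noteq> 0 \<Longrightarrow> wt m \<le> wt l"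
      by blast
    have "pord r' = int (wt l)" unfolding r'_def using c l sQ finite_exps
      by (intro pord_msum[OF x_nonzero pord_x y_nonzero pord_y]) auto
    moreover have "wt l \<le> wt k" using c(5) l by auto
    moreover have "wt l \<noteq> wt k" using wt_inj[of l k] sQ l(1) c(3) by auto
    ultimately show ?thesis using r by simp
  qed simp
  then show ?thesis using r rL req r'L c sQ by blast
qed

lemma Lspace_iff: "r \<in> Lspace s \<longleftrightarrow> r \<in> aff \<and> (r = 0 \<or> pord r \<le> int s)"
proof
  assume r: "r \<in> Lspace s"
  then obtain c where c: "\<forall>k. c k \<in> K" "r = msum c x y (exps s)" by (auto simp: Lspace_def)
  have "pord r \<le> int s" if "r \<noteq> 0"
  proof -
    have "msum c x y (exps s) \<noteq> 0" using that c(2) by simp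
    from msum_max_wt[OF finite_exps this]
    obtain l where l: "l \<in> exps s" "c l \<noteq> 0" "\<And>m. m \<in> exps s \<Longrightarrow> c m \<noteq> 0 \<Longrightarrow> wt m \<le> wt l"
      by blast
    have "pord r = int (wt l)" unfolding c(2) using c l finite_exps
      by (intro pord_msum[OF x_nonzero pord_x y_nonzero pord_y]) (auto simp: exps_def)
    then show ?thesis using l(1) by (simp add: exps_def)
  qed
  then show "r \<in> aff \<and> (r = 0 \<or> pord r \<le> int s)" using r Lspace_aff by blast
next
  assume r: "r \<in> aff \<and> (r = 0 \<or> pord r \<le> int s)"
  show "r \<in> Lspace s"
  proof (cases "r = 0")
    case False
    then obtain k where "pord r = int (wt k)" "r \<in> Lspace (wt k)" using aff_decomp r by blast
    then show ?thesis using Lspace_mono[of "wt k" s] r False by auto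
  qed (simp add: Lspace_zero)
qed

lemma pord_aff_nonneg: "r \<in> aff \<Longrightarrow> r \<noteq> 0 \<Longrightarrow> pord r \<ge> 0"
  using aff_decomp by fastforce

lemma pord_le_iff: "z \<noteq> 0 \<Longrightarrow> pord z \<le> 0 \<longleftrightarrow> z \<in> Vinf"
  using place_val_nonneg_iff[OF Vinf Vinf_discrete] by (auto simp: pord_def)

lemma pord_less_iff: "z \<noteq> 0 \<Longrightarrow> pord z < 0 \<longleftrightarrow> z \<in> vring_max Vinf"
  using place_val_pos_iff[OF Vinf Vinf_discrete] by (auto simp: pord_def)

text \<open>Infinity is a rational place. A unit there is a quotient of two functions of equal pole
  order, hence with the same leading monomial, and the ratio of their leading coefficients is its
  residue.\<close>

lemma Vinf_residue:
  assumes "z \<in> Vinf" shows "\<exists>c\<in>K. z - c \<in> vring_max Vinf"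
proof (cases "z \<in> vring_max Vinf")
  case True then show ?thesis by (intro bexI[of _ 0]) (auto intro: K_intros)
next
  case False
  then have z0: "z \<noteq> 0" using vring_max_zero[OF Vinf] by auto
  have pz: "pord z = 0" using pord_le_iff[OF z0] pord_less_iff[OF z0] assms False by linarith
  obtain u w where uw: "u \<in> aff" "w \<in> aff" "w \<noteq> 0" "z = u / w" using fraction by blast
  have u0: "u \<noteq> 0" using z0 uw by auto
  have "pord u = pord w" using pord_mult[OF z0 uw(3)] pz uw by simp
  obtain c k u' where u: "c \<in> K" "c \<noteq> 0" "snd k < Q" "pord u = int (wt k)"
    "u = c * (x ^ fst k * y ^ snd k) + u'" "u' \<in> aff" "u' = 0 \<or> pord u' < pord u"
    using aff_decomp[OF uw(1) u0] by blast
  obtain d l w' where w: "d \<in> K" "d \<noteq> 0" "snd l < Q" "pord w = int (wt l)"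
    "w = d * (x ^ fst l * y ^ snd l) + w'" "w' \<in> aff" "w' = 0 \<or> pord w' < pord w"
    using aff_decomp[OF uw(2,3)] by blast
  have "k = l" using wt_inj u w \<open>pord u = pord w\<close> by auto
  define a where "a = c / d"
  have aK: "a \<in> K" "a \<noteq> 0" using u w by (auto simp: a_def intro: K_intros)
  have "u - a * w = u' - a * w'" using u(5) w(2,5) \<open>k = l\<close> by (simp add: a_def field_simps)
  then have eq: "z - a = (u' + a * w') / w" using uw(3,4) by (simp add: field_simps diff_eq minus_eq)
  have "z - a \<in> vring_max Vinf"
  proof (cases "z - a = 0")
    case False
    then have nz: "u' + a * w' \<noteq> 0" using eq by auto
    have "pord (u' + a * w') \<le> pord w - 1"
      using u(7) w(7) aK pord_const[OF aK] \<open>pord u = pord w\<close> pord_mult[OF aK(2), of w']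
      by (intro pord_add_le nz; cases "w' = 0") auto
    moreover have "pord (u' + a * w') = pord (z - a) + pord w"
      using pord_mult[OF False uw(3)] eq uw(3) by simp
    ultimately show ?thesis using pord_less_iff[OF False] by simp
  qed (use vring_max_zero[OF Vinf] in simp)
  then show ?thesis using aK by blast
qed

section \<open>Endomorphisms of the function field\<close>

definition Khom :: "('a \<Rightarrow> 'a) \<Rightarrow> bool" where
  "Khom S \<longleftrightarrow> (\<forall>a b. S (a + b) = S a + S b) \<and> (\<forall>a b. S (a * b) = S a * S b) \<and> (\<forall>c\<in>K. S c = c)"

lemma Khom_add: "Khom S \<Longrightarrow> S (a + b) = S a + S b"
  and Khom_mult: "Khom S \<Longrightarrow> S (a * b) = S a * S b"
  and Khom_const: "Khom S \<Longrightarrow> c \<in> K \<Longrightarrow> S c = c"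
  by (auto simp: Khom_def)

lemma Khom_zero: "Khom S \<Longrightarrow> S 0 = 0"
  and Khom_one: "Khom S \<Longrightarrow> S 1 = 1"
  by (auto intro!: Khom_const K_intros)

lemma Khom_diff: "Khom S \<Longrightarrow> S (a - b) = S a - S b"
  by (simp add: diff_eq Khom_add)

lemma Khom_minus: "Khom S \<Longrightarrow> S (- a) = - S a"
  by (simp add: minus_eq)

lemma Khom_power: "Khom S \<Longrightarrow> S (a ^ k) = S a ^ k"
  by (induction k) (auto simp: Khom_one Khom_mult)

lemma Khom_sum: "Khom S \<Longrightarrow> S (sum f I) = (\<Sum>i\<in>I. S (f i))"
  by (induction I rule: infinite_finite_induct) (auto simp: Khom_zero Khom_add)

lemma Khom_h: "Khom S \<Longrightarrow> S (h_poly n a) = h_poly n (S a)"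
  by (simp add: h_poly_def Khom_sum Khom_power)

lemma Khom_eq_zero: "Khom S \<Longrightarrow> S a = 0 \<longleftrightarrow> a = 0"
  using Khom_mult[of S a "inverse a"] by (cases "a = 0") (auto simp: Khom_zero Khom_one)

lemma Khom_inverse: "Khom S \<Longrightarrow> S (inverse a) = inverse (S a)"
  using Khom_mult[of S a "inverse a"] Khom_eq_zero[of S a]
  by (cases "a = 0") (auto simp: Khom_zero Khom_one intro: inverse_unique[symmetric])

lemma Khom_divide: "Khom S \<Longrightarrow> S (a / b) = S a / S b"
  by (simp add: divide_inverse Khom_mult Khom_inverse)

lemma Khom_inj: "Khom S \<Longrightarrow> inj S"
  by (rule injI) (metis Khom_diff Khom_eq_zero eq_iff_diff_eq_0)

lemma Khom_comp: "Khom S \<Longrightarrow> Khom T \<Longrightarrow> Khom (S \<circ> T)"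
  and Khom_id: "Khom id"
  by (auto simp: Khom_def)

lemma Khom_poly_coeff:
  assumes "Khom S" "\<And>i. S (coeff p i) = coeff p i" shows "S (poly p z) = poly p (S z)"
  by (simp add: poly_altdef Khom_sum[OF assms(1)] Khom_mult[OF assms(1)] Khom_power[OF assms(1)] assms(2))

lemma Khom_ext:
  assumes S: "Khom S" and T: "Khom T" and "S x = T x" "S y = T y" shows "S = T"
proof
  fix z
  have *: "S r = T r" if "r \<in> aff" for r
    using that assms
    by (induction rule: aff_induct) (auto simp: Khom_const Khom_add Khom_mult)
  obtain u w where "u \<in> aff" "w \<in> aff" "z = u / w" using fraction by blast
  then show "S z = T z" using * by (simp add: Khom_divide S T)
qed

text \<open>The prescribed pole orders prevent a nontrivial combination of reduced monomials in
  \<open>f\<close> and \<open>g\<close> from vanishing. So the substitution is injective on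
  \<open>aff\<close> and extends to quotients.\<close>

lemma Khom_exists:
  assumes f: "f \<noteq> 0" "pord f = int Q" and g: "g \<noteq> 0" "pord g = int (2 * Q + 1)"
    and fg: "f ^ (2 * Q + 1) = h_poly n g"
  shows "\<exists>S. Khom S \<and> S x = f \<and> S y = g"
proof -
  \<comment> \<open>the graph of the homomorphism on \<open>aff\<close>; \<open>RS\<close> below is its extension to quotients\<close>
  define Rp where "Rp r v \<longleftrightarrow> (\<exists>c s. (\<forall>k. c k \<in> K) \<and> (\<forall>k. k \<notin> exps s \<longrightarrow> c k = 0) \<and>
     r = msum c x y (exps s) \<and> v = msum c f g (exps s))" for r v
  have ext: "msum c u v (exps s) = msum c u v (exps s')"
    if "s \<le> s'" "\<forall>k. k \<notin> exps s \<longrightarrow> c k = 0" for c u v s s'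
    unfolding msum_def
    by (rule sum.mono_neutral_left) (use that finite_exps in \<open>auto simp: exps_def\<close>)
  have exps_mono: "k \<in> exps s'" if "k \<in> exps s" "s \<le> s'" for k s s' using that by (auto simp: exps_def)
  have Rp_add: "Rp (r + r') (v + v')" if "Rp r v" "Rp r' v'" for r r' v v'
  proof -
    obtain c s where c: "\<forall>k. c k \<in> K" "\<forall>k. k \<notin> exps s \<longrightarrow> c k = 0" "r = msum c x y (exps s)" "v = msum c f g (exps s)"
      using \<open>Rp r v\<close> unfolding Rp_def by blast
    obtain d t where d: "\<forall>k. d k \<in> K" "\<forall>k. k \<notin> exps t \<longrightarrow> d k = 0" "r' = msum d x y (exps t)" "v' = msum d f g (exps t)"
      using \<open>Rp r' v'\<close> unfolding Rp_def by blast
    have eq: "msum c a b (exps s) + msum d a b (exps t) = msum (\<lambda>k. c k + d k) a b (exps (max s t))" for a b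
      using ext[of s "max s t" c a b] ext[of t "max s t" d a b] c(2) d(2)
      by (simp add: msum_def sum.distrib distrib_right)
    show ?thesis
      unfolding Rp_def
    proof (intro exI[of _ "\<lambda>k. c k + d k"] exI[of _ "max s t"] conjI allI impI)
      show "c k + d k \<in> K" for k using c(1) d(1) by (blast intro: subring_add[OF K_subring])
      show "c k + d k = 0" if "k \<notin> exps (max s t)" for k
      proof -
        have "k \<notin> exps s" "k \<notin> exps t"
          using that exps_mono by (meson max.cobounded1 max.cobounded2)+
        then show ?thesis using c(2)[rule_format, of k] d(2)[rule_format, of k] by simp
      qed
    qed (simp_all only: c(3,4) d(3,4) eq)
  qed
  have Rp_scale: "Rp (a * r) (a * v)" if "Rp r v" "a \<in> K" for a r v
  proof -
    obtain c s where c: "\<forall>k. c k \<in> K" "\<forall>k. k \<notin> exps s \<longrightarrow> c k = 0" "r = msum c x y (exps s)" "v = msum c f g (exps s)"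
      using \<open>Rp r v\<close> unfolding Rp_def by blast
    show ?thesis
      unfolding Rp_def
    proof (intro exI[of _ "\<lambda>k. a * c k"] exI[of _ s] conjI allI impI)
      show "a * c k \<in> K" for k using c(1) that by (blast intro: subring_mult[OF K_subring])
    qed (use c in \<open>auto simp: msum_def sum_distrib_left mult.assoc\<close>)
  qed
  have Rp_0: "Rp 0 0" unfolding Rp_def
    by (intro exI[of _ "\<lambda>_. 0"] exI[of _ 0]) (auto simp: msum_def intro: K_intros)
  have Rp_sum: "Rp (sum a I) (sum b I)" if "\<And>i. i \<in> I \<Longrightarrow> Rp (a i) (b i)" for a b and I :: "'i set"
    using that by (induction I rule: infinite_finite_induct) (auto simp: Rp_0 intro: Rp_add)
  \<comment> \<open>\<open>g\<close> obeys the same reduction rule as \<open>y\<close>; this makes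
    the substitution compatible with products.\<close>
  have gQ: "g ^ Q = f ^ (2 * Q + 1) + (\<Sum>i<n - 1. g ^ (2 ^ i))"
    using h_top[of g] fg by (simp add: add.assoc add_self)
  have Rp_mono: "Rp (x ^ i * y ^ j) (f ^ i * g ^ j)" for i j
  proof (induction j arbitrary: i rule: less_induct)
    case (less j)
    show ?case
    proof (cases "j < Q")
      case True
      let ?c = "\<lambda>k. if k = (i, j) then 1 else 0 :: 'a"
      have "(i, j) \<in> exps (wt (i, j))" using True by (simp add: exps_def)
      moreover from this have "u ^ i * v ^ j = msum ?c u v (exps (wt (i, j)))" for u v
        using finite_exps by (simp add: msum_def if_distrib[of "\<lambda>u. u * _"] cong: if_cong)
      ultimately show ?thesis unfolding Rp_def
        by (intro exI[of _ ?c] exI[of _ "wt (i, j)"]) (auto intro: K_intros)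
    next
      case False
      then obtain l where l: "j = l + Q" by (metis add.commute le_Suc_ex not_less)
      have eq: "u ^ i * v ^ j = u ^ (i + 2 * Q + 1) * v ^ l + (\<Sum>d<n - 1. u ^ i * v ^ (l + 2 ^ d))"
        if "v ^ Q = u ^ (2 * Q + 1) + (\<Sum>i<n - 1. v ^ (2 ^ i))" for u v :: 'a
        using that by (simp add: l power_add algebra_simps sum_distrib_left)
      have 1: "Rp (x ^ (i + 2 * Q + 1) * y ^ l) (f ^ (i + 2 * Q + 1) * g ^ l)"
        using less.IH[of l "i + 2 * Q + 1"] l Q_ge by auto
      have 2: "Rp (x ^ i * y ^ (l + 2 ^ d)) (f ^ i * g ^ (l + 2 ^ d))" if "d < n - 1" for d
        using less.IH[of "l + 2 ^ d" i] pow2_less_Q[OF that] l by simp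
      show ?thesis unfolding eq[OF y_power_Q] eq[OF gQ] using 1 2 by (intro Rp_add Rp_sum) auto
    qed
  qed
  have Rp_mult: "Rp (r * r') (v * v')" if "Rp r v" "Rp r' v'" for r r' v v'
  proof -
    obtain c s where c: "\<forall>k. c k \<in> K" "r = msum c x y (exps s)" "v = msum c f g (exps s)"
      using \<open>Rp r v\<close> unfolding Rp_def by blast
    obtain d t where d: "\<forall>k. d k \<in> K" "r' = msum d x y (exps t)" "v' = msum d f g (exps t)"
      using \<open>Rp r' v'\<close> unfolding Rp_def by blast
    have eq: "msum c a b (exps s) * msum d a b (exps t) =
       (\<Sum>k\<in>exps s. \<Sum>l\<in>exps t. (c k * d l) * (a ^ (fst k + fst l) * b ^ (snd k + snd l)))" for a b
      unfolding msum_def sum_product by (simp add: power_add algebra_simps)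
    show ?thesis unfolding c(2,3) d(2,3) eq
      by (intro Rp_sum, rule Rp_scale) (use c(1) d(1) in \<open>auto intro: subring_mult[OF K_subring] Rp_mono\<close>)
  qed
  have zero_coeffs: "\<forall>k\<in>exps s. c k = 0"
    if "\<forall>k. c k \<in> K" and uv: "u \<noteq> 0" "pord u = int Q" "v \<noteq> 0" "pord v = int (2 * Q + 1)"
      and z: "msum c u v (exps s) = 0" for c u v s
  proof (intro ballI, rule ccontr)
    fix k assume "k \<in> exps s" "c k \<noteq> 0"
    then have "msum c u v (exps s) \<noteq> 0"
      using msum_nonzero[OF uv finite_exps, of s c k] that(1) by (simp add: exps_def)
    then show False using z by simp
  qed
  \<comment> \<open>Both sides say that all coefficients are zero, so this is well-definedness and
    injectivity at once.\<close>
  have Rp_zero_iff: "r = 0 \<longleftrightarrow> v = 0" if rv: "Rp r v" for r v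
  proof -
    obtain c s where c: "\<forall>k. c k \<in> K" "r = msum c x y (exps s)" "v = msum c f g (exps s)"
      using rv unfolding Rp_def by blast
    have z: "msum c a b (exps s) = 0" if "\<forall>k\<in>exps s. c k = 0" for a b
      unfolding msum_def by (rule sum.neutral) (use that in simp)
    show ?thesis
      unfolding c(2,3)
      using zero_coeffs[OF c(1) x_nonzero pord_x y_nonzero pord_y] zero_coeffs[OF c(1) f g] z by blast
  qed
  have Rp_fun: "v = v'" if "Rp r v" "Rp r v'" for r v v'
    using Rp_add[OF that] Rp_zero_iff[of "r + r" "v + v'"] add_self[of r] by (simp add: diff_eq[symmetric])
  have Rp_ex: "\<exists>v. Rp r v" if "r \<in> aff" for r
    using that
  proof (induction rule: aff_induct)
    case (const c)
    then show ?case using Rp_scale[OF Rp_mono[of 0 0], of c] by auto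
  next
    case (add u v) then show ?case using Rp_add by blast
  next
    case (mult u v) then show ?case using Rp_mult by blast
  qed (use Rp_mono[of 1 0] Rp_mono[of 0 1] in auto)
  have const: "Rp c c" if "c \<in> K" for c using Rp_scale[OF Rp_mono[of 0 0], of c] that by simp
  define RS where "RS z v \<longleftrightarrow> (\<exists>u w u' w'. w \<noteq> 0 \<and> Rp u u' \<and> Rp w w' \<and> z = u / w \<and> v = u' / w')" for z v
  have RS_ex: "\<exists>v. RS z v" for z
  proof -
    obtain u w where "u \<in> aff" "w \<in> aff" "w \<noteq> 0" "z = u / w" using fraction by blast
    then show ?thesis using Rp_ex[of u] Rp_ex[of w] unfolding RS_def by blast
  qed
  have RS_fun: "v = v'" if "RS z v" "RS z v'" for z v v'
  proof -
    obtain u w a b where 1: "w \<noteq> 0" "Rp u a" "Rp w b" "z = u / w" "v = a / b"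
      using \<open>RS z v\<close> unfolding RS_def by blast
    obtain u' w' a' b' where 2: "w' \<noteq> 0" "Rp u' a'" "Rp w' b'" "z = u' / w'" "v' = a' / b'"
      using \<open>RS z v'\<close> unfolding RS_def by blast
    have "b \<noteq> 0" "b' \<noteq> 0" using 1 2 Rp_zero_iff by auto
    have "u * w' = u' * w" using 1 2 by (simp add: field_simps)
    then have "a * b' = a' * b" using Rp_mult[OF 1(2) 2(3)] Rp_mult[OF 2(2) 1(3)] Rp_fun by metis
    then show ?thesis unfolding 1(5) 2(5) using \<open>b \<noteq> 0\<close> \<open>b' \<noteq> 0\<close> by (simp add: frac_eq_eq)
  qed
  define S where "S z = (THE v. RS z v)" for z
  have S: "S z = v" if "RS z v" for z v unfolding S_def using that RS_fun by blast
  have RS_S: "RS z (S z)" for z using S RS_ex by metis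
  have RS_Rp: "RS r v" if "Rp r v" for r v
    unfolding RS_def using that const[of 1] K_intros(2)
    by (intro exI[of _ r] exI[of _ 1] exI[of _ v]) auto
  have RS_add: "RS (z + z') (v + v')" and RS_mult: "RS (z * z') (v * v')" if "RS z v" "RS z' v'" for z z' v v'
  proof -
    obtain u w a b where 1: "w \<noteq> 0" "Rp u a" "Rp w b" "z = u / w" "v = a / b"
      using \<open>RS z v\<close> unfolding RS_def by blast
    obtain u' w' a' b' where 2: "w' \<noteq> 0" "Rp u' a'" "Rp w' b'" "z' = u' / w'" "v' = a' / b'"
      using \<open>RS z' v'\<close> unfolding RS_def by blast
    have b: "b \<noteq> 0" "b' \<noteq> 0" using 1 2 Rp_zero_iff by auto
    show "RS (z + z') (v + v')" unfolding RS_def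
      using 1 2 b Rp_mult[OF 1(3) 2(3)] Rp_add[OF Rp_mult[OF 1(2) 2(3)] Rp_mult[OF 2(2) 1(3)]]
      by (intro exI[of _ "u * w' + u' * w"] exI[of _ "w * w'"] exI[of _ "a * b' + a' * b"] exI[of _ "b * b'"])
         (simp add: add_frac_eq)
    show "RS (z * z') (v * v')" unfolding RS_def
      using 1 2 b Rp_mult[OF 1(3) 2(3)] Rp_mult[OF 1(2) 2(2)]
      by (intro exI[of _ "u * u'"] exI[of _ "w * w'"] exI[of _ "a * a'"] exI[of _ "b * b'"]) simp
  qed
  have "Khom S" unfolding Khom_def
    using S[OF RS_add[OF RS_S RS_S]] S[OF RS_mult[OF RS_S RS_S]] S[OF RS_Rp[OF const]] by blast
  moreover have "S x = f" using S[OF RS_Rp[OF Rp_mono[of 1 0]]] by simp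
  moreover have "S y = g" using S[OF RS_Rp[OF Rp_mono[of 0 1]]] by simp
  ultimately show ?thesis by blast
qed

section \<open>The Galois group over the rational function field\<close>

text \<open>The conjugation \<open>y \<mapsto> y + e\<close> over \<open>K(x)\<close>.\<close>

definition sig :: "'a \<Rightarrow> 'a \<Rightarrow> 'a" where
  "sig e = (SOME S. Khom S \<and> S x = x \<and> S y = y + e)"

text \<open>Adding a constant does not change the pole order of \<open>y\<close>, and for
  \<open>e\<close> in the kernel it does not change \<open>h\<close>, so \<open>Khom_exists\<close>
  applies.\<close>

lemma sig:
  assumes "e \<in> ker_h" shows "Khom (sig e)" "sig e x = x" "sig e y = y + e"
proof -
  have "e = 0 \<or> pord e < pord y" using pord_const[OF ker_K[OF assms]] pord_y by (cases "e = 0") auto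
  from pord_add_eq[OF y_nonzero this] pord_y
  have "\<exists>S. Khom S \<and> S x = x \<and> S y = y + e"
    using curve_eq ker_h[OF assms]
    by (intro Khom_exists) (auto simp: x_nonzero pord_x h_add)
  from someI_ex[OF this] show "Khom (sig e)" "sig e x = x" "sig e y = y + e" by (auto simp: sig_def)
qed

lemma Khom_aff:
  assumes "Khom S" "S x \<in> aff" "S y \<in> aff" "r \<in> aff" shows "S r \<in> aff"
  using assms(4,1-3)
  by (induction rule: aff_induct) (auto simp: Khom_const Khom_add Khom_mult K_aff intro: aff_intros)

lemma sig_aff: "e \<in> ker_h \<Longrightarrow> r \<in> aff \<Longrightarrow> sig e r \<in> aff"
  by (rule Khom_aff[OF sig(1)]) (simp_all add: sig x_aff subring_add[OF aff_subring y_aff] K_aff ker_K)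

lemma sig_sig: "e \<in> ker_h \<Longrightarrow> e' \<in> ker_h \<Longrightarrow> sig e (sig e' z) = sig (e + e') z"
proof -
  assume e: "e \<in> ker_h" "e' \<in> ker_h"
  have "sig e \<circ> sig e' = sig (e + e')"
    using sig[OF e(1)] sig[OF e(2)] sig[OF ker_add[OF e]]
    by (intro Khom_ext Khom_comp) (auto simp: Khom_add Khom_const ker_K e add_ac)
  then show ?thesis by (metis comp_apply)
qed

lemma sig_0: "sig 0 z = z"
proof -
  have "sig 0 = id" using sig[OF ker_0] by (intro Khom_ext Khom_id) auto
  then show ?thesis by simp
qed

lemma sig_involution: "e \<in> ker_h \<Longrightarrow> sig e (sig e z) = z"
  by (simp add: sig_sig add_self sig_0)

definition KX :: "'a set" where "KX = {poly p x | p. \<forall>i. coeff p i \<in> K}"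

lemma KX_subring: "is_subring KX"
  unfolding KX_def by (rule subring_adjoin[OF K_subring])

lemma K_KX: "c \<in> K \<Longrightarrow> c \<in> KX"
  using subring_adjoin_supset[OF K_subring] by (auto simp: KX_def)

lemma x_KX: "x \<in> KX"
  unfolding KX_def by (rule subring_adjoin_mem[OF K_subring])

lemma KX_aff: "u \<in> KX \<Longrightarrow> u \<in> aff"
  unfolding KX_def using K_aff by (auto intro!: subring_poly aff_subring x_aff)

lemma sig_KX:
  assumes e: "e \<in> ker_h" and "u \<in> KX" shows "sig e u = u"
proof -
  obtain p where p: "u = poly p x" "\<forall>i. coeff p i \<in> K" using assms(2) by (auto simp: KX_def)
  show ?thesis unfolding p(1)
    using Khom_poly_coeff[OF sig(1)[OF e], of p x] p(2) sig[OF e] Khom_const[OF sig(1)[OF e]] by simp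
qed

lemma aff_poly:
  assumes "r \<in> aff"
  shows "\<exists>F. poly F y = r \<and> (\<forall>j. coeff F j \<in> KX) \<and> degree F < Q"
proof -
  obtain s c where c: "\<forall>k. c k \<in> K" "r = msum c x y (exps s)"
    using assms(1) by (auto simp: aff_def Lspace_def)
  define F where "F = (\<Sum>k\<in>exps s. monom (c k * x ^ fst k) (snd k))"
  have "poly F y = r" by (simp add: F_def c(2) msum_def poly_sum poly_monom mult.assoc)
  moreover have "coeff F j \<in> KX" for j
    unfolding F_def coeff_sum
  proof (rule subring_sum[OF KX_subring])
    fix k
    have "c k * x ^ fst k \<in> KX" using c(1)[rule_format, of k]
      by (intro subring_mult[OF KX_subring] subring_power[OF KX_subring] x_KX K_KX)
    then show "coeff (monom (c k * x ^ fst k) (snd k)) j \<in> KX"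
      by (auto intro: subring_zero[OF KX_subring])
  qed
  moreover have "degree F \<le> Q - 1" unfolding F_def
  proof (rule degree_sum_le[OF finite_exps])
    fix k assume "k \<in> exps s"
    then have "snd k \<le> Q - 1" by (auto simp: exps_def)
    then show "degree (monom (c k * x ^ fst k) (snd k)) \<le> Q - 1"
      using degree_monom_le[of "c k * x ^ fst k" "snd k"] by linarith
  qed
  ultimately show ?thesis using Q_ge by (intro exI[of _ F]) auto
qed

lemma card_conj: "card ((\<lambda>e. y + e) ` ker_h) = Q"
  using card_ker by (subst card_image) (auto simp: inj_on_def)

text \<open>The polynomial \<open>F(T) - r\<close> has degree below \<open>Q\<close>, but the \<open>Q\<close> roots \<open>y + e\<close>.\<close>

lemma aff_invariant:
  assumes r: "r \<in> aff" and inv: "\<And>e. e \<in> ker_h \<Longrightarrow> sig e r = r" shows "r \<in> KX"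
proof -
  obtain F where F: "poly F y = r" "\<forall>j. coeff F j \<in> KX" "degree F < Q" using aff_poly[OF r] by blast
  have "F = [:r:]"
  proof (rule poly_eqI_degree[of "(\<lambda>e. y + e) ` ker_h"])
    fix z assume "z \<in> (\<lambda>e. y + e) ` ker_h"
    then obtain e where e: "e \<in> ker_h" "z = y + e" by blast
    have "poly F (sig e y) = sig e (poly F y)"
      using Khom_poly_coeff[OF sig(1)[OF e(1)], of F y] F(2) sig_KX[OF e(1)] by simp
    then show "poly F z = poly [:r:] z" using inv[OF e(1)] e sig[OF e(1)] F(1) by simp
  qed (use card_conj F(3) Q_ge in auto)
  then show ?thesis using F(2) by (metis coeff_pCons_0)
qed

text \<open>The characteristic polynomial of \<open>r\<close> over \<open>K(x)\<close>, written as a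
  product over the conjugates; it may be a proper power of the minimal polynomial.\<close>

definition charp :: "'a \<Rightarrow> 'a poly" where
  "charp r = (\<Prod>e\<in>ker_h. [:- sig e r, 1:])"

lemma Khom_map_poly_mult:
  assumes "Khom S" shows "map_poly S (p * r) = map_poly S p * map_poly S r"
  by (rule poly_eqI) (simp add: coeff_map_poly Khom_zero[OF assms] coeff_mult Khom_sum[OF assms] Khom_mult[OF assms])

lemma Khom_map_poly_prod:
  assumes "Khom S" shows "map_poly S (prod f I) = (\<Prod>i\<in>I. map_poly S (f i))"
proof -
  have "map_poly S 1 = 1"
    by (rule poly_eqI) (simp add: coeff_map_poly Khom_zero[OF assms] Khom_one[OF assms] coeff_1)
  then show ?thesis
    by (induction I rule: infinite_finite_induct) (auto simp: Khom_map_poly_mult[OF assms])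
qed

text \<open>Applying \<open>sig e\<close> permutes the linear factors, so the coefficients are
  invariant and \<open>aff_invariant\<close> applies.\<close>

lemma charp_coeff:
  assumes r: "r \<in> aff" shows "coeff (charp r) i \<in> KX"
proof (rule aff_invariant)
  show "coeff (charp r) i \<in> aff"
    unfolding charp_def using sig_aff r
    by (intro subring_poly_prod[OF aff_subring])
       (auto simp: coeff_pCons minus_eq intro: aff_intros split: nat.split)
  fix e assume e: "e \<in> ker_h"
  have "map_poly (sig e) (charp r) = (\<Prod>e'\<in>ker_h. [:- sig (e + e') r, 1:])"
    unfolding charp_def Khom_map_poly_prod[OF sig(1)[OF e]]
    by (intro prod.cong refl) (simp add: map_poly_pCons Khom_zero[OF sig(1)[OF e]] Khom_one[OF sig(1)[OF e]]
        Khom_minus[OF sig(1)[OF e]] sig_sig e)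
  also have "\<dots> = charp r" unfolding charp_def
    by (rule prod.reindex_bij_witness[of _ "\<lambda>e'. e + e'" "\<lambda>e'. e + e'"])
       (auto simp: ker_add e add_self add.assoc[symmetric])
  finally show "sig e (coeff (charp r) i) = coeff (charp r) i"
    by (metis coeff_map_poly Khom_zero[OF sig(1)[OF e]])
qed

lemma charp_monic: "degree (charp r) = Q" "coeff (charp r) Q = 1"
proof -
  show d: "degree (charp r) = Q" unfolding charp_def
    by (subst degree_prod_sum_eq) (auto simp: card_ker)
  have "lead_coeff (charp r) = 1" unfolding charp_def lead_coeff_prod by simp
  then show "coeff (charp r) Q = 1" using d by simp
qed

lemma charp_root: "poly (charp r) r = 0"
  unfolding charp_def poly_prod using ker_0 finite_ker sig_0
  by (intro prod_zero bexI[of _ 0]) auto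

definition nrm :: "'a \<Rightarrow> 'a" where "nrm r = (\<Prod>e\<in>ker_h. sig e r)"

lemma nrm_KX: "r \<in> aff \<Longrightarrow> nrm r \<in> KX"
proof -
  assume r: "r \<in> aff"
  have "coeff (charp r) 0 = nrm r"
    by (simp add: charp_def nrm_def poly_0_coeff_0[symmetric] poly_prod minus_eq)
  then show ?thesis using charp_coeff[OF r] by metis
qed

lemma nrm_nonzero: "r \<noteq> 0 \<Longrightarrow> nrm r \<noteq> 0"
  using sig(1) finite_ker by (auto simp: nrm_def Khom_eq_zero)

text \<open>The factor of the norm for \<open>e = 0\<close> is \<open>r\<close> itself.\<close>

lemma nrm_multiple: "r \<in> aff \<Longrightarrow> \<exists>r'\<in>aff. nrm r = r * r'"
proof -
  assume r: "r \<in> aff"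
  have "nrm r = r * (\<Prod>e\<in>ker_h - {0}. sig e r)"
    unfolding nrm_def using prod.remove[OF finite_ker ker_0, of "\<lambda>e. sig e r"] sig_0 by simp
  moreover have "(\<Prod>e\<in>ker_h - {0}. sig e r) \<in> aff"
    using sig_aff r by (intro subring_prod[OF aff_subring]) auto
  ultimately show ?thesis by blast
qed

lemma fraction_KX: "\<exists>u\<in>aff. \<exists>w\<in>KX. w \<noteq> 0 \<and> (z :: 'a) = u / w"
proof -
  obtain u w where uw: "u \<in> aff" "w \<in> aff" "w \<noteq> 0" "z = u / w" using fraction by blast
  obtain w' where w': "w' \<in> aff" "nrm w = w * w'" using nrm_multiple[OF uw(2)] by blast
  have "w' \<noteq> 0" using nrm_nonzero[OF uw(3)] w' by auto
  then have "z = (u * w') / nrm w" using uw w' by simp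
  then show ?thesis using nrm_KX[OF uw(2)] nrm_nonzero[OF uw(3)] uw(1) w'(1) by (blast intro: aff_intros(4))
qed

section \<open>All places are discrete\<close>

definition Kpoly :: "'a poly \<Rightarrow> bool" where "Kpoly p \<longleftrightarrow> (\<forall>i. coeff p i \<in> K)"

lemma Kpoly_root: "Kpoly p \<Longrightarrow> poly p x = 0 \<Longrightarrow> p = 0"
  using trans by (auto simp: transcendental_over_def Kpoly_def)

lemma KX_iff: "u \<in> KX \<longleftrightarrow> (\<exists>p. Kpoly p \<and> u = poly p x)"
  by (auto simp: KX_def Kpoly_def)

lemma Kpoly_mult: "Kpoly p \<Longrightarrow> Kpoly r \<Longrightarrow> Kpoly (p * r)"
  by (simp add: Kpoly_def subring_poly_mult[OF K_subring])

lemma Kpoly_add: "Kpoly p \<Longrightarrow> Kpoly r \<Longrightarrow> Kpoly (p + r)"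
  and Kpoly_diff: "Kpoly p \<Longrightarrow> Kpoly r \<Longrightarrow> Kpoly (p - r)"
  and Kpoly_0: "Kpoly 0"
  by (auto simp: Kpoly_def intro: K_intros)

lemma Kpoly_monom: "c \<in> K \<Longrightarrow> Kpoly (monom c i)"
  by (auto simp: Kpoly_def intro: K_intros)

lemma Kpoly_linear: "a \<in> K \<Longrightarrow> Kpoly [:- a, 1:]"
  by (auto simp: Kpoly_def coeff_pCons K_intros split: nat.split)

lemma x_minus_const_nonzero: "a \<in> K \<Longrightarrow> x - a \<noteq> 0"
  using Kpoly_root[OF Kpoly_linear, of a] by auto

text \<open>The type of coefficients is the whole function field; the point is that quotient and
  remainder stay over \<open>K\<close>.\<close>

lemma Kpoly_division:
  assumes "Kpoly p" "Kpoly d" "d \<noteq> 0"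
  shows "\<exists>b r. Kpoly b \<and> Kpoly r \<and> p = b * d + r \<and> (r = 0 \<or> degree r < degree d)"
  using assms(1)
proof (induction "degree p" arbitrary: p rule: less_induct)
  case less
  show ?case
  proof (cases "degree p < degree d")
    case True
    then show ?thesis using less.prems Kpoly_0 by (intro exI[of _ 0] exI[of _ p]) auto
  next
    case False
    define m where "m = monom (lead_coeff p / lead_coeff d) (degree p - degree d)"
    have m: "Kpoly m" unfolding m_def using less.prems assms(2)
      by (intro Kpoly_monom K_intros) (auto simp: Kpoly_def)
    define p' where "p' = p - m * d"
    have p': "Kpoly p'" unfolding p'_def using less.prems assms m by (intro Kpoly_diff Kpoly_mult)
    have "degree (m * d) \<le> degree p"
      using degree_mult_le[of m d] degree_monom_le[of "lead_coeff p / lead_coeff d" "degree p - degree d"] False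
      unfolding m_def by linarith
    then have "degree p' \<le> degree p" unfolding p'_def by (intro degree_diff_le) auto
    moreover have "coeff p' (degree p) = 0"
      unfolding p'_def m_def using False assms(3) by (simp add: coeff_monom_mult)
    ultimately have "p' = 0 \<or> degree p' < degree p" by (rule eq_zero_or_degree_less)
    then have "\<exists>b r. Kpoly b \<and> Kpoly r \<and> p' = b * d + r \<and> (r = 0 \<or> degree r < degree d)"
    proof
      assume "p' = 0"
      then show ?thesis using Kpoly_0 by (intro exI[of _ 0]) auto
    qed (use less.hyps p' in blast)
    then obtain b r where br: "Kpoly b" "Kpoly r" "p' = b * d + r" "r = 0 \<or> degree r < degree d" by blast
    have "p = (b + m) * d + r" using br(3) by (simp add: p'_def algebra_simps)
    then show ?thesis using br m Kpoly_add by blast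
  qed
qed

lemma aff_subset: "valuation_ring K V \<Longrightarrow> x \<in> V \<Longrightarrow> r \<in> aff \<Longrightarrow> r \<in> V"
proof -
  assume V: "valuation_ring K V" "x \<in> V" and r: "r \<in> aff"
  show "r \<in> V" using r
    by (induction rule: aff_induct)
       (use V y_mem_iff[OF V(1)] vring_const[OF V(1)] in \<open>auto intro: subring_intros[OF vring_subring[OF V(1)]]\<close>)
qed

text \<open>The place meets \<open>K[x]\<close> in a nonzero ideal: write the inverse of an element
  outside \<open>V\<close> as a quotient from \<open>aff\<close>; the numerator is a nonunit, and so
  is its norm, which lies in \<open>K[x]\<close>. A polynomial of least degree then generates, by
  division with remainder.\<close>

lemma KX_generator:
  assumes V: "valuation_ring K V" and xV: "x \<in> V"
  shows "\<exists>p. Kpoly p \<and> p \<noteq> 0 \<and> poly p x \<in> vring_max V \<and> degree p > 0 \<and>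
    (\<forall>r. Kpoly r \<longrightarrow> poly r x \<in> vring_max V \<longrightarrow> (\<exists>b. Kpoly b \<and> r = b * p))"
proof -
  obtain z where z: "z \<notin> V" using V by (auto simp: valuation_ring_def)
  have iz: "inverse z \<in> vring_max V" using not_in_vring_inverse_max[OF V z] .
  have z0: "z \<noteq> 0" using z subring_zero[OF vring_subring[OF V]] by auto
  obtain u w where uw: "u \<in> aff" "w \<in> aff" "w \<noteq> 0" "inverse z = u / w" using fraction by blast
  have "u = inverse z * w" using uw by simp
  then have u: "u \<in> vring_max V" using vring_max_mult[OF V iz aff_subset[OF V xV uw(2)]] by simp
  have u0: "u \<noteq> 0" using uw z0 by auto
  obtain r' where "r' \<in> aff" "nrm u = u * r'" using nrm_multiple[OF uw(1)] by blast
  then have "nrm u \<in> vring_max V" using vring_max_mult[OF V u aff_subset[OF V xV]] by simp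
  moreover obtain p0 where p0: "Kpoly p0" "nrm u = poly p0 x" using nrm_KX[OF uw(1)] KX_iff by blast
  moreover have "p0 \<noteq> 0" using nrm_nonzero[OF u0] p0 by auto
  ultimately have "\<exists>p. Kpoly p \<and> p \<noteq> 0 \<and> poly p x \<in> vring_max V" by auto
  then obtain p where p: "Kpoly p" "p \<noteq> 0" "poly p x \<in> vring_max V"
    and min: "\<And>r. Kpoly r \<Longrightarrow> r \<noteq> 0 \<Longrightarrow> poly r x \<in> vring_max V \<Longrightarrow> degree p \<le> degree r"
    using ex_has_least_nat[of "\<lambda>p. Kpoly p \<and> p \<noteq> 0 \<and> poly p x \<in> vring_max V" _ degree] by blast
  have "degree p > 0"
  proof (rule ccontr)
    assume "\<not> degree p > 0"
    then obtain c where c: "p = [:c:]" by (metis degree_eq_zeroE gr0I)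
    then have "c \<in> K" "c \<noteq> 0" using p unfolding Kpoly_def by (metis coeff_pCons_0, simp)
    then have "c \<in> ring_units V" using units_const[OF K V] by blast
    then show False using p(3) c vring_max_not_unit by fastforce
  qed
  moreover have "\<exists>b. Kpoly b \<and> r = b * p" if r: "Kpoly r" "poly r x \<in> vring_max V" for r
  proof -
    obtain b s where bs: "Kpoly b" "Kpoly s" "r = b * p + s" "s = 0 \<or> degree s < degree p"
      using Kpoly_division[OF r(1) p(1,2)] by blast
    have "poly b x \<in> V" using bs(1) KX_iff KX_aff aff_subset[OF V xV] by blast
    then have "poly p x * poly b x \<in> vring_max V" using vring_max_mult[OF V p(3)] by blast
    from vring_max_diff[OF V r(2) this] have "poly s x \<in> vring_max V" using bs(3) by (simp add: mult.commute)
    then have "s = 0" using min[OF bs(2)] bs(4) by fastforce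
    then show ?thesis using bs by auto
  qed
  ultimately show ?thesis using p by blast
qed

lemma KX_decomp:
  assumes V: "valuation_ring K V" and xV: "x \<in> V"
    and p: "Kpoly p" "p \<noteq> 0" "degree p > 0"
      "\<And>r. Kpoly r \<Longrightarrow> poly r x \<in> vring_max V \<Longrightarrow> \<exists>b. Kpoly b \<and> r = b * p"
    and r: "Kpoly r" "r \<noteq> 0"
  shows "\<exists>k u. u \<in> ring_units V \<and> poly r x = poly p x ^ k * u"
  using r
proof (induction "degree r" arbitrary: r rule: less_induct)
  case less
  have rV: "poly r x \<in> V" using less.prems KX_iff KX_aff aff_subset[OF V xV] by blast
  show ?case
  proof (cases "poly r x \<in> vring_max V")
    case True
    then obtain b where b: "Kpoly b" "r = b * p" using p(4) less.prems by blast
    have b0: "b \<noteq> 0" using b less.prems by auto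
    then have "degree b < degree r" using b p by (simp add: degree_mult_eq)
    from less.hyps[OF this b(1) b0] obtain k u where "u \<in> ring_units V" "poly b x = poly p x ^ k * u" by blast
    then show ?thesis by (intro exI[of _ "Suc k"] exI[of _ u]) (simp add: b(2) mult_ac)
  next
    case False
    then show ?thesis using rV vring_unit_or_max[of "poly r x" V] by (intro exI[of _ 0] exI[of _ "poly r x"]) auto
  qed
qed

text \<open>If no two terms had the same order, dividing by the dominant term would leave 1 plus
  nonunits, which is not zero. Orders are compared through quotients, since discreteness is what
  this lemma is for.\<close>

lemma vring_tie:
  assumes V: "valuation_ring K V" and I: "finite I" "sum z I = 0" "i0 \<in> I" "z i0 \<noteq> 0"
  shows "\<exists>i\<in>I. \<exists>j\<in>I. i \<noteq> j \<and> z i \<noteq> 0 \<and> z j \<noteq> 0 \<and> z j / z i \<in> ring_units V"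
proof (rule ccontr)
  assume no: "\<not> ?thesis"
  define J where "J = {i \<in> I. z i \<noteq> 0}"
  have V': "is_subring V" using V by (rule vring_subring)
  have "finite J" "J \<noteq> {}" "\<forall>i\<in>J. z i \<noteq> 0" using I by (auto simp: J_def)
  then have "\<exists>i\<in>J. \<forall>j\<in>J. z j / z i \<in> V"
  proof (induction J rule: finite_ne_induct)
    case (singleton i) then show ?case using V' by (cases "z i = 0") (auto simp: subring_intros)
  next
    case (insert k J)
    then obtain i where i: "i \<in> J" "\<forall>j\<in>J. z j / z i \<in> V" by blast
    have "z k / z i \<in> V \<or> z i / z k \<in> V" using vring_cases[OF V, of "z k / z i"] by simp
    then show ?case
    proof
      assume "z k / z i \<in> V" then show ?thesis using i by blast
    next
      assume ik: "z i / z k \<in> V"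
      have "z j / z k \<in> V" if "j \<in> insert k J" for j
      proof (cases "j = k")
        case True then show ?thesis using V' insert.prems by (auto simp: subring_one)
      next
        case False
        then have "z j / z i * (z i / z k) \<in> V" using that i ik V' by (intro subring_mult) auto
        then show ?thesis using insert.prems i(1) by simp
      qed
      then show ?thesis by blast
    qed
  qed
  then obtain i where i: "i \<in> J" "\<forall>j\<in>J. z j / z i \<in> V" by blast
  have zi: "z i \<noteq> 0" "i \<in> I" using i by (auto simp: J_def)
  have "z j / z i \<in> vring_max V" if "j \<in> I - {i}" for j
  proof (cases "z j = 0")
    case True then show ?thesis using vring_max_zero[OF V] by simp
  next
    case False
    then have "z j / z i \<in> V" using i that by (auto simp: J_def)
    moreover have "z j / z i \<notin> ring_units V" using no that zi False by auto
    ultimately show ?thesis by (simp add: vring_max_def)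
  qed
  then have "(\<Sum>j\<in>I - {i}. z j / z i) \<in> vring_max V" by (intro vring_max_sum[OF V])
  from unit_add_max[OF V units_one[OF V'] this]
  have "1 + (\<Sum>j\<in>I - {i}. z j / z i) \<noteq> 0" using units_nonzero by blast
  moreover have "1 + (\<Sum>j\<in>I - {i}. z j / z i) = sum z I / z i"
    using I(1) zi by (simp add: sum.remove add_divide_distrib sum_divide_distrib)
  ultimately show False using I(2) by simp
qed

text \<open>
  In the characteristic equation of \<open>r\<close> over \<open>K[x]\<close> two terms have the same value, so some
  \<open>r^d\<close> with \<open>1 \<le> d \<le> Q\<close> is a unit times a power of the generator \<open>w\<close>; hence \<open>r^(Q!)\<close> always is.
\<close>

lemma affine_discrete:
  assumes V: "valuation_ring K V" and xV: "x \<in> V" shows "discrete V"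
proof -
  have V': "is_subring V" using V by (rule vring_subring)
  obtain p where p: "Kpoly p" "p \<noteq> 0" "poly p x \<in> vring_max V" "degree p > 0"
      "\<And>r. Kpoly r \<Longrightarrow> poly r x \<in> vring_max V \<Longrightarrow> \<exists>b. Kpoly b \<and> r = b * p"
    using KX_generator[OF V xV] by blast
  define w where "w = poly p x"
  have w0: "w \<noteq> 0" using Kpoly_root p by (auto simp: w_def)
  have wm: "w \<in> vring_max V" using p by (simp add: w_def)
  \<comment> \<open>Each \<open>d\<close> from 1 to \<open>Q\<close> divides \<open>fact Q\<close>,
    so a single exponent serves all functions.\<close>
  define E :: nat where "E = fact Q"
  have E: "E > 0" by (simp add: E_def)
  \<comment> \<open>\<open>k\<close> plays the role of the value of \<open>z\<close>, scaled so that
    \<open>w\<close> has value \<open>E\<close>.\<close>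
  define P where "P z k \<longleftrightarrow> (\<exists>u\<in>ring_units V. z ^ E = w powi k * u)" for z k
  have KXd: "\<exists>k u. u \<in> ring_units V \<and> a = w ^ k * u" if a: "a \<in> KX" "a \<noteq> 0" for a
  proof -
    obtain r where "Kpoly r" "a = poly r x" using a KX_iff by blast
    moreover from this have "r \<noteq> 0" using a by auto
    ultimately show ?thesis using KX_decomp[OF V xV p(1,2,4,5), of r] by (auto simp: w_def)
  qed
  have Pmult: "P (z * z') (k + k')" if "P z k" "P z' k'" for z z' k k'
  proof -
    obtain u u' where "u \<in> ring_units V" "z ^ E = w powi k * u" "u' \<in> ring_units V" "z' ^ E = w powi k' * u'"
      using \<open>P z k\<close> \<open>P z' k'\<close> unfolding P_def by blast
    then show ?thesis unfolding P_def using w0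
      by (intro bexI[of _ "u * u'"]) (auto simp: power_mult_distrib power_int_add mult_ac intro: units_mult[OF V'])
  qed
  have Pinv: "P (inverse z) (- k)" if Pz: "P z k" for z k
  proof -
    obtain u where "u \<in> ring_units V" "z ^ E = w powi k * u" using Pz unfolding P_def by blast
    then show ?thesis unfolding P_def
      by (intro bexI[of _ "inverse u"]) (auto simp: power_inverse power_int_minus intro: units_inverse)
  qed
  have Ppow: "P (z ^ i) (int i * k)" if "P z k" for z k i
  proof (induction i)
    case 0 then show ?case unfolding P_def using units_one[OF V'] by auto
  next
    case (Suc i) then show ?case using Pmult[OF that Suc.IH] by (simp add: algebra_simps)
  qed
  have Ppowi: "P (z powi i) (i * k)" if "P z k" for z k i
    using Ppow[OF that, of "nat i"] Pinv[OF Ppow[OF that, of "nat (- i)"]]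
    by (cases "i \<ge> 0") (auto simp: power_int_def power_inverse)
  have Paff: "\<exists>k. P r k" if r: "r \<in> aff" "r \<noteq> 0" for r
  proof -
    define z where "z i = coeff (charp r) i * r ^ i" for i
    have "sum z {..Q} = 0"
      using charp_root[of r] charp_monic[of r] by (simp add: poly_altdef z_def)
    moreover have "z Q \<noteq> 0" using charp_monic[of r] r by (simp add: z_def)
    ultimately obtain i j where ij: "i \<le> Q" "j \<le> Q" "i \<noteq> j" "z i \<noteq> 0" "z j \<noteq> 0" "z j / z i \<in> ring_units V"
      using vring_tie[OF V, of "{..Q}" z Q] by auto
    have main: "\<exists>k. P r k" if ij: "i < j" "j \<le> Q" "z i \<noteq> 0" "z j \<noteq> 0" "z j / z i \<in> ring_units V" for i j
    proof -
      let ?a = "coeff (charp r) i" and ?b = "coeff (charp r) j"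
      have nz: "?a \<noteq> 0" "?b \<noteq> 0" using ij by (auto simp: z_def)
      obtain k u where a: "u \<in> ring_units V" "?a = w ^ k * u" using KXd[OF charp_coeff[OF r(1)] nz(1)] by blast
      obtain l v where b: "v \<in> ring_units V" "?b = w ^ l * v" using KXd[OF charp_coeff[OF r(1)] nz(2)] by blast
      define e where "e = z j / z i * (u / v)"
      have e: "e \<in> ring_units V" unfolding e_def by (rule units_mult[OF V' ij(5) units_divide[OF V' a(1) b(1)]])
      obtain d where d: "j = i + d" "d > 0" using ij(1) less_imp_add_positive by blast
      have "z j / z i = ?b / ?a * r ^ d" using r(2) nz by (simp add: z_def d power_add field_simps)
      then have "e = w ^ l / w ^ k * r ^ d"
        unfolding e_def a(2) b(2) using w0 units_nonzero[OF a(1)] units_nonzero[OF b(1)] by simp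
      then have rd: "r ^ d = w powi (int k - int l) * e" using w0 by (simp add: power_int_diff)
      have "d dvd E" unfolding E_def using d ij by (intro dvd_fact) auto
      then obtain c where c: "E = d * c" by blast
      have "r ^ E = (w powi (int k - int l)) ^ c * e ^ c"
        unfolding c power_mult rd by (simp add: power_mult_distrib)
      also have "(w powi (int k - int l)) ^ c = w powi ((int k - int l) * int c)"
        by (simp add: power_int_mult)
      finally show ?thesis unfolding P_def using units_power[OF V' e] by blast
    qed
    show ?thesis
    proof (cases "i < j")
      case True then show ?thesis using main ij by blast
    next
      case False
      have "z i / z j \<in> ring_units V" using units_inverse[OF ij(6)] by simp
      then show ?thesis using main[of j i] ij False by auto
    qed
  qed
  have Pex: "\<exists>k. P z k" if z: "z \<noteq> 0" for z
  proof -
    obtain u v where uv: "u \<in> aff" "v \<in> aff" "v \<noteq> 0" "z = u / v" using fraction by blast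
    then have "u \<noteq> 0" using z by auto
    then obtain k l where "P u k" "P v l" using Paff uv by blast
    from Pmult[OF this(1) Pinv[OF this(2)]] show ?thesis using uv by (auto simp: divide_inverse)
  qed
  have wp: "P w (int E)" unfolding P_def using units_one[OF V'] by (intro bexI[of _ 1]) auto
  then have ex: "\<exists>k t. t \<noteq> 0 \<and> P t (int k) \<and> k > 0" using E w0 by blast
  \<comment> \<open>The scaled values form a group of integers; an element whose value is its least
    positive member is the uniformizer.\<close>
  define k0 where "k0 = (LEAST k. \<exists>t. t \<noteq> 0 \<and> P t (int k) \<and> k > 0)"
  obtain t where t: "t \<noteq> 0" "P t (int k0)" "k0 > 0"
    using LeastI_ex[OF ex] unfolding k0_def by blast
  have min: "k0 \<le> k" if "t \<noteq> 0" "P t (int k)" "k > 0" for k t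
    unfolding k0_def by (rule Least_le) (use that in blast)
  \<comment> \<open>Scaled value zero means unit, because \<open>vring_power_mem\<close> takes
    \<open>E\<close>-th roots inside \<open>V\<close>.\<close>
  have unitE: "z \<in> ring_units V" if z: "z \<noteq> 0" "P z 0" for z
  proof -
    obtain u where u: "u \<in> ring_units V" "z ^ E = u" using z unfolding P_def by auto
    have "z \<in> V" using vring_power_mem[OF V, of z E] u E units_mem by blast
    moreover have "inverse z \<in> V"
      using vring_power_mem[OF V, of "inverse z" E] units_mem[OF units_inverse[OF u(1)]] u E
      by (simp add: power_inverse)
    ultimately show ?thesis using z by (simp add: ring_units_def)
  qed
  have "uniformizer V t"
    unfolding uniformizer_def
  proof (intro conjI allI impI)
    show "t \<noteq> 0" by fact
    obtain u where u: "u \<in> ring_units V" "t ^ E = w ^ k0 * u" using t(2) unfolding P_def by auto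
    obtain k1 where k1: "k0 = Suc k1" using t(3) gr0_conv_Suc by blast
    have "w * (w ^ k1 * u) \<in> vring_max V"
      by (rule vring_max_mult[OF V wm]) (intro subring_mult[OF V'] subring_power[OF V'] vring_max_mem[OF wm] units_mem[OF u(1)])
    then have tE: "t ^ E \<in> vring_max V" using u(2) k1 by (simp add: mult.assoc)
    then have "t \<in> V" using vring_power_mem[OF V, of t E] E vring_max_mem by blast
    moreover have "t \<notin> ring_units V" using tE units_power[OF V'] vring_max_not_unit by blast
    ultimately show "t \<in> vring_max V" by (simp add: vring_max_def)
    fix z :: 'a assume z: "z \<noteq> 0"
    obtain k where k: "P z k" using Pex[OF z] by blast
    define d where "d = k div int k0"
    define z' where "z' = z * inverse (t powi d)"
    have z'0: "z' \<noteq> 0" using z t(1) by (simp add: z'_def)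
    have "P z' (k + - (d * int k0))" unfolding z'_def by (intro Pmult[OF k] Pinv Ppowi t(2))
    then have Pz': "P z' (k mod int k0)" by (simp add: d_def minus_div_mult_eq_mod)
    have "k mod int k0 = 0"
    proof (rule ccontr)
      assume "k mod int k0 \<noteq> 0"
      moreover have "0 \<le> k mod int k0" "k mod int k0 < int k0" using t(3) by auto
      ultimately have "nat (k mod int k0) > 0" "nat (k mod int k0) < k0" "int (nat (k mod int k0)) = k mod int k0"
        by auto
      then show False using min[OF z'0, of "nat (k mod int k0)"] Pz' by auto
    qed
    then have "z' \<in> ring_units V" using unitE[OF z'0] Pz' by simp
    moreover have "z = t powi d * z'" using t(1) by (simp add: z'_def)
    ultimately show "\<exists>k u. u \<in> ring_units V \<and> z = t powi k * u" by blast
  qed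
  then show ?thesis by (auto simp: discrete_def)
qed

lemma vring_discrete: "valuation_ring K V \<Longrightarrow> discrete V"
  using affine_discrete Vinf_unique Vinf_discrete by blast

section \<open>Functions without affine poles\<close>

text \<open>This is how automorphisms act on places. Surjectivity keeps the preimage strictly
  between \<open>K\<close> and the whole field.\<close>

lemma vring_vimage:
  assumes V: "valuation_ring K V" and S: "Khom S" "surj S"
  shows "valuation_ring K (S -` V)"
proof -
  have V': "is_subring V" using V by (rule vring_subring)
  have "is_subring (S -` V)" unfolding is_subring_def
    by (auto simp: Khom_zero Khom_one Khom_diff Khom_mult S intro: subring_intros[OF V'])
  moreover have "K \<subseteq> S -` V" using Khom_const[OF S(1)] vring_const[OF V] by auto
  moreover obtain v where "v \<in> V" "v \<notin> K" using V by (auto simp: valuation_ring_def)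
  moreover obtain u where "u \<notin> V" using V by (auto simp: valuation_ring_def)
  moreover have "z \<in> S -` V \<or> inverse z \<in> S -` V" for z
    using vring_cases[OF V, of "S z"] by (simp add: Khom_inverse S)
  ultimately show ?thesis
    unfolding valuation_ring_def using S Khom_const[OF S(1)] by (metis psubsetI subset_UNIV surjD vimage_eq UNIV_I)
qed

lemma sig_surj: "e \<in> ker_h \<Longrightarrow> surj (sig e)"
  using sig_involution by (metis surjI)

text \<open>By degrees \<open>poly p x\<close> has no inverse in \<open>K[x]\<close>, so
  \<open>place_exists\<close> provides a place of the function field at which it vanishes.\<close>

lemma place_over:
  assumes p: "Kpoly p" "degree p > 0"
  shows "\<exists>V. valuation_ring K V \<and> x \<in> V \<and> poly p x \<in> vring_max V"
proof -
  have p0: "p \<noteq> 0" using p by auto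
  then have px: "poly p x \<noteq> 0" using Kpoly_root p by blast
  have "inverse (poly p x) \<notin> KX"
  proof
    assume "inverse (poly p x) \<in> KX"
    then obtain b where b: "Kpoly b" "inverse (poly p x) = poly b x" using KX_iff by blast
    have "Kpoly (b * p - [:1:])" using b p
      by (intro Kpoly_diff Kpoly_mult) (auto simp: Kpoly_def coeff_pCons K_intros split: nat.split)
    moreover have "poly (b * p - [:1:]) x = 0" using px by (simp add: b(2)[symmetric])
    ultimately have "b * p = 1" using Kpoly_root by (metis eq_iff_diff_eq_0 one_pCons)
    then have "degree (b * p) = 0" by simp
    moreover have "b \<noteq> 0" using \<open>b * p = 1\<close> by auto
    ultimately show False using p p0 by (simp add: degree_mult_eq)
  qed
  moreover have "poly p x \<in> KX" using p KX_iff by blast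
  ultimately obtain V where V: "valuation_ring K V" "KX \<subseteq> V" "poly p x \<in> vring_max V"
    using place_exists[OF K KX_subring _ , of "poly p x"] K_KX by blast
  then show ?thesis using x_KX by blast
qed

text \<open>Take a denominator of least degree. If it were not constant, a place would lie over it,
  and there numerator and denominator share the factor from \<open>KX_generator\<close>, which
  cancels.\<close>

lemma KX_if_all_vrings:
  assumes d: "d \<in> KX" "d \<noteq> 0" "c * d \<in> KX"
    and all: "\<And>V. valuation_ring K V \<Longrightarrow> x \<in> V \<Longrightarrow> c \<in> V"
  shows "c \<in> KX"
proof -
  let ?P = "\<lambda>p. Kpoly p \<and> p \<noteq> 0 \<and> c * poly p x \<in> KX"
  obtain p0 where "?P p0" using d KX_iff by fastforce
  then obtain p where p: "Kpoly p" "p \<noteq> 0" "c * poly p x \<in> KX"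
    and min: "\<And>r. ?P r \<Longrightarrow> degree p \<le> degree r"
    using ex_has_least_nat[of ?P p0 degree] by blast
  have px: "poly p x \<noteq> 0" using Kpoly_root p by blast
  show ?thesis
  proof (cases "degree p = 0")
    case True
    then obtain a where a: "p = [:a:]" by (metis degree_eq_zeroE)
    then have "a \<in> K" "a \<noteq> 0" using p unfolding Kpoly_def by (metis coeff_pCons_0, simp)
    then have "inverse a * (c * a) \<in> KX"
      using p(3) a subring_mult[OF KX_subring K_KX[OF K_inverse], of a "c * a"] by simp
    then show ?thesis using \<open>a \<noteq> 0\<close> by (simp add: field_simps)
  next
    case False
    then obtain V where V: "valuation_ring K V" and xV: "x \<in> V" and pV: "poly p x \<in> vring_max V"
      using place_over[OF p(1)] by blast
    obtain g where g: "Kpoly g" "g \<noteq> 0" "degree g > 0"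
      "\<And>r. Kpoly r \<Longrightarrow> poly r x \<in> vring_max V \<Longrightarrow> \<exists>b. Kpoly b \<and> r = b * g"
      using KX_generator[OF V xV] by blast
    obtain p1 where p1: "Kpoly p1" "p = p1 * g" using g(4)[OF p(1) pV] by blast
    obtain r where r: "Kpoly r" "c * poly p x = poly r x" using p(3) KX_iff by blast
    have "poly p x * c \<in> vring_max V" using vring_max_mult[OF V pV all[OF V xV]] .
    then have "poly r x \<in> vring_max V" using r(2) by (simp add: mult.commute)
    then obtain r1 where r1: "Kpoly r1" "r = r1 * g" using g(4) r(1) by blast
    have "poly g x \<noteq> 0" using Kpoly_root g by blast
    then have "c * poly p1 x = poly r1 x" using r(2) p1(2) r1(2) by simp
    then have "?P p1" using p1 p(2) r1 KX_iff by auto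
    moreover have "degree p1 < degree p" using p1 p(2) g by (auto simp: degree_mult_eq)
    ultimately show ?thesis using min by fastforce
  qed
qed

lemma aff_if_all_vrings:
  assumes all: "\<And>V. valuation_ring K V \<Longrightarrow> x \<in> V \<Longrightarrow> f \<in> V"
  shows "f \<in> aff"
proof -
  obtain r d where rd: "r \<in> aff" "d \<in> KX" "d \<noteq> 0" "f = r / d" using fraction_KX by blast
  obtain F where F: "poly F y = r" "\<forall>j. coeff F j \<in> KX" "degree F < Q" using aff_poly[OF rd(1)] by blast
  \<comment> \<open>\<open>f\<close> as a polynomial in \<open>y\<close> of degree below
    \<open>Q\<close>, with coefficients in the fraction field of \<open>K[x]\<close>; the
    denominator \<open>d\<close> is to be removed.\<close>
  define G where "G = smult (inverse d) F"
  have Gdeg: "degree G < Q" using F(3) by (simp add: G_def)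
  have Gy: "poly G y = f" by (simp add: G_def F(1) rd(4) divide_inverse mult.commute)
  have Gval: "poly G (y + e) = sig e f" if e: "e \<in> ker_h" for e
  proof -
    have "sig e (coeff G i) = coeff G i" for i
      using F(2) rd(2) sig_KX[OF e] by (simp add: G_def Khom_mult[OF sig(1)[OF e]] Khom_inverse[OF sig(1)[OF e]])
    from Khom_poly_coeff[OF sig(1)[OF e] this, of y] show ?thesis using sig[OF e] Gy by simp
  qed
  \<comment> \<open>The Lagrange basis for the nodes \<open>y + e\<close>. Two nodes differ by
    \<open>e - e'\<close>, so only constants are divided by, and these are units at every
    place.\<close>
  define B where "B e = (\<Prod>e'\<in>ker_h - {e}. [:- (y + e') / (e - e'), 1 / (e - e'):])" for e
  define H where "H = (\<Sum>e\<in>ker_h. smult (sig e f) (B e))"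
  have polyB: "poly (B e) (y + e0) = (if e0 = e then 1 else 0)" if "e \<in> ker_h" "e0 \<in> ker_h" for e e0
  proof -
    have fac: "poly [:- (y + e') / (e - e'), 1 / (e - e'):] (y + e0) = (e0 - e') / (e - e')" if "e' \<noteq> e" for e'
      using that by (simp add: add_divide_distrib diff_divide_distrib)
    have "poly (B e) (y + e0) = (\<Prod>e'\<in>ker_h - {e}. (e0 - e') / (e - e'))"
      unfolding B_def poly_prod by (intro prod.cong refl fac) auto
    also have "\<dots> = (if e0 = e then 1 else 0)"
    proof (cases "e0 = e")
      case True
      have "(\<Prod>e'\<in>ker_h - {e}. (e0 - e') / (e - e')) = (\<Prod>e'\<in>ker_h - {e}. 1)"
        by (intro prod.cong refl) (use True in auto)
      then show ?thesis using True by simp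
    next
      case False
      then have "e0 \<in> ker_h - {e}" using that by auto
      then have "(\<Prod>e'\<in>ker_h - {e}. (e0 - e') / (e - e')) = 0"
        using finite_ker by (intro prod_zero bexI[of _ e0]) auto
      then show ?thesis using False by simp
    qed
    finally show ?thesis .
  qed
  have GH: "G = H"
  proof (rule poly_eqI_degree[of "(\<lambda>e. y + e) ` ker_h"])
    fix z assume "z \<in> (\<lambda>e. y + e) ` ker_h"
    then obtain e0 where e0: "e0 \<in> ker_h" "z = y + e0" by blast
    have "poly H z = (\<Sum>e\<in>ker_h. if e0 = e then sig e f else 0)"
      unfolding H_def poly_sum e0(2) by (intro sum.cong refl) (use polyB e0 in auto)
    also have "\<dots> = sig e0 f" using e0 finite_ker by simp
    finally show "poly G z = poly H z" using Gval e0 by simp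
  next
    have "degree H \<le> Q - 1"
      unfolding H_def
    proof (rule degree_sum_le[OF finite_ker])
      fix e assume e: "e \<in> ker_h"
      have "degree (B e) \<le> sum (degree \<circ> (\<lambda>e'. [:- (y + e') / (e - e'), 1 / (e - e'):])) (ker_h - {e})"
        unfolding B_def by (rule degree_prod_sum_le) (use finite_ker in auto)
      also have "\<dots> \<le> (\<Sum>e'\<in>ker_h - {e}. 1)" by (rule sum_mono) (simp add: degree_pCons_le)
      also have "\<dots> = Q - 1" using e finite_ker card_ker by simp
      finally show "degree (smult (sig e f) (B e)) \<le> Q - 1" using degree_smult_le order_trans by blast
    qed
    then show "degree H < card ((\<lambda>e. y + e) ` ker_h)" using card_conj Q_ge by simp
  qed (use Gdeg card_conj in simp)
  have "coeff G j \<in> KX" for j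
  proof (rule KX_if_all_vrings[OF rd(2,3)])
    have "coeff G j * d = coeff F j" using rd(3) by (simp add: G_def)
    then show "coeff G j * d \<in> KX" using F(2) by simp
    fix V assume V: "valuation_ring K V" "x \<in> V"
    have V': "is_subring V" using V by (intro vring_subring)
    \<comment> \<open>Conjugation fixes \<open>x\<close>, so the pullback of \<open>V\<close> again
      contains \<open>x\<close>, and every conjugate of \<open>f\<close> is finite at
      \<open>V\<close>.\<close>
    have sf: "sig e f \<in> V" if e: "e \<in> ker_h" for e
      using all[OF vring_vimage[OF V(1) sig(1)[OF e] sig_surj[OF e]]] sig(2)[OF e] V(2) by simp
    have yV: "y \<in> V" using y_mem_iff[OF V(1)] V(2) by simp
    have KV: "c \<in> V" if "c \<in> K" for c using vring_const[OF V(1)] that .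
    have "coeff (B e) i \<in> V" if e: "e \<in> ker_h" for e i
      unfolding B_def
    proof (rule subring_poly_prod[OF V'])
      fix e' i assume e': "e' \<in> ker_h - {e}"
      have iv: "inverse (e - e') \<in> V" using e e' by (intro KV K_intros) (auto simp: ker_K)
      have "e' \<in> V" using e' by (auto intro: KV ker_K)
      then have "- (y + e') * inverse (e - e') \<in> V"
        by (intro subring_mult[OF V'] subring_minus[OF V'] subring_add[OF V'] yV iv)
      then show "coeff [:- (y + e') / (e - e'), 1 / (e - e'):] i \<in> V"
        using iv subring_zero[OF V'] by (auto simp: coeff_pCons divide_inverse split: nat.split)
    qed
    then have "coeff H j \<in> V" unfolding H_def coeff_sum coeff_smult
      using sf by (intro subring_sum[OF V'] subring_mult[OF V'])
    then show "coeff G j \<in> V" using GH by simp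
  qed
  then have "poly G y \<in> aff" using KX_aff by (intro subring_poly[OF aff_subring] y_aff) auto
  then show ?thesis using Gy by simp
qed

lemma aff_iff: "f \<in> aff \<longleftrightarrow> (\<forall>V. valuation_ring K V \<longrightarrow> x \<in> V \<longrightarrow> f \<in> V)"
  using aff_if_all_vrings aff_subset by blast

lemma common_pole_eq: "common_pole K x y = vring_max Vinf"
  unfolding common_pole_def
proof (rule the_equality)
  have "pole_at (vring_max Vinf) x" "pole_at (vring_max Vinf) y"
    using pord_x pord_y x_nonzero y_nonzero Q_ge by (auto simp: pole_at_def pord_def)
  then show "is_place K (vring_max Vinf) \<and> pole_at (vring_max Vinf) x \<and> pole_at (vring_max Vinf) y"
    using is_place_vring_max[OF Vinf] by blast
  fix P assume P: "is_place K P \<and> pole_at P x \<and> pole_at P y"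
  then obtain V where V: "valuation_ring K V" "P = vring_max V" using is_placeE by blast
  have "x \<notin> V"
    using place_val_nonneg_iff[OF V(1) vring_discrete[OF V(1)] x_nonzero] P V(2) by (auto simp: pole_at_def)
  then show "P = vring_max Vinf" using Vinf_unique V by blast
qed

text \<open>The place at infinity contributes the bound on the pole order; all other places together
  demand integrality, which is \<open>aff_iff\<close>. The discreteness of every valuation ring
  turns nonnegative values into membership.\<close>

lemma RR_space_eq: "RR_space K (point_divisor (int s) (vring_max Vinf)) = Lspace s"
proof -
  have "(\<forall>P. is_place K P \<longrightarrow> principal_divisor f P + point_divisor (int s) (vring_max Vinf) P \<ge> 0) \<longleftrightarrow>
    f \<in> Lspace s" if f: "f \<noteq> 0" for f
  proof -
    have pl: "is_place K P \<longleftrightarrow> (\<exists>V. valuation_ring K V \<and> P = vring_max V)" for P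
      using is_placeE is_place_vring_max by metis
    have "(\<forall>P. is_place K P \<longrightarrow> principal_divisor f P + point_divisor (int s) (vring_max Vinf) P \<ge> 0) \<longleftrightarrow>
      (\<forall>V. valuation_ring K V \<longrightarrow> pval V f + (if V = Vinf then int s else 0) \<ge> 0)"
      unfolding pl principal_divisor_def point_divisor_def using vring_max_inject[OF _ Vinf] by auto
    also have "\<dots> \<longleftrightarrow> pord f \<le> int s \<and> (\<forall>V. valuation_ring K V \<longrightarrow> x \<in> V \<longrightarrow> pval V f \<ge> 0)"
    proof (intro iffI conjI allI impI)
      assume A: "\<forall>V. valuation_ring K V \<longrightarrow> 0 \<le> pval V f + (if V = Vinf then int s else 0)"
      then show "pord f \<le> int s" using Vinf by (auto simp: pord_def)
      fix V assume "valuation_ring K V" "x \<in> V"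
      moreover from this have "V \<noteq> Vinf" using x_notin_Vinf by blast
      ultimately show "0 \<le> pval V f" using A[rule_format, of V] by simp
    next
      fix V assume B: "pord f \<le> int s \<and> (\<forall>V. valuation_ring K V \<longrightarrow> x \<in> V \<longrightarrow> 0 \<le> pval V f)"
        and V: "valuation_ring K V"
      show "0 \<le> pval V f + (if V = Vinf then int s else 0)"
      proof (cases "V = Vinf")
        case True then show ?thesis using B by (simp add: pord_def)
      next
        case False
        then have "x \<in> V" using Vinf_unique V by blast
        then show ?thesis using B V False by simp
      qed
    qed
    also have "\<dots> \<longleftrightarrow> pord f \<le> int s \<and> f \<in> aff"
      unfolding aff_iff using place_val_nonneg_iff vring_discrete f by blast
    finally show ?thesis using f by (auto simp: Lspace_iff)
  qed
  then show ?thesis using Lspace_zero by (auto simp: RR_space_def)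
qed

section \<open>Affine rational places\<close>

definition pts :: "('a \<times> 'a) set" where
  "pts = {p. fst p \<in> K \<and> snd p \<in> K \<and> h_poly n (snd p) = fst p ^ (2 * Q + 1)}"

definition centred :: "'a set \<Rightarrow> 'a \<times> 'a \<Rightarrow> bool" where
  "centred V p \<longleftrightarrow> valuation_ring K V \<and> x - fst p \<in> vring_max V \<and> y - snd p \<in> vring_max V"

lemma vring_max_vimage:
  assumes V: "valuation_ring K V" and S: "Khom S" "surj S"
  shows "z \<in> vring_max (S -` V) \<longleftrightarrow> S z \<in> vring_max V"
  using vring_max_iff[OF V, of "S z"] vring_max_iff[OF vring_vimage[OF assms], of z]
  by (simp add: Khom_inverse[OF S(1)] Khom_eq_zero[OF S(1)])

lemma x_mem_if_centred:
  assumes V: "valuation_ring K V" and a: "a \<in> K" and "x - a \<in> vring_max V" shows "x \<in> V"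
proof -
  have "(x - a) + a \<in> V"
    using assms vring_max_mem vring_const[OF V a] by (intro subring_add[OF vring_subring[OF V]])
  then show ?thesis by simp
qed

text \<open>Both sides are monic of degree \<open>Q\<close> in \<open>z\<close>, with the
  \<open>Q\<close> elements of \<open>ker_h\<close> as roots.\<close>

lemma h_prod: "h_poly n z = (\<Prod>e\<in>ker_h. z + e)"
proof -
  define H :: "'a poly" where "H = (\<Sum>i<n. monom 1 (2 ^ i))"
  define G :: "'a poly" where "G = (\<Prod>e\<in>ker_h. [:e, 1:])"
  have polyH: "poly H z = h_poly n z" for z by (simp add: H_def poly_sum poly_monom h_poly_def)
  have polyG: "poly G z = (\<Prod>e\<in>ker_h. z + e)" for z by (simp add: G_def poly_prod add.commute)
  have "H = G"
  proof (rule poly_eqI_degree_lead_coeff[where A = ker_h and n = Q])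
    have dG: "degree G = Q" unfolding G_def by (subst degree_prod_sum_eq) (auto simp: card_ker)
    then show "degree G \<le> Q" by simp
    have "lead_coeff G = 1" unfolding G_def lead_coeff_prod by simp
    moreover have "coeff H Q = 1"
    proof -
      have "(\<Sum>i<n. if (2 :: nat) ^ i = Q then 1 else 0 :: 'a) = (\<Sum>i<n. if i = n - 1 then 1 else 0)"
        by (intro sum.cong refl) (simp add: Q_eq)
      then show ?thesis using n by (simp add: H_def coeff_sum)
    qed
    ultimately show "coeff H Q = coeff G Q" using dG by simp
    show "degree H \<le> Q" unfolding H_def
    proof (rule degree_sum_le)
      fix i assume "i \<in> {..<n}"
      then have "(2 :: nat) ^ i \<le> Q" unfolding Q_eq by (intro power_increasing) auto
      then show "degree (monom (1 :: 'a) (2 ^ i)) \<le> Q" using degree_monom_le[of "1 :: 'a" "2 ^ i"] by linarith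
    qed simp
    show "card ker_h \<ge> Q" using card_ker by simp
    fix e assume e: "e \<in> ker_h"
    have "(\<Prod>e'\<in>ker_h. e + e') = 0" using finite_ker e add_self[of e] by (intro prod_zero bexI[of _ e]) auto
    then show "poly H e = poly G e" using polyH polyG ker_h[OF e] by simp
  qed
  then show ?thesis using polyH polyG by metis
qed

lemma h_shift:
  assumes "(a, b) \<in> pts"
  shows "h_poly n (y - b) = (x - a) * (\<Sum>i<2 * Q + 1. a ^ (2 * Q + 1 - Suc i) * x ^ i)"
proof -
  have "h_poly n (y - b) = x ^ (2 * Q + 1) - a ^ (2 * Q + 1)"
    unfolding diff_eq h_add curve_eq[symmetric] using assms by (simp add: pts_def)
  then show ?thesis by (simp only: power_diff_sumr2)
qed

text \<open>Some place lies over \<open>x = a\<close>. There \<open>h_poly n (y - b)\<close>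
  vanishes, so by \<open>h_prod\<close> one conjugate \<open>y - b + e\<close> does; pulling back
  along \<open>sig e\<close> moves that zero to \<open>y - b\<close>.\<close>

lemma centred_exists:
  assumes p: "p \<in> pts" shows "\<exists>V. centred V p"
proof -
  obtain a b where ab: "p = (a, b)" by (cases p)
  then have aK: "a \<in> K" "b \<in> K" using p by (auto simp: pts_def)
  from place_over[OF Kpoly_linear[OF aK(1)]] obtain V where V: "valuation_ring K V" and xV: "x \<in> V" and "poly [:- a, 1:] x \<in> vring_max V"
    by auto
  then have xa: "x - a \<in> vring_max V" by simp
  have V': "is_subring V" using V by (rule vring_subring)
  have aV: "a \<in> V" "b \<in> V" using vring_const[OF V] aK by auto
  have yV: "y \<in> V" using y_mem_iff[OF V] xV by simp
  have "h_poly n (y - b) \<in> vring_max V"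
    unfolding h_shift[OF p[unfolded ab]]
    by (rule vring_max_mult[OF V xa]) (intro subring_sum[OF V'] subring_mult[OF V'] subring_power[OF V'] xV aV)
  then have "\<exists>e\<in>ker_h. y - b + e \<in> vring_max V"
    unfolding h_prod
    by (rule vring_max_prod[OF V finite_ker, rotated])
       (intro subring_add[OF V'] subring_diff[OF V'] yV aV vring_const[OF V] ker_K)
  then obtain e where e: "e \<in> ker_h" "y - b + e \<in> vring_max V" by blast
  let ?W = "sig e -` V"
  have W: "valuation_ring K ?W" using vring_vimage[OF V sig(1) sig_surj] e by blast
  have "sig e (x - a) = x - a" "sig e (y - b) = y - b + e"
    using sig[OF e(1)] aK by (simp_all add: Khom_diff Khom_const)
  then have "centred ?W p"
    unfolding centred_def using W vring_max_vimage[OF V sig(1)[OF e(1)] sig_surj[OF e(1)]] xa e(2) ab by simp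
  then show ?thesis by blast
qed

text \<open>The functions of this form contain \<open>K\<close>, \<open>x\<close> and
  \<open>y\<close> and are closed under sums and products. In other words, \<open>x - a\<close> and
  \<open>y - b\<close> generate the ideal of functions vanishing at the point.\<close>

lemma aff_taylor:
  assumes p: "(a, b) \<in> pts" and r: "r \<in> aff"
  shows "\<exists>c\<in>K. \<exists>u\<in>aff. \<exists>v\<in>aff. r = c + (x - a) * u + (y - b) * v"
proof -
  have aK: "a \<in> K" "b \<in> K" using p by (auto simp: pts_def)
  have aA: "0 \<in> aff" "1 \<in> aff" by (auto intro: aff_intros)
  show ?thesis using r
  proof (induction rule: aff_induct)
    case (const c)
    then show ?case using aA by (intro bexI[of _ c] bexI[of _ 0]) auto
  next
    case x
    show ?case using aA aK by (intro bexI[of _ a] bexI[of _ 1] bexI[of _ 0]) auto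
  next
    case y
    show ?case using aA aK by (intro bexI[of _ b] bexI[of _ 0] bexI[of _ 1]) auto
  next
    case (add r r')
    then obtain c u v c' u' v' where mem: "c \<in> K" "u \<in> aff" "v \<in> aff" "c' \<in> K" "u' \<in> aff" "v' \<in> aff"
      and eq: "r = c + (x - a) * u + (y - b) * v" "r' = c' + (x - a) * u' + (y - b) * v'" by blast
    have "r + r' = (c + c') + (x - a) * (u + u') + (y - b) * (v + v')"
      unfolding eq by (simp add: algebra_simps)
    moreover have "c + c' \<in> K" "u + u' \<in> aff" "v + v' \<in> aff"
      using mem by (auto intro: subring_add[OF aff_subring] subring_add[OF K_subring])
    ultimately show ?case by blast
  next
    case (mult r r')
    then obtain c u v c' u' v' where mem: "c \<in> K" "u \<in> aff" "v \<in> aff" "c' \<in> K" "u' \<in> aff" "v' \<in> aff"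
      and eq: "r = c + (x - a) * u + (y - b) * v" "r' = c' + (x - a) * u' + (y - b) * v'" by blast
    have "r * r' = c * c' + (x - a) * (u * r' + c * u') + (y - b) * (v * r' + c * v')"
      unfolding eq by (simp add: algebra_simps)
    moreover have "c * c' \<in> K" using mem by (intro subring_mult[OF K_subring])
    moreover have "u * r' + c * u' \<in> aff" "v * r' + c * v' \<in> aff"
      using mem mult.hyps K_aff by (auto intro!: subring_add[OF aff_subring] subring_mult[OF aff_subring])
    ultimately show ?case by blast
  qed
qed

text \<open>The curve is smooth at the point with parameter \<open>x - a\<close>: the relation
  \<open>(y - b) * w = (x - a) * s\<close> has \<open>w\<close> a unit there. So a function
  vanishing at the point, times \<open>w\<close>, is divisible by \<open>x - a\<close> in
  \<open>aff\<close>, and the value drops. As at infinity, the exponent is chosen before the ring,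
  which gives uniqueness of the place.\<close>

lemma centred_decomp:
  assumes p: "(a, b) \<in> pts" and V: "centred V (a, b)" and r: "r \<in> aff" "r \<noteq> 0"
  shows "\<exists>k. \<forall>W. centred W (a, b) \<longrightarrow> (\<exists>u\<in>ring_units W. r = (x - a) ^ k * u)"
proof -
  have aK: "a \<in> K" "b \<in> K" using p by (auto simp: pts_def)
  define w where "w = 1 + (\<Sum>i\<in>{1..<n}. (y - b) ^ (2 ^ i - 1))"
  define s where "s = (\<Sum>i<2 * Q + 1. a ^ (2 * Q + 1 - Suc i) * x ^ i)"
  have yb: "y - b \<in> aff" using y_aff K_aff aK by (intro subring_diff[OF aff_subring])
  have w: "w \<in> aff" unfolding w_def using yb
    by (intro subring_add[OF aff_subring] subring_one[OF aff_subring] subring_sum[OF aff_subring] subring_power[OF aff_subring])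
  have s: "s \<in> aff" unfolding s_def using x_aff K_aff aK
    by (intro subring_mult[OF aff_subring] subring_sum[OF aff_subring] subring_power[OF aff_subring])
  have ws: "(y - b) * w = (x - a) * s"
    using h_shift[OF p] h_bot[of "y - b"] by (simp add: w_def s_def)
  have wunit: "w \<in> ring_units W" if W: "centred W (a, b)" for W
    unfolding w_def using W by (intro h_small) (auto simp: centred_def)
  have V1: "valuation_ring K V" and xV: "x - a \<in> vring_max V" using V by (auto simp: centred_def)
  have D: "discrete V" using vring_discrete[OF V1] .
  have xV': "x \<in> V" using x_mem_if_centred[OF V1 aK(1) xV] .
  have xa0: "x - a \<noteq> 0" using x_minus_const_nonzero[OF aK(1)] .
  show ?thesis using r
  proof (induction "nat (pval V r)" arbitrary: r rule: less_induct)
    case less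
    obtain c u v where cuv: "c \<in> K" "u \<in> aff" "v \<in> aff" "r = c + (x - a) * u + (y - b) * v"
      using aff_taylor[OF p less.prems(1)] by blast
    show ?case
    proof (cases "c = 0")
      case False
      have "r \<in> ring_units W" if W: "centred W (a, b)" for W
      proof -
        have VW: "valuation_ring K W" and xW: "x - a \<in> vring_max W" and yW: "y - b \<in> vring_max W"
          using W by (auto simp: centred_def)
        have "x \<in> W" using x_mem_if_centred[OF VW aK(1) xW] .
        then have "(x - a) * u + (y - b) * v \<in> vring_max W"
          using vring_max_mult[OF VW xW] vring_max_mult[OF VW yW] aff_subset[OF VW] cuv
          by (intro vring_max_add[OF VW]) auto
        from unit_add_max[OF VW units_const[OF K VW cuv(1) False] this]
        show ?thesis using cuv(4) by (simp add: add.assoc)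
      qed
      then show ?thesis by (intro exI[of _ 0]) auto
    next
      case True
      define r' where "r' = u * w + s * v"
      have r': "r' \<in> aff" unfolding r'_def using cuv w s
        by (intro subring_add[OF aff_subring] subring_mult[OF aff_subring])
      have "r * w = (x - a) * u * w + (y - b) * w * v" unfolding cuv(4) True by (simp add: algebra_simps)
      also have "\<dots> = (x - a) * r'" unfolding ws by (simp add: r'_def algebra_simps)
      finally have rw: "r * w = (x - a) * r'" .
      have w0: "w \<noteq> 0" using units_nonzero[OF wunit[OF V]] .
      have r'0: "r' \<noteq> 0" using rw less.prems w0 by auto
      have "pval V r + pval V w =
          pval V (x - a) + pval V r'"
        using place_val_mult[OF V1 D less.prems(2) w0] place_val_mult[OF V1 D xa0 r'0] rw by simp
      moreover have "pval V w = 0" using place_val_unit[OF V1 D wunit[OF V]] .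
      moreover have "pval V (x - a) > 0" using place_val_pos_iff[OF V1 D xa0] xV by simp
      moreover have "pval V r' \<ge> 0"
        using place_val_nonneg_iff[OF V1 D r'0] aff_subset[OF V1 xV' r'] by simp
      ultimately have "nat (pval V r') < nat (pval V r)" by linarith
      from less.hyps[OF this r' r'0] obtain k where
        k: "\<And>W. centred W (a, b) \<Longrightarrow> \<exists>u\<in>ring_units W. r' = (x - a) ^ k * u" by blast
      have "\<exists>u\<in>ring_units W. r = (x - a) ^ Suc k * u" if W: "centred W (a, b)" for W
      proof -
        obtain u where u: "u \<in> ring_units W" "r' = (x - a) ^ k * u" using k[OF W] by blast
        have VW: "valuation_ring K W" using W by (simp add: centred_def)
        have "r = (x - a) ^ Suc k * (u / w)" using rw w0 u(2) by (simp add: field_simps)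
        then show ?thesis using units_divide[OF vring_subring[OF VW] u(1) wunit[OF W]] by blast
      qed
      then show ?thesis by blast
    qed
  qed
qed

lemma centred_uniformizer:
  assumes p: "(a, b) \<in> pts" and V: "centred V (a, b)" shows "uniformizer V (x - a)"
  unfolding uniformizer_def
proof (intro conjI allI impI)
  have V1: "valuation_ring K V" using V by (auto simp: centred_def)
  show xa0: "x - a \<noteq> 0" using x_minus_const_nonzero p by (simp add: pts_def)
  show "x - a \<in> vring_max V" using V by (auto simp: centred_def)
  fix z :: 'a assume z: "z \<noteq> 0"
  obtain u w where uw: "u \<in> aff" "w \<in> aff" "w \<noteq> 0" "z = u / w" using fraction by blast
  then have "u \<noteq> 0" using z by auto
  obtain k e where e: "e \<in> ring_units V" "u = (x - a) ^ k * e"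
    using centred_decomp[OF p V uw(1) \<open>u \<noteq> 0\<close>] V by blast
  obtain l f where f: "f \<in> ring_units V" "w = (x - a) ^ l * f"
    using centred_decomp[OF p V uw(2,3)] V by blast
  have "z = (x - a) powi (int k - int l) * (e / f)"
    using xa0 units_nonzero[OF f(1)] by (simp add: uw(4) e(2) f(2) power_int_diff)
  then show "\<exists>k u. u \<in> ring_units V \<and> z = (x - a) powi k * u"
    using units_divide[OF vring_subring[OF V1] e(1) f(1)] by blast
qed

lemma centred_unique:
  assumes p: "(a, b) \<in> pts" and V: "centred V (a, b)" and W: "centred W (a, b)" shows "V = W"
proof -
  have V1: "valuation_ring K V" and W1: "valuation_ring K W" using V W by (auto simp: centred_def)
  have DV: "discrete V" and DW: "discrete W" using vring_discrete V1 W1 by auto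
  have "pval V r = pval W r" if r: "r \<in> aff" "r \<noteq> 0" for r
  proof -
    obtain k where k: "\<And>W. centred W (a, b) \<Longrightarrow> \<exists>u\<in>ring_units W. r = (x - a) ^ k * u"
      using centred_decomp[OF p V r] by blast
    have "pval U r = int k" if U: "centred U (a, b)" for U
    proof -
      obtain u where u: "u \<in> ring_units U" "r = (x - a) ^ k * u" using k[OF U] by blast
      have "valuation_ring K U" using U by (simp add: centred_def)
      then show ?thesis by (rule place_val_eqI[OF _ centred_uniformizer[OF p U] u(1)]) (simp add: u(2))
    qed
    then show ?thesis using V W by simp
  qed
  then show ?thesis by (rule vring_eqI[OF V1 DV W1 DW])
qed

definition ptV :: "'a \<times> 'a \<Rightarrow> 'a set" where "ptV p = (SOME V. centred V p)"

lemma ptV: "p \<in> pts \<Longrightarrow> centred (ptV p) p"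
  unfolding ptV_def by (rule someI_ex) (rule centred_exists)

lemma ptV_unique: "p \<in> pts \<Longrightarrow> centred V p \<Longrightarrow> V = ptV p"
  using centred_unique[of "fst p" "snd p" V "ptV p"] ptV[of p] by simp

lemma ptV_vring: "p \<in> pts \<Longrightarrow> valuation_ring K (ptV p)"
  using ptV by (simp add: centred_def)

lemma ptV_x: "p \<in> pts \<Longrightarrow> x \<in> ptV p"
  using ptV[of p] x_mem_if_centred[of "ptV p" "fst p"] by (auto simp: centred_def pts_def)

lemma common_zero_eq:
  assumes p: "p \<in> pts" shows "common_zero K (x - fst p) (y - snd p) = vring_max (ptV p)"
proof -
  obtain a b where ab: "p = (a, b)" by (cases p)
  then have aK: "a \<in> K" "b \<in> K" using p by (auto simp: pts_def)
  have xa0: "x - fst p \<noteq> 0" using x_minus_const_nonzero[OF aK(1)] ab by simp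
  have yb0: "y - snd p \<noteq> 0"
  proof
    assume "y - snd p = 0"
    then have "y \<in> K" using aK ab by simp
    then show False using pord_const[of y] pord_y y_nonzero by simp
  qed
  have zero_iff: "zero_at (vring_max V) (x - fst p) \<and> zero_at (vring_max V) (y - snd p) \<longleftrightarrow> centred V p"
    if "valuation_ring K V" for V
    using that place_val_pos_iff[OF that vring_discrete[OF that]] xa0 yb0
    by (simp add: zero_at_def centred_def del: right_minus_eq)
  show ?thesis
    unfolding common_zero_def
  proof (rule the_equality)
    show "is_place K (vring_max (ptV p)) \<and> zero_at (vring_max (ptV p)) (x - fst p) \<and> zero_at (vring_max (ptV p)) (y - snd p)"
      using zero_iff[OF ptV_vring[OF p]] ptV[OF p] is_place_vring_max[OF ptV_vring[OF p]] by blast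
    fix P assume P: "is_place K P \<and> zero_at P (x - fst p) \<and> zero_at P (y - snd p)"
    then obtain V where V: "valuation_ring K V" "P = vring_max V" using is_placeE by blast
    then have "centred V p" using zero_iff P by blast
    then show "P = vring_max (ptV p)" using ptV_unique[OF p] V by blast
  qed
qed

section \<open>Evaluation of functions at the affine rational points\<close>

definition ev :: "'a \<times> 'a \<Rightarrow> 'a \<Rightarrow> 'a" where
  "ev p f = place_value K (vring_max (ptV p)) f"

lemma K_vring_max:
  assumes "valuation_ring K V" "c \<in> K" "c \<in> vring_max V" shows "c = 0"
  using units_const[OF K assms(1,2)] vring_max_not_unit[OF assms(3)] by blast

lemma ev_eqI:
  assumes p: "p \<in> pts" and c: "c \<in> K" "f - c \<in> vring_max (ptV p)" shows "ev p f = c"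
  unfolding ev_def place_value_def
proof (rule the_equality)
  show "c \<in> K \<and> f - c \<in> vring_max (ptV p)" using c by blast
  fix d assume d: "d \<in> K \<and> f - d \<in> vring_max (ptV p)"
  have "(f - c) - (f - d) \<in> vring_max (ptV p)" using c d vring_max_diff[OF ptV_vring[OF p]] by blast
  then have "d - c \<in> vring_max (ptV p)" by simp
  moreover have "d - c \<in> K" using c d by (auto intro: K_intros)
  ultimately show "d = c" using K_vring_max[OF ptV_vring[OF p]] by fastforce
qed

lemma ev_mem:
  assumes p: "p \<in> pts" and r: "r \<in> aff" shows "ev p r \<in> K" "r - ev p r \<in> vring_max (ptV p)"
proof -
  obtain a b where ab: "p = (a, b)" by (cases p)
  obtain c u v where c: "c \<in> K" "u \<in> aff" "v \<in> aff" "r = c + (x - a) * u + (y - b) * v"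
    using aff_taylor[OF p[unfolded ab] r] by blast
  have V: "valuation_ring K (ptV p)" using ptV_vring[OF p] .
  have "(x - a) * u + (y - b) * v \<in> vring_max (ptV p)"
    using vring_max_mult[OF V] aff_subset[OF V ptV_x[OF p]] c ptV[OF p] ab
    by (intro vring_max_add[OF V]) (auto simp: centred_def)
  then have m: "r - c \<in> vring_max (ptV p)" using c(4) by simp
  have "ev p r = c" by (rule ev_eqI[OF p c(1) m])
  then show "ev p r \<in> K" "r - ev p r \<in> vring_max (ptV p)" using c(1) m by auto
qed

lemma ev_const: "p \<in> pts \<Longrightarrow> c \<in> K \<Longrightarrow> ev p c = c"
  by (rule ev_eqI) (auto simp: vring_max_zero[OF ptV_vring])

lemma ev_x: "p \<in> pts \<Longrightarrow> ev p x = fst p" and ev_y: "p \<in> pts \<Longrightarrow> ev p y = snd p"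
  using ptV[of p] by (auto intro!: ev_eqI simp: pts_def centred_def)

lemma ev_add:
  assumes p: "p \<in> pts" and r: "r \<in> aff" "s \<in> aff" shows "ev p (r + s) = ev p r + ev p s"
proof (rule ev_eqI[OF p])
  show "ev p r + ev p s \<in> K" using ev_mem[OF p] r by (intro subring_add[OF K_subring])
  have "(r - ev p r) + (s - ev p s) \<in> vring_max (ptV p)"
    using ev_mem[OF p] r by (intro vring_max_add[OF ptV_vring[OF p]])
  then show "r + s - (ev p r + ev p s) \<in> vring_max (ptV p)" by (simp add: algebra_simps)
qed

lemma ev_mult:
  assumes p: "p \<in> pts" and r: "r \<in> aff" "s \<in> aff" shows "ev p (r * s) = ev p r * ev p s"
proof (rule ev_eqI[OF p])
  have V: "valuation_ring K (ptV p)" using ptV_vring[OF p] .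
  show "ev p r * ev p s \<in> K" using ev_mem[OF p] r by (intro subring_mult[OF K_subring])
  have "(r - ev p r) * s + (s - ev p s) * ev p r \<in> vring_max (ptV p)"
    using ev_mem[OF p] r aff_subset[OF V ptV_x[OF p]] vring_const[OF V ev_mem(1)[OF p r(1)]]
    by (intro vring_max_add[OF V] vring_max_mult[OF V])
  then show "r * s - ev p r * ev p s \<in> vring_max (ptV p)" by (simp add: algebra_simps)
qed

lemma ev_diff: "p \<in> pts \<Longrightarrow> r \<in> aff \<Longrightarrow> s \<in> aff \<Longrightarrow> ev p (r - s) = ev p r - ev p s"
  by (simp add: diff_eq ev_add)

lemma ev_power: "p \<in> pts \<Longrightarrow> r \<in> aff \<Longrightarrow> ev p (r ^ k) = ev p r ^ k"
  by (induction k) (auto simp: ev_const K_intros ev_mult subring_power[OF aff_subring])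

lemma ev_sum:
  assumes p: "p \<in> pts" and "\<And>i. i \<in> I \<Longrightarrow> f i \<in> aff" shows "ev p (sum f I) = (\<Sum>i\<in>I. ev p (f i))"
  using assms(2)
proof (induction I rule: infinite_finite_induct)
  case (insert i I)
  then show ?case using p by (simp add: ev_add subring_sum[OF aff_subring])
qed (use ev_const[OF p] in \<open>auto intro: K_intros\<close>)

lemma ev_msum:
  assumes p: "p \<in> pts" and c: "\<And>k. c k \<in> K"
  shows "ev p (msum c x y M) = msum c (fst p) (snd p) M"
proof -
  have mem: "x ^ i \<in> aff" "y ^ i \<in> aff" "c k \<in> aff" for i k
    using x_aff y_aff c K_aff by (auto intro: subring_power[OF aff_subring])
  have mem2: "x ^ i * y ^ j \<in> aff" for i j using mem by (intro subring_mult[OF aff_subring])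
  show ?thesis unfolding msum_def
    using p c mem mem2 x_aff y_aff
    by (subst ev_sum) (auto simp: ev_mult ev_power ev_const ev_x ev_y intro: subring_mult[OF aff_subring])
qed

text \<open>With an evaluation after a field homomorphism as \<open>\<phi>\<close>, this shows the
  composite to be the evaluation at another point, knowing only its values at \<open>x\<close> and
  \<open>y\<close>.\<close>

lemma ev_unique:
  assumes q: "q \<in> pts" and r: "r \<in> aff"
    and c: "\<And>c. c \<in> K \<Longrightarrow> \<phi> c = c"
    and add: "\<And>u v. u \<in> aff \<Longrightarrow> v \<in> aff \<Longrightarrow> \<phi> (u + v) = \<phi> u + \<phi> v"
    and mult: "\<And>u v. u \<in> aff \<Longrightarrow> v \<in> aff \<Longrightarrow> \<phi> (u * v) = \<phi> u * \<phi> v"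
    and x: "\<phi> x = fst q" and y: "\<phi> y = snd q"
  shows "\<phi> r = ev q r"
  using r by (induction rule: aff_induct) (simp_all add: c add mult x y ev_const ev_add ev_mult ev_x ev_y q)

text \<open>On the fibre over \<open>a\<close> the function is a polynomial in the second
  coordinate, of degree below \<open>Q\<close> and with \<open>Q\<close> zeros, so each of its
  coefficients vanishes at \<open>a\<close>. The coefficient at the leading exponent of
  \<open>y\<close> is thus a nonzero polynomial in \<open>x\<close>, of degree at most
  \<open>fst k\<close>, with all of \<open>K\<close> as roots.\<close>

lemma vanishing_degree:
  assumes r: "r \<in> aff" "r \<noteq> 0" and van: "\<And>p. p \<in> pts \<Longrightarrow> ev p r = 0"
    and k: "snd k < Q" "pord r = int (wt k)"
  shows "fst k \<ge> 4 * Q ^ 2"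
proof -
  obtain c s l where c: "\<forall>k. c k \<in> K" "r = msum c x y (exps s)" "l \<in> exps s" "c l \<noteq> 0"
    "\<forall>m\<in>exps s. c m \<noteq> 0 \<longrightarrow> wt m \<le> wt l" using aff_lead[OF r] by blast
  have "pord r = int (wt l)" unfolding c(2) using c finite_exps
    by (intro pord_msum[OF x_nonzero pord_x y_nonzero pord_y]) (auto simp: exps_def)
  then have kl: "k = l" using wt_inj[of k l] k c(3) by (simp add: exps_def)
  define P where "P = (\<Sum>m\<in>exps s. if snd m = snd l then monom (c m) (fst m) else 0)"
  have inj: "m = l" if "snd m = snd l" "fst m = fst l" for m :: "nat \<times> nat" using that by (simp add: prod_eq_iff)
  have "coeff P (fst l) = (\<Sum>m\<in>exps s. if m = l then c m else 0)"
    unfolding P_def coeff_sum by (intro sum.cong refl) (use inj in auto)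
  then have "coeff P (fst l) \<noteq> 0" using c(3,4) finite_exps by simp
  then have P0: "P \<noteq> 0" by auto
  have "degree P \<le> fst l" unfolding P_def
  proof (rule degree_sum_le[OF finite_exps])
    fix m assume m: "m \<in> exps s"
    show "degree (if snd m = snd l then monom (c m) (fst m) else 0) \<le> fst l"
    proof (cases "snd m = snd l \<and> c m \<noteq> 0")
      case True
      then have "wt m \<le> wt l" using c(5) m by blast
      then have "fst m * Q \<le> fst l * Q" using True by (simp add: wt_def)
      then have "fst m \<le> fst l" using Q_ge by simp
      then show ?thesis using True degree_monom_le[of "c m" "fst m"] by simp
    qed auto
  qed
  moreover have "card K \<le> degree P"
  proof -
    have "poly P a = 0" if a: "a \<in> K" for a
    proof -
      define F where "F = (\<Sum>m\<in>exps s. monom (c m * a ^ fst m) (snd m))"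
      have "F = 0"
      proof (rule poly_eqI_degree[of "{b \<in> K. h_poly n b = a ^ (2 * Q + 1)}"])
        fix b assume "b \<in> {b \<in> K. h_poly n b = a ^ (2 * Q + 1)}"
        then have p: "(a, b) \<in> pts" using a by (simp add: pts_def)
        have "poly F b = msum c a b (exps s)" by (simp add: F_def msum_def poly_sum poly_monom mult.assoc)
        also have "\<dots> = ev (a, b) r" using ev_msum[OF p, of c "exps s"] c(1,2) by simp
        finally show "poly F b = poly 0 b" using van[OF p] by simp
      next
        have "degree F \<le> Q - 1" unfolding F_def
        proof (rule degree_sum_le[OF finite_exps])
          fix k assume "k \<in> exps s"
          then have "snd k \<le> Q - 1" by (auto simp: exps_def)
          then show "degree (monom (c k * a ^ fst k) (snd k)) \<le> Q - 1"
            using degree_monom_le[of "c k * a ^ fst k" "snd k"] by linarith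
        qed
        then show "degree F < card {b \<in> K. h_poly n b = a ^ (2 * Q + 1)}" using fibre[OF a] Q_ge by simp
      qed (use fibre[OF a] Q_ge in simp)
      then have "coeff F (snd l) = 0" by simp
      moreover have "coeff F (snd l) = poly P a"
        unfolding F_def P_def coeff_sum poly_sum by (intro sum.cong refl) (auto simp: poly_monom)
      ultimately show ?thesis by simp
    qed
    then have "card K \<le> card {a. poly P a = 0}" using poly_roots_finite[OF P0] by (intro card_mono) auto
    also have "\<dots> \<le> degree P" by (rule card_poly_roots_bound[OF P0])
    finally show ?thesis .
  qed
  ultimately show ?thesis using card_K kl by simp
qed

lemma vanishing_pord:
  assumes r: "r \<in> aff" "r \<noteq> 0" and van: "\<And>p. p \<in> pts \<Longrightarrow> ev p r = 0"
  shows "pord r \<ge> int (4 * Q ^ 3)"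
proof -
  obtain k where k: "snd k < Q" "pord r = int (wt k)" using aff_decomp[OF r] by blast
  have "4 * Q ^ 2 * Q \<le> fst k * Q" using vanishing_degree[OF r van k] by (intro mult_le_mono1)
  also have "\<dots> \<le> wt k" by (simp add: wt_def)
  finally have "4 * Q ^ 3 \<le> wt k" by (simp add: power3_eq_cube power2_eq_square mult.assoc)
  then show ?thesis unfolding k(2) by (rule of_nat_mono)
qed

section \<open>Automorphisms fix the place at infinity\<close>

lemma Khom_inv:
  assumes S: "Khom S" "surj S" shows "Khom (inv_into UNIV S)" "surj (inv_into UNIV S)"
proof -
  have cancel: "S (inv_into UNIV S a) = a" for a using S(2) by (rule surj_f_inv_f)
  have eqI: "inv_into UNIV S a = b" if "S b = a" for a b
    using inv_f_f[OF Khom_inj[OF S(1)], of b] that by simp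
  show "Khom (inv_into UNIV S)" unfolding Khom_def
    by (auto intro!: eqI simp: Khom_add[OF S(1)] Khom_mult[OF S(1)] Khom_const[OF S(1)] cancel)
  show "surj (inv_into UNIV S)" by (rule surjI[of _ S]) (rule eqI, simp)
qed

lemma uniformizer_vimage:
  assumes V: "valuation_ring K V" and S: "Khom S" "surj S" and t: "uniformizer V (S t)"
  shows "uniformizer (S -` V) t"
  unfolding uniformizer_def
proof (intro conjI allI impI)
  have units: "u \<in> ring_units (S -` V) \<longleftrightarrow> S u \<in> ring_units V" for u
    by (simp add: ring_units_def Khom_inverse[OF S(1)] Khom_eq_zero[OF S(1)])
  show "t \<noteq> 0" using t Khom_zero[OF S(1)] by (auto simp: uniformizer_def)
  show "t \<in> vring_max (S -` V)" using t vring_max_vimage[OF V S] by (simp add: uniformizer_def)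
  fix z :: 'a assume "z \<noteq> 0"
  then have "S z \<noteq> 0" by (simp add: Khom_eq_zero[OF S(1)])
  then obtain k u where u: "u \<in> ring_units V" "S z = S t powi k * u" using t by (auto simp: uniformizer_def)
  obtain u' where u': "u = S u'" using S(2) by (metis surjD)
  have "S t powi k = S (t powi k)"
    by (simp add: power_int_def Khom_power[OF S(1)] Khom_inverse[OF S(1)])
  then have "S z = S (t powi k * u')" using u u' by (simp add: Khom_mult[OF S(1)])
  then have "z = t powi k * u'" using Khom_inj[OF S(1)] by (simp add: inj_eq)
  moreover have "u' \<in> ring_units (S -` V)" using units u u' by simp
  ultimately show "\<exists>k u. u \<in> ring_units (S -` V) \<and> z = t powi k * u" by blast
qed

lemma place_val_vimage:
  assumes V: "valuation_ring K V" and S: "Khom S" "surj S" and z: "z \<noteq> 0"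
  shows "pval (S -` V) z = pval V (S z)"
proof -
  obtain t0 where t0: "uniformizer V t0" using vring_discrete[OF V] by (auto simp: discrete_def)
  obtain t where t: "t0 = S t" using S(2) by (metis surjD)
  have ut: "uniformizer (S -` V) t" using uniformizer_vimage[OF V S] t0 t by simp
  have W: "valuation_ring K (S -` V)" using vring_vimage[OF V S] .
  obtain u where u: "u \<in> ring_units (S -` V)" "z = t powi pval (S -` V) z * u"
    using place_val_decomp[OF W ut z] by blast
  define k where "k = pval (S -` V) z"
  have "S u \<in> ring_units V"
    using u(1) by (simp add: ring_units_def Khom_inverse[OF S(1)] Khom_eq_zero[OF S(1)])
  moreover have "S z = t0 powi k * S u"
    using u(2) unfolding k_def[symmetric]
    by (metis Khom_mult[OF S(1)] Khom_power[OF S(1)] Khom_inverse[OF S(1)] power_int_def t)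
  ultimately show ?thesis using place_val_eqI[OF V t0] k_def by metis
qed

text \<open>Expanding by \<open>frobenius\<close> makes consecutive terms cancel in characteristic
  two.\<close>

lemma h_telescope: "h_poly n (w + w ^ 2) = (w :: 'a) + w ^ (2 * Q)"
proof -
  have eq: "2 * Q = 2 ^ n" using n by (cases n) (auto simp: Q_eq)
  have "(\<Sum>i<m. (w + w ^ 2) ^ 2 ^ i) = w + w ^ 2 ^ m" for m
  proof (induction m)
    case (Suc m)
    have "(w + w ^ 2) ^ 2 ^ m = w ^ 2 ^ m + w ^ 2 ^ Suc m"
      by (simp add: frobenius power_mult[symmetric])
    then show ?case using Suc by (simp add: add.assoc) (simp add: two_eq_zero)
  qed (simp add: add_self)
  then show ?thesis by (simp add: h_poly_def eq)
qed

text \<open>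
  The argument of \<open>h\<close> is the image of \<open>y\<close> under the translation of
  the curve that moves \<open>(a, b)\<close> to the origin.
\<close>

lemma tangent_function:
  assumes p: "(a, b) \<in> pts"
  defines "xh \<equiv> x - a" and "e \<equiv> a ^ (2 * Q)"
  shows "h_poly n (y - b + e * xh + (e * xh) ^ 2) = xh ^ (2 * Q + 1)"
proof -
  have q: "2 * Q = 2 ^ n" using n by (cases n) (auto simp: Q_eq)
  have aK: "a \<in> K" and hb: "h_poly n b = a ^ (2 * Q + 1)" using p by (auto simp: pts_def)
  have "e ^ (2 * Q) = a ^ (4 * Q ^ 2)" by (simp add: e_def power_mult[symmetric] power2_eq_square mult_ac)
  \<comment> \<open>Raising to the power q is an involution on \<open>K\<close>.\<close>
  then have eq: "e ^ (2 * Q) = a" using K_power[OF aK] by simp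
  have xq: "xh ^ (2 * Q) = x ^ (2 * Q) + e" unfolding xh_def e_def diff_eq q by (rule frobenius)
  have exq: "(e * xh) ^ (2 * Q) = a * (x ^ (2 * Q) + e)" by (simp only: power_mult_distrib eq xq)
  have "h_poly n (y - b + e * xh + (e * xh) ^ 2) = h_poly n y + h_poly n b + h_poly n (e * xh + (e * xh) ^ 2)"
    by (simp add: diff_eq h_add add.assoc)
  also have "\<dots> = x ^ (2 * Q + 1) + a ^ (2 * Q + 1) + (e * xh + a * (x ^ (2 * Q) + e))"
    by (simp only: h_telescope hb curve_eq exq)
  also have "\<dots> = x ^ (2 * Q) * x + e * a + (e * (x + a) + a * (x ^ (2 * Q) + e))"
    by (simp add: e_def xh_def diff_eq mult.commute)
  also have "\<dots> = (x ^ (2 * Q) + e) * (x + a) + (a * e + a * e)"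
    by (simp only: distrib_left distrib_right add_ac mult_ac)
  also have "\<dots> = (x ^ (2 * Q) + e) * xh" by (simp add: add_self xh_def diff_eq)
  finally show ?thesis using xq by (simp add: mult.commute)
qed

text \<open>The next power \<open>x^3\<close> has weight \<open>3 * Q\<close>, which exceeds
  \<open>2 * Q + 1\<close> because \<open>Q \<ge> 2\<close>.\<close>

lemma exps_small: "exps (2 * Q + 1) = {(0, 0), (1, 0), (2, 0), (0, 1)}"
proof -
  have "k \<in> exps (2 * Q + 1) \<longleftrightarrow> k \<in> {(0, 0), (1, 0), (2, 0), (0, 1)}" for k
  proof
    obtain i j where ij: "k = (i, j)" by (cases k)
    assume "k \<in> exps (2 * Q + 1)"
    then have le: "i * Q + j * (2 * Q + 1) \<le> 2 * Q + 1" by (simp add: exps_def wt_def ij)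
    have "j \<le> 1"
    proof (rule ccontr)
      assume "\<not> j \<le> 1"
      then have "2 * (2 * Q + 1) \<le> j * (2 * Q + 1)" by (intro mult_le_mono1) simp
      then show False using le by simp
    qed
    moreover have "i \<le> 2"
    proof (rule ccontr)
      assume "\<not> i \<le> 2"
      then have "3 * Q \<le> i * Q" by (intro mult_le_mono1) simp
      then show False using le Q_ge by linarith
    qed
    moreover have "i = 0" if "j = 1" using that le Q_ge by simp
    ultimately show "k \<in> {(0, 0), (1, 0), (2, 0), (0, 1)}" unfolding ij
      by (cases "j = 0") (auto simp: le_Suc_eq numeral_2_eq_2)
  next
    assume "k \<in> {(0, 0), (1, 0), (2, 0), (0, 1)}"
    then show "k \<in> exps (2 * Q + 1)" using Q_ge by (auto simp: exps_def wt_def)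
  qed
  then show ?thesis by blast
qed

lemma aut_Vinf:
  assumes S: "Khom S" "surj S" shows "S -` Vinf = Vinf"
proof (rule ccontr)
  define W where "W = S -` Vinf"
  assume "S -` Vinf \<noteq> Vinf"
  then have WV: "W \<noteq> Vinf" by (simp add: W_def)
  have W: "valuation_ring K W" unfolding W_def using vring_vimage[OF Vinf S] .
  have W': "is_subring W" using W by (rule vring_subring)
  have D: "discrete W" using vring_discrete[OF W] .
  have xW: "x \<in> W" using Vinf_unique[OF W] WV by blast
  have yW: "y \<in> W" using y_mem_iff[OF W] xW by simp
  \<comment> \<open>\<open>W\<close> is the preimage of a rational place, so its residue field is
    \<open>K\<close> as well.\<close>
  have res: "\<exists>c\<in>K. z - c \<in> vring_max W" if "z \<in> W" for z
  proof -
    have "S z \<in> Vinf" using that by (simp add: W_def)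
    then obtain c where c: "c \<in> K" "S z - c \<in> vring_max Vinf" using Vinf_residue by blast
    then have "S (z - c) \<in> vring_max Vinf" by (simp add: Khom_diff[OF S(1)] Khom_const[OF S(1)])
    then show ?thesis using c vring_max_vimage[OF Vinf S] W_def by blast
  qed
  obtain a where a: "a \<in> K" "x - a \<in> vring_max W" using res[OF xW] by blast
  obtain b where b: "b \<in> K" "y - b \<in> vring_max W" using res[OF yW] by blast
  have KW: "c \<in> W" if "c \<in> K" for c using vring_const[OF W that] .
  have "(y - b) * (1 + (\<Sum>i\<in>{1..<n}. (y - b) ^ (2 ^ i - 1))) \<in> vring_max W"
    by (rule vring_max_mult[OF W b(2)])
       (intro subring_add[OF W'] subring_one[OF W'] subring_sum[OF W'] subring_power[OF W'] vring_max_mem[OF b(2)])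
  then have h1: "h_poly n (y - b) \<in> vring_max W" using h_bot by simp
  have "(x - a) * (\<Sum>i<2 * Q + 1. a ^ (2 * Q + 1 - Suc i) * x ^ i) \<in> vring_max W"
    by (rule vring_max_mult[OF W a(2)])
       (intro subring_sum[OF W'] subring_mult[OF W'] subring_power[OF W'] xW KW a(1))
  then have h2: "x ^ (2 * Q + 1) - a ^ (2 * Q + 1) \<in> vring_max W" by (simp only: power_diff_sumr2)
  \<comment> \<open>The two functions vanish at \<open>W\<close> and differ by a constant, which
    must then be zero; so \<open>(a, b)\<close> lies on the curve.\<close>
  have "h_poly n (y - b) - (x ^ (2 * Q + 1) - a ^ (2 * Q + 1)) = a ^ (2 * Q + 1) - h_poly n b"
  proof -
    have "h_poly n (y - b) = x ^ (2 * Q + 1) + h_poly n b" by (simp only: diff_eq h_add curve_eq)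
    then have "h_poly n (y - b) - (x ^ (2 * Q + 1) - a ^ (2 * Q + 1)) = a ^ (2 * Q + 1) + h_poly n b"
      by (simp only: diff_diff_eq2) simp
    then show ?thesis by (simp only: diff_eq[of "a ^ (2 * Q + 1)"])
  qed
  then have "a ^ (2 * Q + 1) - h_poly n b \<in> vring_max W" using vring_max_diff[OF W h1 h2] by metis
  moreover have "a ^ (2 * Q + 1) - h_poly n b \<in> K"
    unfolding h_poly_def using a b by (intro subring_diff[OF K_subring] subring_power[OF K_subring] subring_sum[OF K_subring])
  ultimately have "a ^ (2 * Q + 1) - h_poly n b = 0" using K_vring_max[OF W] by blast
  then have p: "(a, b) \<in> pts" using a b by (simp add: pts_def)
  have cW: "centred W (a, b)" using W a b by (simp add: centred_def)
  define xh where "xh = x - a"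
  define e where "e = a ^ (2 * Q)"
  \<comment> \<open>By \<open>tangent_function\<close> and \<open>h_small\<close> its order at
    \<open>W\<close> comes out as \<open>2 * Q + 1\<close>.\<close>
  define yh where "yh = y - b + e * xh + (e * xh) ^ 2"
  have eK: "e \<in> K" unfolding e_def using a by (intro subring_power[OF K_subring])
  have ux: "uniformizer W xh" unfolding xh_def by (rule centred_uniformizer[OF p cW])
  have xh0: "xh \<noteq> 0" and xhW: "xh \<in> vring_max W" using ux by (auto simp: uniformizer_def)
  have vx: "pval W xh = 1"
    by (rule place_val_eqI[OF W ux units_one[OF W']]) simp
  have exW: "e * xh \<in> vring_max W" using vring_max_mult[OF W xhW KW[OF eK]] by (simp add: mult.commute)
  have yhW: "yh \<in> vring_max W" unfolding yh_def power2_eq_square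
    using b(2) exW vring_max_mult[OF W exW vring_max_mem[OF exW]] by (intro vring_max_add[OF W])
  have hyh: "h_poly n yh = xh ^ (2 * Q + 1)"
    unfolding yh_def e_def xh_def by (rule tangent_function[OF p])
  have yh0: "yh \<noteq> 0" using hyh h_zero xh0 by auto
  define u where "u = 1 + (\<Sum>i\<in>{1..<n}. yh ^ (2 ^ i - 1))"
  have uW: "u \<in> ring_units W" unfolding u_def by (rule h_small[OF W yhW])
  have "yh * u = xh ^ (2 * Q + 1)" using hyh h_bot[of yh] by (simp add: u_def)
  then have vy: "pval W yh = int (2 * Q + 1)"
    using place_val_mult[OF W D yh0 units_nonzero[OF uW]] place_val_unit[OF W D uW]
      place_val_power[OF W D xh0, of "2 * Q + 1"] vx by simp
  \<comment> \<open>The only pole of this preimage of \<open>x\<close> is \<open>W\<close>, and it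
    has order \<open>Q\<close>.\<close>
  obtain z where z: "S z = x" using S(2) by (metis surjD)
  have z0: "z \<noteq> 0" using z x_nonzero Khom_zero[OF S(1)] by auto
  have vz: "pval W z = - int Q"
    unfolding W_def using place_val_vimage[OF Vinf S z0] z pord_x by (simp add: pord_def)
  have zV: "z \<in> V" if V: "valuation_ring K V" "V \<noteq> W" for V
  proof (rule ccontr)
    assume "z \<notin> V"
    let ?U = "inv_into UNIV S -` V"
    have U: "valuation_ring K ?U" using vring_vimage[OF V(1) Khom_inv[OF S]] .
    have "inv_into UNIV S x = z" using z Khom_inj[OF S(1)] by (metis inv_f_f)
    then have "x \<notin> ?U" using \<open>z \<notin> V\<close> by simp
    then have "?U = Vinf" using Vinf_unique[OF U] by blast
    then have "W = S -` ?U" by (simp add: W_def)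
    also have "\<dots> = V" using Khom_inj[OF S(1)] by auto
    finally show False using V by simp
  qed
  define g where "g = z * yh"
  have g0: "g \<noteq> 0" using z0 yh0 by (simp add: g_def)
  have vg: "pval W g = int Q + 1"
    unfolding g_def using place_val_mult[OF W D z0 yh0] vz vy by simp
  have xhL: "xh \<in> Lspace Q" unfolding xh_def using Lspace_diff[OF x_Lspace const_Lspace[OF a(1)]] .
  have yhL: "yh \<in> Lspace (2 * Q + 1)"
  proof -
    have "y - b \<in> Lspace (2 * Q + 1)" using Lspace_diff[OF y_Lspace const_Lspace[OF b(1)]] .
    moreover have ex: "e * xh \<in> Lspace Q" using Lspace_scale[OF xhL eK] .
    then have "e * xh \<in> Lspace (2 * Q + 1)" using Lspace_mono[of Q "2 * Q + 1"] by auto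
    moreover have "(e * xh) ^ 2 \<in> Lspace (2 * Q + 1)"
      using Lspace_mult[OF ex ex] Lspace_mono[of "Q + Q" "2 * Q + 1"] by (auto simp: power2_eq_square)
    ultimately show ?thesis unfolding yh_def by (intro Lspace_add)
  qed
  have yhA: "yh \<in> aff" using Lspace_aff[OF yhL] .
  have gA: "g \<in> aff"
  proof (rule aff_if_all_vrings)
    fix V assume V: "valuation_ring K V" "x \<in> V"
    show "g \<in> V"
    proof (cases "V = W")
      case True
      then show ?thesis using place_val_nonneg_iff[OF W D g0] vg by simp
    next
      case False
      then show ?thesis unfolding g_def using zV[OF V(1) False] aff_subset[OF V yhA]
        by (intro subring_mult[OF vring_subring[OF V(1)]])
    qed
  qed
  have "pord z \<le> 0" using zV[OF Vinf] WV pord_le_iff[OF z0] by auto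
  moreover have "pord yh \<le> int (2 * Q + 1)" using yhL yh0 Lspace_iff by blast
  ultimately have "pord g \<le> int (2 * Q + 1)" using pord_mult[OF z0 yh0] by (simp add: g_def)
  then have "g \<in> Lspace (2 * Q + 1)" using Lspace_iff gA by blast
  then obtain c where c: "\<forall>k. c k \<in> K" "g = msum c x y (exps (2 * Q + 1))" by (auto simp: Lspace_def)
  have geq: "g = c (0, 0) + c (1, 0) * x + c (2, 0) * x ^ 2 + c (0, 1) * y"
    unfolding c(2) exps_small msum_def by (simp add: algebra_simps)
  have cK: "c k \<in> K" for k using c(1) by blast
  define c3 where "c3 = c (0, 1)"
  \<comment> \<open>The coefficients of \<open>g\<close> after the change from \<open>x\<close>,
    \<open>y\<close> to \<open>xh\<close>, \<open>yh\<close>; squaring is additive, so no mixed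
    terms arise.\<close>
  define d0 where "d0 = c (0, 0) + c (1, 0) * a + c (2, 0) * a ^ 2 + c3 * b"
  define d1 where "d1 = c (1, 0) + c3 * e"
  define d2 where "d2 = c (2, 0) + c3 * e ^ 2"
  have dK: "d0 \<in> K" "d1 \<in> K" "d2 \<in> K" "c3 \<in> K"
    unfolding d0_def d1_def d2_def c3_def using cK a(1) b(1) eK
    by (auto intro!: subring_add[OF K_subring] subring_mult[OF K_subring] subring_power[OF K_subring])
  have xx: "x = xh + a" by (simp add: xh_def)
  have yy: "y = yh + b + e * xh + (e * xh) ^ 2"
  proof -
    have "y = yh + b - e * xh - (e * xh) ^ 2" by (simp add: yh_def)
    then show ?thesis by (simp only: diff_eq)
  qed
  have x2: "x ^ 2 = xh ^ 2 + a ^ 2"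
    unfolding xx using frobenius[of xh a 1] by simp
  have "g = d0 + d1 * xh + d2 * xh ^ 2 + c3 * yh"
    unfolding geq x2 d0_def d1_def d2_def c3_def[symmetric] by (subst yy, subst xx) (simp add: algebra_simps power_mult_distrib)
  then have gd: "g - c3 * yh = d0 + (d1 * xh + d2 * xh ^ 2)" by simp
  define r where "r = d0 + (d1 * xh + d2 * xh ^ 2)"
  \<comment> \<open>Both \<open>g\<close> and \<open>yh\<close> vanish at \<open>W\<close> to order
    at least \<open>Q + 1 \<ge> 3\<close>, while a nonzero combination of \<open>1\<close>,
    \<open>xh\<close>, \<open>xh^2\<close> vanishes to order at most 2.\<close>
  have vr: "pval W r \<ge> 3" if r0: "r \<noteq> 0"
  proof -
    have "pval W (g + - (c3 * yh)) \<ge> 3"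
    proof (rule place_val_add_ge[OF W D])
      show "g + - (c3 * yh) \<noteq> 0" using r0 gd by (simp add: r_def)
      show "g = 0 \<or> 3 \<le> pval W g" using vg Q_ge by simp
      show "- (c3 * yh) = 0 \<or> 3 \<le> pval W (- (c3 * yh))"
        using place_val_minus[OF W D, of "c3 * yh"] place_val_mult[OF W D _ yh0, of c3]
          place_val_const[OF W D K dK(4)] vy Q_ge by (cases "c3 = 0") auto
    qed
    then show ?thesis using gd by (simp add: r_def)
  qed
  have small: "pval W (v * w) = pval W v" if "v \<noteq> 0" "w \<in> ring_units W" for v w
    using place_val_mult[OF W D that(1) units_nonzero[OF that(2)]] place_val_unit[OF W D that(2)] by simp
  have xhW': "xh \<in> W" using xhW by (rule vring_max_mem)
  have d0z: "d0 = 0"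
  proof (rule ccontr)
    assume "d0 \<noteq> 0"
    have "xh * (d1 + d2 * xh) \<in> vring_max W"
      by (rule vring_max_mult[OF W xhW]) (intro subring_add[OF W'] subring_mult[OF W'] KW dK xhW')
    then have "d1 * xh + d2 * xh ^ 2 \<in> vring_max W" by (simp add: algebra_simps power2_eq_square)
    from unit_add_max[OF W units_const[OF K W dK(1) \<open>d0 \<noteq> 0\<close>] this]
    have "r \<in> ring_units W" by (simp add: r_def)
    then show False using vr place_val_unit[OF W D] units_nonzero by fastforce
  qed
  have d1z: "d1 = 0"
  proof (rule ccontr)
    assume "d1 \<noteq> 0"
    have "xh * d2 \<in> vring_max W" by (rule vring_max_mult[OF W xhW KW[OF dK(3)]])
    from unit_add_max[OF W units_const[OF K W dK(2) \<open>d1 \<noteq> 0\<close>] this]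
    have v: "d1 + xh * d2 \<in> ring_units W" .
    have "r = xh * (d1 + xh * d2)" using d0z by (simp add: r_def algebra_simps power2_eq_square)
    then have "r \<noteq> 0" "pval W r = 1" using small[OF xh0 v] vx xh0 units_nonzero[OF v] by auto
    then show False using vr by simp
  qed
  have d2z: "d2 = 0"
  proof (rule ccontr)
    assume "d2 \<noteq> 0"
    have v: "d2 \<in> ring_units W" using units_const[OF K W dK(3) \<open>d2 \<noteq> 0\<close>] .
    have "r = xh ^ 2 * d2" using d0z d1z by (simp add: r_def)
    moreover have "pval W (xh ^ 2) = 2" using place_val_power[OF W D xh0, of 2] vx by simp
    ultimately have "r \<noteq> 0" "pval W r = 2" using small[of "xh ^ 2" d2] v xh0 units_nonzero[OF v] by auto
    then show False using vr by simp
  qed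
  have "g = c3 * yh" using gd d0z d1z d2z by simp
  then have "z = c3" using yh0 by (simp add: g_def)
  then have "pval W z = 0" using place_val_const[OF W D K dK(4)] z0 by simp
  then show False using vz Q_ge by simp
qed

lemma aut_pord:
  assumes S: "Khom S" "surj S" and "z \<noteq> 0" shows "pord (S z) = pord z"
  using place_val_vimage[OF Vinf S assms(3)] aut_Vinf[OF S] by (simp add: pord_def)

text \<open>An automorphism permutes the valuation rings and fixes the one at infinity, so it
  permutes those containing \<open>x\<close>.\<close>

lemma aut_aff:
  assumes S: "Khom S" "surj S" and r: "r \<in> aff" shows "S r \<in> aff"
proof (rule aff_if_all_vrings)
  fix V assume V: "valuation_ring K V" "x \<in> V"
  have W: "valuation_ring K (S -` V)" using vring_vimage[OF V(1) S] .
  have "S -` V \<noteq> Vinf"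
  proof
    assume "S -` V = Vinf"
    then have "S -` V = S -` Vinf" using aut_Vinf[OF S] by simp
    then have "V = Vinf" using S(2) by (metis surj_image_vimage_eq)
    then show False using V x_notin_Vinf by simp
  qed
  then have "x \<in> S -` V" using Vinf_unique[OF W] by blast
  then show "S r \<in> V" using aff_subset[OF W _ r] by simp
qed

lemma aut_Lspace:
  assumes S: "Khom S" "surj S" and r: "r \<in> Lspace s" shows "S r \<in> Lspace s"
  using r aut_aff[OF S] aut_pord[OF S, of r] Khom_zero[OF S(1)] by (cases "r = 0") (auto simp: Lspace_iff)

section \<open>Permutations preserving the code\<close>

text \<open>A nonzero difference vanishing at all points would have pole order at least
  \<open>4 * Q ^ 3\<close> by \<open>vanishing_pord\<close>.\<close>

lemma ev_inj:
  assumes "r \<in> Lspace s" "r' \<in> Lspace s" "s < 4 * Q ^ 3" "\<And>p. p \<in> pts \<Longrightarrow> ev p r = ev p r'"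
  shows "r = r'"
proof (rule ccontr)
  assume "r \<noteq> r'"
  then have nz: "r - r' \<noteq> 0" by simp
  have L: "r - r' \<in> Lspace s" using Lspace_diff assms by blast
  have "ev p (r - r') = 0" if "p \<in> pts" for p
    using ev_diff[OF that] assms Lspace_aff that by simp
  from vanishing_pord[OF Lspace_aff[OF L] nz this] L nz assms(3) show False
    unfolding Lspace_iff by (metis leD of_nat_less_iff order_trans)
qed

text \<open>Apart from the at most \<open>Q\<close> pure powers of \<open>y\<close>, each monomial
  in \<open>Lspace m\<close> is \<open>x\<close> times one in \<open>Lspace (m - Q)\<close>.
  Dimensions are expressed through cardinalities, \<open>K\<close> being finite.\<close>

lemma card_Lspace_le:
  assumes "Q \<le> m" shows "card (Lspace m) \<le> card K ^ Q * card (Lspace (m - Q))"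
    and "finite (Lspace m)"
proof -
  define \<Phi> where "\<Phi> = (\<lambda>(c, r). (\<Sum>j<Q. c j * y ^ j) + x * r)"
  have fin: "finite (Lspace s)" for s
  proof (rule finite_subset)
    show "Lspace s \<subseteq> (\<lambda>c. msum c x y (exps s)) ` (PiE (exps s) (\<lambda>_. K))"
    proof
      fix r assume "r \<in> Lspace s"
      then obtain c where c: "\<forall>k. c k \<in> K" "r = msum c x y (exps s)" by (auto simp: Lspace_def)
      have "r = msum (restrict c (exps s)) x y (exps s)"
        unfolding c(2) msum_def by (intro sum.cong refl) simp
      moreover have "restrict c (exps s) \<in> PiE (exps s) (\<lambda>_. K)" using c(1) by (auto intro!: restrict_PiE)
      ultimately show "r \<in> (\<lambda>c. msum c x y (exps s)) ` (PiE (exps s) (\<lambda>_. K))" by blast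
    qed
    show "finite ((\<lambda>c. msum c x y (exps s)) ` (PiE (exps s) (\<lambda>_. K)))"
      using finite_exps finite_K by (intro finite_imageI finite_PiE)
  qed
  then show "finite (Lspace m)" .
  have "Lspace m \<subseteq> \<Phi> ` (PiE {..<Q} (\<lambda>_. K) \<times> Lspace (m - Q))"
  proof
    fix r assume "r \<in> Lspace m"
    then obtain c where c: "\<forall>k. c k \<in> K" "r = msum c x y (exps m)" by (auto simp: Lspace_def)
    define A where "A = {k \<in> exps m. fst k = 0}"
    define B where "B = {k \<in> exps m. fst k \<noteq> 0}"
    define d where "d = restrict (\<lambda>j. if (0, j) \<in> exps m then c (0, j) else 0) {..<Q}"
    have fAB: "finite A" "finite B" using finite_exps by (auto simp: A_def B_def)
    have "r = msum c x y A + msum c x y B"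
      unfolding c(2) msum_def by (subst sum.union_disjoint[symmetric])
        (use fAB in \<open>auto simp: A_def B_def intro!: sum.cong\<close>)
    also have "msum c x y A = (\<Sum>j<Q. d j * y ^ j)"
    proof -
      have "(\<Sum>j<Q. d j * y ^ j) = (\<Sum>j\<in>{j. j < Q \<and> (0, j) \<in> exps m}. c (0, j) * y ^ j)"
        by (rule sum.mono_neutral_cong_right) (auto simp: d_def)
      also have "\<dots> = msum c x y A" unfolding msum_def
        by (rule sum.reindex_bij_witness[of _ snd "\<lambda>j. (0, j)"]) (auto simp: A_def exps_def)
      finally show ?thesis by simp
    qed
    also have "msum c x y B = x * (\<Sum>k\<in>B. c k * (x ^ (fst k - 1) * y ^ snd k))"
      unfolding msum_def sum_distrib_left
    proof (intro sum.cong refl)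
      fix k assume "k \<in> B"
      then obtain i where "fst k = Suc i" by (auto simp: B_def gr0_conv_Suc)
      then show "c k * (x ^ fst k * y ^ snd k) = x * (c k * (x ^ (fst k - 1) * y ^ snd k))" by (simp add: mult_ac)
    qed
    finally have req: "r = \<Phi> (d, \<Sum>k\<in>B. c k * (x ^ (fst k - 1) * y ^ snd k))" by (simp add: \<Phi>_def)
    have "(\<Sum>k\<in>B. c k * (x ^ (fst k - 1) * y ^ snd k)) \<in> Lspace (m - Q)"
    proof (rule Lspace_sum, rule Lspace_scale)
      fix k assume k: "k \<in> B"
      then obtain i where i: "fst k = Suc i" by (auto simp: B_def gr0_conv_Suc)
      have "wt k \<le> m" using k by (simp add: B_def exps_def)
      then have "(fst k - 1) * Q + snd k * (2 * Q + 1) \<le> m - Q" using i by (simp add: wt_def)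
      then show "x ^ (fst k - 1) * y ^ snd k \<in> Lspace (m - Q)"
        using monom_Lspace[of "fst k - 1" "snd k"] Lspace_mono by blast
      show "c k \<in> K" using c(1) by blast
    qed
    moreover have "d \<in> PiE {..<Q} (\<lambda>_. K)" unfolding d_def using c(1) by (auto intro!: restrict_PiE K_intros)
    ultimately show "r \<in> \<Phi> ` (PiE {..<Q} (\<lambda>_. K) \<times> Lspace (m - Q))" using req by blast
  qed
  moreover have finP: "finite (PiE {..<Q} (\<lambda>_. K))" using finite_K by (intro finite_PiE) auto
  ultimately have "card (Lspace m) \<le> card (\<Phi> ` (PiE {..<Q} (\<lambda>_. K) \<times> Lspace (m - Q)))"
    using fin by (intro card_mono) auto
  also have "\<dots> \<le> card (PiE {..<Q} (\<lambda>_. K) \<times> Lspace (m - Q))" using finP fin by (intro card_image_le) auto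
  also have "\<dots> = card K ^ Q * card (Lspace (m - Q))" by (simp add: card_cartesian_product card_PiE)
  finally show "card (Lspace m) \<le> card K ^ Q * card (Lspace (m - Q))" .
qed

lemma msum_diff: "msum c f g M - msum d f g M = msum (\<lambda>k. c k - d k) f g M"
  by (simp add: msum_def sum_subtractf left_diff_distrib)

lemma Q_powers: "2 * Q \<le> Q ^ 2" "2 * Q ^ 2 \<le> Q ^ 3"
  using Q_ge by (auto simp: power2_eq_square power3_eq_cube)

lemma wt_less:
  assumes "wt l < 4 * Q ^ 3" shows "fst l < 4 * Q ^ 2"
proof (rule ccontr)
  assume "\<not> fst l < 4 * Q ^ 2"
  then have "4 * Q ^ 2 * Q \<le> fst l * Q" by (intro mult_le_mono1) simp
  moreover have "4 * Q ^ 2 * Q = 4 * Q ^ 3" by (simp add: power3_eq_cube power2_eq_square)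
  moreover have "fst l * Q \<le> wt l" by (simp add: wt_def)
  ultimately show False using assms by linarith
qed

section \<open>The map on functions induced by a permutation that preserves the code\<close>

context
  fixes T :: "'a \<times> 'a \<Rightarrow> 'a \<times> 'a" and m :: nat
  assumes T: "bij_betw T pts pts"
    and pres: "\<And>f. f \<in> Lspace m \<Longrightarrow> \<exists>g\<in>Lspace m. \<forall>p\<in>pts. ev p g = ev (T p) f"
    and m_lo: "2 * Q + 1 \<le> m" and m_hi: "m + 3 * Q + 1 \<le> 4 * Q ^ 3"
begin

text \<open>The choice is unique by \<open>ev_inj\<close>, because
  \<open>m < 4 * Q ^ 3\<close>.\<close>

definition lam :: "'a \<Rightarrow> 'a" where
  "lam f = (SOME g. g \<in> Lspace m \<and> (\<forall>p\<in>pts. ev p g = ev (T p) f))"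

lemma T_pts: "p \<in> pts \<Longrightarrow> T p \<in> pts"
  using T by (auto simp: bij_betw_def)

lemma lam_mem: "f \<in> Lspace m \<Longrightarrow> lam f \<in> Lspace m"
  and lam_ev: "f \<in> Lspace m \<Longrightarrow> p \<in> pts \<Longrightarrow> ev p (lam f) = ev (T p) f"
proof -
  assume "f \<in> Lspace m"
  then have "\<exists>g. g \<in> Lspace m \<and> (\<forall>p\<in>pts. ev p g = ev (T p) f)" using pres by blast
  from someI_ex[OF this] show "lam f \<in> Lspace m" "p \<in> pts \<Longrightarrow> ev p (lam f) = ev (T p) f"
    by (auto simp: lam_def)
qed

lemma lam_aff: "f \<in> Lspace m \<Longrightarrow> lam f \<in> aff"
  by (rule Lspace_aff[OF lam_mem])

lemma m_less: "m < 4 * Q ^ 3" using m_hi by simp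

lemma lam_eqI:
  assumes "f \<in> Lspace m" "g \<in> Lspace m" "\<And>p. p \<in> pts \<Longrightarrow> ev p g = ev (T p) f" shows "lam f = g"
  by (rule ev_inj[OF lam_mem[OF assms(1)] assms(2) m_less]) (simp add: lam_ev[OF assms(1)] assms(3))

lemma lam_inj:
  assumes f: "f \<in> Lspace m" "g \<in> Lspace m" and eq: "lam f = lam g" shows "f = g"
proof (rule ev_inj[OF f m_less])
  fix p assume "p \<in> pts"
  then have "p \<in> T ` pts" using T by (simp add: bij_betw_def)
  then obtain p' where "p' \<in> pts" "p = T p'" by blast
  then show "ev p f = ev p g" using lam_ev[OF f(1)] lam_ev[OF f(2)] eq by metis
qed

lemma lam_diff:
  assumes "f \<in> Lspace m" "g \<in> Lspace m" shows "lam (f - g) = lam f - lam g"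
proof (rule lam_eqI)
  show "f - g \<in> Lspace m" "lam f - lam g \<in> Lspace m" using assms lam_mem Lspace_diff by auto
  fix p assume "p \<in> pts"
  then show "ev p (lam f - lam g) = ev (T p) (f - g)"
    using assms by (simp add: ev_diff Lspace_aff[of _ m] lam_aff lam_ev T_pts)
qed

lemma lam_const: "c \<in> K \<Longrightarrow> lam c = c"
  by (rule lam_eqI) (auto simp: const_Lspace ev_const T_pts)

lemma sub_L: "w \<in> Lspace (m - Q) \<Longrightarrow> w \<in> Lspace m"
  using Lspace_mono[of "m - Q" m] by auto

lemma x_mult_L: "w \<in> Lspace (m - Q) \<Longrightarrow> x * w \<in> Lspace m"
  using Lspace_mult[OF x_Lspace, of w "m - Q"] m_lo by simp

text \<open>The image of \<open>Lspace (m - Q)\<close> has codimension at most \<open>Q\<close> in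
  \<open>Lspace m\<close>, and the monomials of \<open>E\<close> span more than \<open>Q\<close>
  dimensions there, so the two spaces share a nonzero element. In counting form: there are too many
  sums of elements of the two spaces for all to be distinct.\<close>

lemma lam_pigeonhole:
  assumes E: "finite E" "\<And>k. k \<in> E \<Longrightarrow> snd k < Q \<and> wt k \<le> m" "Q < card E"
  shows "\<exists>w\<in>Lspace (m - Q). \<exists>k\<in>E. lam w \<noteq> 0 \<and> pord (lam w) = int (wt k)"
proof -
  define D where "D = PiE E (\<lambda>_. K) \<times> Lspace (m - Q)"
  define \<Phi> where "\<Phi> = (\<lambda>(c, w). msum c x y E + lam w)"
  have mQ: "Q \<le> m" using m_lo by simp
  have finL: "finite (Lspace s)" for s
  proof (rule finite_subset)
    show "Lspace s \<subseteq> Lspace (s + Q)" by (rule Lspace_mono) simp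
    show "finite (Lspace (s + Q))" by (rule card_Lspace_le) simp
  qed
  have sum_mem: "msum c x y E \<in> Lspace m" if "c \<in> PiE E (\<lambda>_. K)" for c
    unfolding msum_def
  proof (rule Lspace_sum, rule Lspace_scale)
    fix k assume k: "k \<in> E"
    then show "x ^ fst k * y ^ snd k \<in> Lspace m"
      using monom_Lspace[of "fst k" "snd k"] E(2)[OF k] Lspace_mono[of "wt k" m] by (auto simp: wt_def)
    show "c k \<in> K" using that k by auto
  qed
  have "\<not> inj_on \<Phi> D"
  proof
    assume "inj_on \<Phi> D"
    moreover have "\<Phi> ` D \<subseteq> Lspace m"
      unfolding \<Phi>_def D_def using sum_mem lam_mem sub_L by (auto intro!: Lspace_add)
    ultimately have "card D \<le> card (Lspace m)" using finL by (intro card_inj_on_le)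
    also have "\<dots> \<le> card K ^ Q * card (Lspace (m - Q))" by (rule card_Lspace_le[OF mQ])
    finally have "card K ^ card E * card (Lspace (m - Q)) \<le> card K ^ Q * card (Lspace (m - Q))"
      using E(1) by (simp add: D_def card_cartesian_product card_PiE)
    moreover have "card (Lspace (m - Q)) > 0" using finL Lspace_zero by (auto simp: card_gt_0_iff)
    ultimately have "card K ^ card E \<le> card K ^ Q" by simp
    moreover have "1 < card K" using card_K Q_ge Q_powers(1) by linarith
    ultimately show False using E(3) power_strict_increasing[of Q "card E" "card K"] by simp
  qed
  then obtain c w d v where cw: "(c, w) \<in> D" "(d, v) \<in> D" "(c, w) \<noteq> (d, v)" "\<Phi> (c, w) = \<Phi> (d, v)"
    unfolding inj_on_def by fast
  then have cd: "c \<in> PiE E (\<lambda>_. K)" "d \<in> PiE E (\<lambda>_. K)" and wv: "w \<in> Lspace (m - Q)" "v \<in> Lspace (m - Q)"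
    by (auto simp: D_def)
  have eq: "msum c x y E - msum d x y E = lam (v - w)"
  proof -
    have "msum c x y E + lam w = msum d x y E + lam v" using cw(4) by (simp add: \<Phi>_def)
    then have "msum c x y E - msum d x y E = lam v - lam w" by (metis add.commute add_diff_cancel_left diff_add_eq_diff_diff_swap add_diff_cancel_right')
    then show ?thesis using lam_diff[OF sub_L[OF wv(2)] sub_L[OF wv(1)]] by simp
  qed
  \<comment> \<open>Equal coefficients would give \<open>lam w = lam v\<close>, against injectivity;
    hence the common element is nonzero.\<close>
  have "c \<noteq> d"
  proof
    assume "c = d"
    then have "lam w = lam v" using cw(4) by (simp add: \<Phi>_def)
    then have "w = v" using lam_inj sub_L wv by blast
    then show False using \<open>c = d\<close> cw(3) by simp
  qed
  then obtain k where k: "c k \<noteq> d k" by blast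
  then have kE: "k \<in> E" using PiE_arb[OF cd(1), of k] PiE_arb[OF cd(2), of k] by metis
  define e where "e k = (if k \<in> E then c k - d k else 0)" for k
  have eK: "e k \<in> K" for k using cd by (auto simp: e_def intro!: K_intros)
  have "msum e x y E = msum (\<lambda>k. c k - d k) x y E" unfolding msum_def by (intro sum.cong refl) (simp add: e_def)
  then have "msum e x y E = lam (v - w)" using eq msum_diff by simp
  moreover have "msum e x y E \<noteq> 0 \<and> (\<exists>k\<in>E. pord (msum e x y E) = int (wt k))"
    using E(1,2) eK kE k by (intro msum_nonzero[OF x_nonzero pord_x y_nonzero pord_y, where k = k]) (auto simp: e_def)
  moreover have "v - w \<in> Lspace (m - Q)" using wv by (intro Lspace_diff)
  ultimately show ?thesis by metis
qed

lemma x_m: "x \<in> Lspace m" using x_Lspace Lspace_mono[of Q m] m_lo by auto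
lemma y_m: "y \<in> Lspace m" using y_Lspace Lspace_mono[of "2 * Q + 1" m] m_lo by auto

text \<open>\<open>lam\<close> fixes constants and is injective, so only a constant can have a
  constant image.\<close>

lemma lam_x_nonconst: "lam x \<notin> K"
proof
  assume c: "lam x \<in> K"
  then have "lam (lam x) = lam x" by (rule lam_const)
  then have "lam x = x" using lam_inj[OF lam_mem[OF x_m] x_m] by simp
  then have "x \<in> K" using c by simp
  then show False using pord_const[OF _ x_nonzero] pord_x Q_ge by simp
qed

lemma lam_x_nonzero: "lam x \<noteq> 0"
  using lam_x_nonconst K_intros(1) by auto

lemma lam_x_ev:
  assumes w: "w \<in> Lspace (m - Q)" and p: "p \<in> pts"
  shows "ev p (lam x * lam w) = ev p (lam (x * w))" "ev p (lam x * lam w - lam (x * w)) = 0"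
proof -
  have A: "w \<in> aff" "lam x \<in> aff" "lam w \<in> aff" "lam (x * w) \<in> aff"
    using Lspace_aff[OF w] lam_aff[OF x_m] lam_aff[OF sub_L[OF w]] lam_aff[OF x_mult_L[OF w]] by auto
  show "ev p (lam x * lam w) = ev p (lam (x * w))"
    using A by (simp add: ev_mult[OF p] ev_mult[OF T_pts[OF p]] x_aff lam_ev[OF x_m p]
        lam_ev[OF sub_L[OF w] p] lam_ev[OF x_mult_L[OF w] p])
  then show "ev p (lam x * lam w - lam (x * w)) = 0"
    using A ev_diff[OF p subring_mult[OF aff_subring A(2,3)] A(4)] by simp
qed

text \<open>
  If \<open>w\<close> is as in the pigeonhole lemma with \<open>wt k\<close> in \<open>E\<close>, then \<open>lam x * lam w - lam (x * w)\<close> vanishes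
  at all points although its leading monomial \<open>l\<close> is not divisible by \<open>x^(4 Q^2)\<close>.
\<close>

lemma no_large_E:
  assumes s: "pord (lam x) = int s"
    and E: "finite E" "Q < card E"
      "\<And>k. k \<in> E \<Longrightarrow> snd k < Q \<and> wt k \<le> m \<and> (\<exists>l. snd l < Q \<and> fst l < 4 * Q ^ 2 \<and> wt l = s + wt k \<and> m < wt l)"
  shows False
proof -
  obtain w k where w: "w \<in> Lspace (m - Q)" and k: "k \<in> E" "lam w \<noteq> 0" "pord (lam w) = int (wt k)"
    using lam_pigeonhole[OF E(1) _ E(2)] E(3) by blast
  obtain l where l: "snd l < Q" "fst l < 4 * Q ^ 2" "wt l = s + wt k" "m < wt l" using E(3)[OF k(1)] by blast
  have L: "lam (x * w) \<in> Lspace m" using lam_mem[OF x_mult_L[OF w]] .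
  have nz: "lam x * lam w \<noteq> 0" using lam_x_nonzero k(2) by simp
  have pr: "pord (lam x * lam w) = int (wt l)"
    using pord_mult[OF lam_x_nonzero k(2)] s k(3) l(3) by simp
  have "lam (x * w) = 0 \<or> pord (lam (x * w)) < pord (lam x * lam w)" using L pr l(4) by (auto simp: Lspace_iff)
  from pord_add_eq[OF nz this]
  have r: "lam x * lam w - lam (x * w) \<noteq> 0" "pord (lam x * lam w - lam (x * w)) = int (wt l)"
    using pr by (auto simp: diff_eq)
  have "lam x * lam w - lam (x * w) \<in> aff"
    using L lam_mem[OF x_m] lam_mem[OF sub_L[OF w]] Lspace_aff
    by (intro subring_diff[OF aff_subring] subring_mult[OF aff_subring]) auto
  from vanishing_degree[OF this r(1) lam_x_ev(2)[OF w] l(1) r(2)] l(2) show False by simp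
qed

text \<open>
  Every integer \<open>d \<ge> 2 Q^2 - 2 Q\<close> is a pole order. Accordingly \<open>E\<close> is chosen among all \<open>d > m - s\<close>
  if \<open>m - s\<close> is that large, among the exponents below the top corner of the box
  \<open>[0, 4 Q^2) \<times> [0, Q)\<close> if \<open>s + m\<close> is large, and among powers of \<open>x\<close> otherwise.
\<close>

lemma lam_x_pord_small:
  assumes s: "pord (lam x) = int s" shows "s + m < 4 * Q ^ 3"
proof (rule ccontr)
  assume "\<not> s + m < 4 * Q ^ 3"
  then have sm: "s + m \<ge> 4 * Q ^ 3" by simp
  have sle: "s \<le> m" using s lam_mem[OF x_m] lam_x_nonzero by (simp add: Lspace_iff)
  have "lam x \<in> aff" using lam_mem[OF x_m] Lspace_aff by blast
  then obtain k0 where k0: "snd k0 < Q" "s = wt k0" using aff_decomp[of "lam x"] lam_x_nonzero s by auto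
  obtain i j where ij: "k0 = (i, j)" by (cases k0)
  have j: "j < Q" and sij: "s = i * Q + j * (2 * Q + 1)" using k0 ij by (auto simp: wt_def)
  have A: "Q * Q = Q ^ 2" "Q * Q ^ 2 = Q ^ 3" by (auto simp: power2_eq_square power3_eq_cube)
  consider (1) "s + 2 * Q ^ 2 \<le> m + 1 + 2 * Q" | (2) "4 * Q ^ 3 + 2 * Q ^ 2 \<le> s + m + 1 + 2 * Q"
    | (3) "m + 1 + 2 * Q < s + 2 * Q ^ 2" "s + m + 1 + 2 * Q < 4 * Q ^ 3 + 2 * Q ^ 2" by linarith
  then show False
  proof cases
    case 1
    \<comment> \<open>The exponents of the reduced monomial of weight \<open>d\<close>, as in
      \<open>wt_ex\<close>.\<close>
    define dec where "dec d = (d div Q - 2 * (d mod Q), d mod Q)" for d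
    have dec: "wt (dec d) = d" "snd (dec d) < Q" if d: "2 * Q ^ 2 \<le> d + 2 * Q" for d
    proof -
      have "(2 * Q - 2) * Q \<le> d" proof -
        have "2 * Q * Q = 2 * Q ^ 2" by (simp add: power2_eq_square)
        then show ?thesis using d unfolding diff_mult_distrib by linarith
      qed
      then have "2 * Q - 2 \<le> d div Q" using Q_ge by (simp add: less_eq_div_iff_mult_less_eq)
      moreover have "d mod Q \<le> Q - 1" using Q_ge mod_less_divisor[of Q d] by linarith
      ultimately have "2 * (d mod Q) \<le> d div Q" by linarith
      then show "wt (dec d) = d" unfolding dec_def by (rule wt_ex)
      show "snd (dec d) < Q" using Q_ge by (simp add: dec_def)
    qed
    \<comment> \<open>The \<open>Q + 1\<close> weights just above \<open>m - s\<close>; adding the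
      pole order of \<open>lam x\<close> carries them just above \<open>m\<close>.\<close>
    let ?D = "{m - s + 1..m - s + Q + 1}"
    have D: "2 * Q ^ 2 \<le> d + 2 * Q" "d \<le> m" "m < s + d" "s + d < 4 * Q ^ 3" if "d \<in> ?D" for d
    proof -
      have "m - s + 1 \<le> d" "d \<le> m - s + Q + 1" using that by auto
      then show "2 * Q ^ 2 \<le> d + 2 * Q" "d \<le> m" "m < s + d" "s + d < 4 * Q ^ 3"
        using 1 sle sm m_hi Q_ge by linarith+
    qed
    have "inj_on dec ?D" using dec(1) D(1) by (metis inj_onI)
    then have "card (dec ` ?D) = Q + 1" by (simp add: card_image)
    then have "Q < card (dec ` ?D)" by simp
    moreover have "snd k < Q \<and> wt k \<le> m \<and> (\<exists>l. snd l < Q \<and> fst l < 4 * Q ^ 2 \<and> wt l = s + wt k \<and> m < wt l)"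
      if k: "k \<in> dec ` ?D" for k
    proof -
      obtain d where d: "d \<in> ?D" "k = dec d" using k by blast
      have "2 * Q ^ 2 \<le> (s + d) + 2 * Q" using D(1)[OF d(1)] by simp
      note l = dec[OF this] and k = dec[OF D(1)[OF d(1)]]
      have "fst (dec (s + d)) < 4 * Q ^ 2" using wt_less[of "dec (s + d)"] l(1) D(4)[OF d(1)] by simp
      then show ?thesis using l k D[OF d(1)] d(2) by (intro conjI exI[of _ "dec (s + d)"]) auto
    qed
    ultimately show False using no_large_E[OF s, of "dec ` ?D"] by blast
  next
    case 2
    \<comment> \<open>The upper bound on \<open>m\<close> enters: it leaves room for
      \<open>3 + 2 * j\<close> columns of the box to the right of column \<open>i\<close>.\<close>
    have "(i + 3 + 2 * j) * Q \<le> s + 3 * Q" unfolding sij by (simp add: algebra_simps)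
    also have "\<dots> < 4 * Q ^ 2 * Q" using sle m_hi A by (simp add: mult.commute)
    finally have ib: "i + 3 + 2 * j < 4 * Q ^ 2" using Q_ge by simp
    \<comment> \<open>The last \<open>3 + 2 * j\<close> columns of the box, from row
      \<open>j\<close> upwards. These exponents are divisible by the leading monomial of
      \<open>lam x\<close>, and \<open>f\<close> divides by it. The lowest weight among them is
      \<open>4 * Q ^ 3 - 3 * Q + j\<close>, which is above \<open>m\<close>; the
      \<open>2 * j\<close> extra columns make up for having only \<open>Q - j\<close> rows.\<close>
    define X where "X = {4 * Q ^ 2 - 3 - 2 * j..<4 * Q ^ 2} \<times> {j..<Q}"
    define f where "f = (\<lambda>l :: nat \<times> nat. (fst l - i, snd l - j))"
    have X: "i \<le> fst l" "j \<le> snd l" "snd l < Q" "fst l < 4 * Q ^ 2" "4 * Q ^ 2 \<le> fst l + 3 + 2 * j" if "l \<in> X" for l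
      using that ib by (auto simp: X_def)
    have "inj_on f X" unfolding inj_on_def f_def using X by (metis Pair_inject eq_diff_iff prod.collapse)
    then have "card (f ` X) = (3 + 2 * j) * (Q - j)" using ib by (simp add: card_image X_def card_cartesian_product)
    also obtain d where d: "Q = j + d" "d > 0" using j less_imp_add_positive by metis
    have "(3 + 2 * j) * (Q - j) > Q"
    proof -
      have "j \<le> j * d" using d by simp
      moreover have "(3 + 2 * j) * (Q - j) = 3 * d + 2 * (j * d)" using d by (simp add: algebra_simps)
      ultimately show ?thesis using d by linarith
    qed
    finally have card: "Q < card (f ` X)" .
    have "snd k < Q \<and> wt k \<le> m \<and> (\<exists>l. snd l < Q \<and> fst l < 4 * Q ^ 2 \<and> wt l = s + wt k \<and> m < wt l)"
      if k: "k \<in> f ` X" for k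
    proof -
      obtain l where l: "l \<in> X" "k = f l" using k by blast
      note lX = X[OF l(1)]
      obtain u v where uv: "fst l = i + u" "snd l = j + v" using lX(1,2) le_iff_add by metis
      have k': "k = (u, v)" using l(2) uv by (simp add: f_def)
      have wl: "wt l = s + wt k" unfolding k' sij by (simp add: wt_def uv algebra_simps)
      have "4 * Q ^ 2 * Q \<le> (fst l + 3 + 2 * j) * Q" using lX(5) by (intro mult_le_mono1)
      moreover have "j * (2 * Q + 1) \<le> snd l * (2 * Q + 1)" using lX(2) by (intro mult_le_mono1)
      moreover have "(fst l + 3 + 2 * j) * Q + j + snd l * (2 * Q + 1) = wt l + 3 * Q + j * (2 * Q + 1)"
        by (simp add: wt_def algebra_simps)
      moreover have "4 * Q ^ 2 * Q = 4 * Q ^ 3" using A by (simp add: mult.commute)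
      ultimately have gt: "m < wt l" using m_hi by linarith
      have "fst l * Q \<le> (4 * Q ^ 2 - 1) * Q" using lX(4) by (intro mult_le_mono1) simp
      moreover have "(4 * Q ^ 2 - 1) * Q + Q = 4 * Q ^ 3"
      proof -
        have "1 \<le> 4 * Q ^ 2" using Q_ge Q_powers(1) by linarith
        then have "(4 * Q ^ 2 - 1) * Q + Q = 4 * Q ^ 2 * Q"
          using add_mult_distrib[of "4 * Q ^ 2 - 1" 1 Q] by (simp only: le_add_diff_inverse2 mult_1)
        then show ?thesis using A by (simp add: mult.commute)
      qed
      moreover have "snd l * (2 * Q + 1) \<le> (Q - 1) * (2 * Q + 1)" using lX(3) by (intro mult_le_mono1) simp
      moreover have "(Q - 1) * (2 * Q + 1) + Q + 1 = 2 * Q ^ 2"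
      proof -
        obtain Q' where "Q = Suc Q'" using Q_ge by (cases Q) auto
        then show ?thesis by (simp add: power2_eq_square)
      qed
      ultimately have "wt l + 2 * Q + 1 \<le> 4 * Q ^ 3 + 2 * Q ^ 2" unfolding wt_def by linarith
      then have "wt k \<le> m" using wl 2 by linarith
      then show ?thesis using lX wl gt uv k' by (intro conjI exI[of _ l]) auto
    qed
    then show False using no_large_E[OF s _ card] by (simp add: X_def)
  next
    case 3
    \<comment> \<open>\<open>x ^ (c + 1)\<close> is the first power of \<open>x\<close> whose pole
      order exceeds \<open>m - s\<close>; it is taken together with the next \<open>Q\<close>
      powers.\<close>
    define c where "c = (m - s) div Q"
    have c1: "c * Q \<le> m - s" unfolding c_def by simp
    have c2: "m - s < c * Q + Q" unfolding c_def using Q_ge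
      by (metis add.commute div_mult_mod_eq mod_less_divisor add_less_cancel_left le_less_trans not_less zero_less_numeral less_le_trans)
    let ?E = "(\<lambda>t. (t, 0 :: nat)) ` {c + 1..c + Q + 1}"
    have "card ?E = Q + 1" by (subst card_image) (auto simp: inj_on_def)
    then have card: "Q < card ?E" by simp
    have "snd k < Q \<and> wt k \<le> m \<and> (\<exists>l. snd l < Q \<and> fst l < 4 * Q ^ 2 \<and> wt l = s + wt k \<and> m < wt l)"
      if k: "k \<in> ?E" for k
    proof -
      obtain t where t: "c + 1 \<le> t" "t \<le> c + Q + 1" "k = (t, 0)" using k by auto
      have "(c + 1) * Q \<le> t * Q" "t * Q \<le> (c + Q + 1) * Q" using mult_le_mono1[OF t(1), of Q] mult_le_mono1[OF t(2), of Q] by auto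
      then have t1: "c * Q + Q \<le> t * Q" and t2: "t * Q \<le> c * Q + Q ^ 2 + Q" by (auto simp: algebra_simps power2_eq_square)
      have wk: "wt k = t * Q" by (simp add: wt_def t)
      have wl: "wt (i + t, j) = s + t * Q" by (simp add: wt_def sij algebra_simps)
      have "m < s + t * Q" using t1 c2 sle by linarith
      moreover have "s + t * Q < 4 * Q ^ 3" using t2 c1 sle 3 Q_powers by linarith
      moreover have "t * Q \<le> m" using t2 c1 sle sm 3 Q_powers by linarith
      ultimately show ?thesis using wt_less[of "(i + t, j)"] wk wl j t Q_ge by (intro conjI exI[of _ "(i + t, j)"]) auto
    qed
    then show False using no_large_E[OF s _ card] by blast
  qed
qed

text \<open>Both sides now have pole orders below \<open>4 * Q ^ 3\<close>, so agreement at all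
  points is equality.\<close>

lemma lam_x_mult:
  assumes w: "w \<in> Lspace (m - Q)" shows "lam (x * w) = lam x * lam w"
proof -
  have "pord (lam x) \<ge> 0" using pord_aff_nonneg[OF Lspace_aff[OF lam_mem[OF x_m]] lam_x_nonzero] .
  then obtain s where s: "pord (lam x) = int s" using nonneg_int_cases by blast
  have fs: "lam x \<in> Lspace s" using s Lspace_aff[OF lam_mem[OF x_m]] by (simp add: Lspace_iff)
  have L1: "lam x * lam w \<in> Lspace (s + m)" using Lspace_mult[OF fs lam_mem[OF sub_L[OF w]]] .
  have L2: "lam (x * w) \<in> Lspace (s + m)" using lam_mem[OF x_mult_L[OF w]] Lspace_mono[of m "s + m"] by auto
  show ?thesis
  proof (rule ev_inj[OF L2 L1 lam_x_pord_small[OF s]])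
    fix p assume p: "p \<in> pts"
    show "ev p (lam (x * w)) = ev p (lam x * lam w)"
      using lam_x_ev(1)[OF w p] by simp
  qed
qed

lemma lam_x_power:
  assumes "w \<in> Lspace s" "i * Q + s \<le> m"
  shows "x ^ i * w \<in> Lspace (i * Q + s)" "lam (x ^ i * w) = lam x ^ i * lam w"
proof -
  have L: "x ^ i * w \<in> Lspace (i * Q + s)" for i
    using Lspace_mult[OF _ assms(1), of "x ^ i" "i * Q"] monom_Lspace[of i 0] by simp
  then show "x ^ i * w \<in> Lspace (i * Q + s)" .
  show "lam (x ^ i * w) = lam x ^ i * lam w" using assms(2)
  proof (induction i)
    case (Suc i)
    have "i * Q + s \<le> m - Q" using Suc.prems by simp
    then have "x ^ i * w \<in> Lspace (m - Q)" using L Lspace_mono by blast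
    then have "lam (x * (x ^ i * w)) = lam x * lam (x ^ i * w)" by (rule lam_x_mult)
    then show ?case using Suc by (simp add: mult.assoc)
  qed simp
qed

text \<open>For \<open>i = m div Q\<close> the power \<open>x ^ i\<close> lies in
  \<open>Lspace m\<close>, hence so does \<open>lam x ^ i\<close>; so \<open>i\<close> times the
  pole order is at most \<open>m < (i + 1) * Q \<le> 2 * i * Q\<close>. The only pole orders below
  \<open>2 * Q\<close> are 0 and \<open>Q\<close>, and 0 would make \<open>lam x\<close>
  constant.\<close>

lemma pord_lam_x: "pord (lam x) = int Q"
proof -
  have "lam x \<in> aff" using lam_mem[OF x_m] Lspace_aff by blast
  then obtain k where k: "snd k < Q" "pord (lam x) = int (wt k)" using aff_decomp lam_x_nonzero by blast
  define i where "i = m div Q"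
  have i: "i * Q \<le> m" "m < i * Q + Q" "i \<ge> 1"
  proof -
    show "i * Q \<le> m" by (simp add: i_def)
    have "m mod Q < Q" using Q_ge by simp
    then show "m < i * Q + Q" using div_mult_mod_eq[of m Q] unfolding i_def by linarith
    show "i \<ge> 1" unfolding i_def using m_lo Q_ge by (simp add: Suc_le_eq div_greater_zero_iff)
  qed
  have one: "1 \<in> Lspace 0" using const_Lspace K_intros(2) by blast
  have "lam (x ^ i * 1) = lam x ^ i * lam 1" using lam_x_power(2)[OF one, of i] i(1) by simp
  then have "lam (x ^ i) = lam x ^ i" using lam_const[of 1] K_intros(2) by simp
  moreover have "x ^ i \<in> Lspace m" using monom_Lspace[of i 0] Lspace_mono[of "i * Q" m] i(1) by auto
  ultimately have "lam x ^ i \<in> Lspace m" using lam_mem by metis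
  then have "int i * int (wt k) \<le> int m"
    using pord_power[OF lam_x_nonzero, of i] lam_x_nonzero k(2) by (simp add: Lspace_iff)
  then have "i * wt k \<le> m" by (metis of_nat_le_iff of_nat_mult)
  then have "i * wt k < i * (2 * Q)"
  proof -
    have "Q \<le> i * Q" using mult_le_mono1[OF i(3), of Q] by (simp only: mult_1)
    moreover have "i * (2 * Q) = i * Q + i * Q" by simp
    ultimately show ?thesis using i(2) \<open>i * wt k \<le> m\<close> by linarith
  qed
  then have "wt k < 2 * Q" by simp
  then have "snd k = 0" by (cases "snd k") (auto simp: wt_def)
  moreover have "fst k < 2" using \<open>wt k < 2 * Q\<close> by (simp add: wt_def \<open>snd k = 0\<close>)
  ultimately consider "wt k = 0" | "wt k = Q" by (cases "fst k = 0") (auto simp: wt_def less_2_cases_iff)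
  then show ?thesis
  proof cases
    case 1
    then have "lam x \<in> Lspace 0" using \<open>lam x \<in> aff\<close> k by (simp add: Lspace_iff)
    moreover have "exps 0 = {(0, 0)}" using Q_ge by (auto simp: exps_def wt_def)
    ultimately have "lam x \<in> K" by (auto simp: Lspace_def msum_def)
    then show ?thesis using lam_x_nonconst by simp
  qed (use k in simp)
qed

lemma lam_y_nonzero: "lam y \<noteq> 0"
proof
  assume "lam y = 0"
  moreover have "lam 0 = 0" by (rule lam_const) (rule K_intros(1))
  ultimately have "y = 0" using lam_inj[OF y_m Lspace_zero] by simp
  then show False using y_nonzero by simp
qed

text \<open>The product of \<open>y\<close> with the highest admissible power of \<open>x\<close>
  bounds the pole order of \<open>lam y\<close> by \<open>3 * Q\<close>. Both sides of the curve
  equation then have pole order at most \<open>3 * Q ^ 2 < 4 * Q ^ 3\<close>, so the equation, valid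
  at all points, holds between functions, and comparing pole orders gives the exact value.\<close>

lemma lam_y: "pord (lam y) = int (2 * Q + 1)" "lam x ^ (2 * Q + 1) = h_poly n (lam y)"
proof -
  define i where "i = (m - (2 * Q + 1)) div Q"
  have i1: "i * Q + (2 * Q + 1) \<le> m"
  proof -
    have "i * Q \<le> m - (2 * Q + 1)" by (simp add: i_def)
    then show ?thesis using m_lo by linarith
  qed
  have i2: "m < i * Q + Q + (2 * Q + 1)"
  proof -
    have "(m - (2 * Q + 1)) mod Q < Q" using Q_ge by simp
    then show ?thesis using div_mult_mod_eq[of "m - (2 * Q + 1)" Q] unfolding i_def by linarith
  qed
  have "x ^ i * y \<in> Lspace m" using lam_x_power(1)[OF y_Lspace i1] Lspace_mono[OF i1] by blast
  then have "lam x ^ i * lam y \<in> Lspace m" using lam_x_power(2)[OF y_Lspace i1] lam_mem by metis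
  then have "pord (lam x ^ i * lam y) \<le> int m" using lam_x_nonzero lam_y_nonzero by (simp add: Lspace_iff)
  then have "int i * int Q + pord (lam y) \<le> int m"
    using pord_mult[of "lam x ^ i" "lam y"] pord_power[OF lam_x_nonzero, of i] pord_lam_x lam_x_nonzero lam_y_nonzero by simp
  moreover have "int m < int (i * Q + Q + (2 * Q + 1))" using i2 by (simp only: of_nat_less_iff)
  then have "int m < int i * int Q + int Q + (2 * int Q + 1)" by simp
  ultimately have py: "pord (lam y) \<le> int (3 * Q)" by simp
  have yA: "lam y \<in> aff" using lam_mem[OF y_m] Lspace_aff by blast
  have xA: "lam x \<in> aff" using lam_mem[OF x_m] Lspace_aff by blast
  have yL: "lam y \<in> Lspace (3 * Q)" using yA py by (simp add: Lspace_iff)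
  have xL: "lam x \<in> Lspace Q" using xA pord_lam_x by (simp add: Lspace_iff)
  show eq: "lam x ^ (2 * Q + 1) = h_poly n (lam y)"
  proof (rule ev_inj[where s = "3 * Q ^ 2"])
    have "(2 * Q + 1) * Q \<le> 3 * Q ^ 2" using Q_powers by (simp add: power2_eq_square algebra_simps)
    then show "lam x ^ (2 * Q + 1) \<in> Lspace (3 * Q ^ 2)" using Lspace_power[OF xL] Lspace_mono by blast
    show "h_poly n (lam y) \<in> Lspace (3 * Q ^ 2)" unfolding h_poly_def
    proof (rule Lspace_sum)
      fix d assume "d \<in> {..<n}"
      then have "(2 :: nat) ^ d \<le> Q" unfolding Q_eq by (intro power_increasing) auto
      then have "2 ^ d * (3 * Q) \<le> Q * (3 * Q)" by (rule mult_le_mono1)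
      then have "2 ^ d * (3 * Q) \<le> 3 * Q ^ 2" by (simp add: power2_eq_square)
      then show "lam y ^ 2 ^ d \<in> Lspace (3 * Q ^ 2)" using Lspace_power[OF yL] Lspace_mono by blast
    qed
    show "3 * Q ^ 2 < 4 * Q ^ 3" using Q_powers Q_ge by linarith
    fix p assume p: "p \<in> pts"
    have Tp: "T p \<in> pts" using T_pts[OF p] .
    have "ev p (h_poly n (lam y)) = h_poly n (ev p (lam y))"
      unfolding h_poly_def using p yA by (subst ev_sum) (auto simp: ev_power subring_power[OF aff_subring])
    also have "\<dots> = fst (T p) ^ (2 * Q + 1)"
      using lam_ev[OF y_m p] ev_y[OF Tp] Tp by (simp add: pts_def)
    also have "\<dots> = ev p (lam x ^ (2 * Q + 1))"
      using lam_ev[OF x_m p] ev_x[OF Tp] ev_power[OF p xA] by metis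
    finally show "ev p (lam x ^ (2 * Q + 1)) = ev p (h_poly n (lam y))" by simp
  qed
  have pf: "pord (lam x ^ (2 * Q + 1)) = int (2 * Q + 1) * int Q"
    using pord_power[OF lam_x_nonzero, of "2 * Q + 1"] pord_lam_x by simp
  have "lam y \<notin> Vinf"
  proof
    assume "lam y \<in> Vinf"
    then have "h_poly n (lam y) \<in> Vinf" unfolding h_poly_def
      by (intro subring_sum[OF vring_subring[OF Vinf]] subring_power[OF vring_subring[OF Vinf]])
    then have "pord (lam x ^ (2 * Q + 1)) \<le> 0" using pord_le_iff[of "lam x ^ (2 * Q + 1)"] lam_x_nonzero eq by simp
    moreover have "int (2 * Q + 1) * int Q > 0" using Q_ge by simp
    ultimately show False using pf by linarith
  qed
  then obtain u where u: "u \<in> ring_units Vinf" "h_poly n (lam y) = lam y ^ Q * u" using h_pole[OF Vinf] by blast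
  have "pord u = 0" using place_val_unit[OF Vinf Vinf_discrete u(1)] by (simp add: pord_def)
  then have "pord (h_poly n (lam y)) = int Q * pord (lam y)"
    using pord_mult[of "lam y ^ Q" u] lam_y_nonzero units_nonzero[OF u(1)] pord_power[OF lam_y_nonzero, of Q] u(2) by simp
  then have "int Q * pord (lam y) = int Q * int (2 * Q + 1)" using pf eq by (simp add: mult.commute)
  then show "pord (lam y) = int (2 * Q + 1)" using Q_ge by simp
qed

lemma perm_to_hom:
  "\<exists>S. Khom S \<and> S x \<in> Lspace Q \<and> S y \<in> Lspace (2 * Q + 1) \<and> (\<forall>p\<in>pts. \<forall>r\<in>aff. ev p (S r) = ev (T p) r)"
proof -
  obtain S where S: "Khom S" "S x = lam x" "S y = lam y"
    using Khom_exists[OF lam_x_nonzero pord_lam_x lam_y_nonzero lam_y] by blast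
  have A: "lam x \<in> aff" "lam y \<in> aff" using lam_mem x_m y_m Lspace_aff by blast+
  have SA: "S r \<in> aff" if "r \<in> aff" for r using Khom_aff[OF S(1)] S A that by simp
  have "ev p (S r) = ev (T p) r" if p: "p \<in> pts" and r: "r \<in> aff" for p r
    by (rule ev_unique[OF T_pts[OF p] r, of "\<lambda>r. ev p (S r)"])
       (simp_all add: Khom_const[OF S(1)] Khom_add[OF S(1)] Khom_mult[OF S(1)] S(2,3) SA ev_const[OF p]
         ev_add[OF p] ev_mult[OF p] lam_ev[OF x_m p] lam_ev[OF y_m p] ev_x[OF T_pts[OF p]] ev_y[OF T_pts[OF p]])
  moreover have "S x \<in> Lspace Q" "S y \<in> Lspace (2 * Q + 1)"
    using S A pord_lam_x lam_y(1) by (auto simp: Lspace_iff)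
  ultimately show ?thesis using S(1) by blast
qed

end

lemma Khom_Lspace:
  assumes S: "Khom S" "S x \<in> Lspace Q" "S y \<in> Lspace (2 * Q + 1)" and r: "r \<in> Lspace s"
  shows "S r \<in> Lspace s"
proof -
  obtain c where c: "\<forall>k. c k \<in> K" "r = msum c x y (exps s)" using r by (auto simp: Lspace_def)
  have cK: "S (c k) = c k" for k using Khom_const[OF S(1)] c(1) by blast
  have "S r = (\<Sum>k\<in>exps s. c k * (S x ^ fst k * S y ^ snd k))"
    unfolding c(2) msum_def
    by (simp add: Khom_sum[OF S(1)] Khom_mult[OF S(1)] Khom_power[OF S(1)] cK)
  also have "\<dots> \<in> Lspace s"
  proof (rule Lspace_sum, rule Lspace_scale)
    fix k assume "k \<in> exps s"
    then have "fst k * Q + snd k * (2 * Q + 1) \<le> s" by (simp add: exps_def wt_def)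
    then show "S x ^ fst k * S y ^ snd k \<in> Lspace s"
      using Lspace_mult[OF Lspace_power[OF S(2)] Lspace_power[OF S(3)]] Lspace_mono by blast
    show "c k \<in> K" using c(1) by blast
  qed
  finally show ?thesis .
qed

text \<open>The homomorphisms obtained from \<open>T\<close> and from its inverse compose to one
  that preserves the values of \<open>x\<close> and \<open>y\<close> at every point, hence fixes
  \<open>x\<close> and \<open>y\<close>. This gives surjectivity; a field homomorphism is injective
  anyway.\<close>

lemma perm_to_aut:
  assumes T: "bij_betw T pts pts" and T': "bij_betw T' pts pts"
    and inv: "\<And>p. p \<in> pts \<Longrightarrow> T (T' p) = p" "\<And>p. p \<in> pts \<Longrightarrow> T' (T p) = p"
    and pres: "\<And>f. f \<in> Lspace m \<Longrightarrow> \<exists>g\<in>Lspace m. \<forall>p\<in>pts. ev p g = ev (T p) f"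
    and pres': "\<And>f. f \<in> Lspace m \<Longrightarrow> \<exists>g\<in>Lspace m. \<forall>p\<in>pts. ev p g = ev (T' p) f"
    and m: "2 * Q + 1 \<le> m" "m + 3 * Q + 1 \<le> 4 * Q ^ 3"
  shows "\<exists>S. Khom S \<and> bij S \<and> (\<forall>p\<in>pts. \<forall>r\<in>aff. ev p (S r) = ev (T p) r)"
proof -
  obtain S where S: "Khom S" "S x \<in> Lspace Q" "S y \<in> Lspace (2 * Q + 1)"
    "\<And>p r. p \<in> pts \<Longrightarrow> r \<in> aff \<Longrightarrow> ev p (S r) = ev (T p) r" using perm_to_hom[OF T pres m] by blast
  obtain R where R: "Khom R" "R x \<in> Lspace Q" "R y \<in> Lspace (2 * Q + 1)"
    "\<And>p r. p \<in> pts \<Longrightarrow> r \<in> aff \<Longrightarrow> ev p (R r) = ev (T' p) r" using perm_to_hom[OF T' pres' m] by blast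
  have id: "S (R z) = z"
    if S: "Khom S" "S x \<in> Lspace Q" "S y \<in> Lspace (2 * Q + 1)"
      and Sev: "\<And>p r. p \<in> pts \<Longrightarrow> r \<in> aff \<Longrightarrow> ev p (S r) = ev (T p) r"
      and R: "Khom R" "R x \<in> Lspace Q" "R y \<in> Lspace (2 * Q + 1)"
      and Rev: "\<And>p r. p \<in> pts \<Longrightarrow> r \<in> aff \<Longrightarrow> ev p (R r) = ev (T' p) r"
      and inv: "\<And>p. p \<in> pts \<Longrightarrow> T' (T p) = p" and T: "bij_betw T pts pts" for S R T T' z
  proof -
    have Tp: "T p \<in> pts" if "p \<in> pts" for p using T that by (auto simp: bij_betw_def)
    have "S (R r) = r" if r: "r \<in> Lspace s" and s: "s < 4 * Q ^ 3" for r s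
    proof (rule ev_inj[OF Khom_Lspace[OF S(1-3)] r s])
      show Rr: "R r \<in> Lspace s" using Khom_Lspace[OF R(1-3) r] .
      fix p assume p: "p \<in> pts"
      show "ev p (S (R r)) = ev p r"
        using Sev[OF p Lspace_aff[OF Rr]] Rev[OF Tp[OF p] Lspace_aff[OF r]] inv[OF p] by simp
    qed
    then have "(S \<circ> R) x = id x" "(S \<circ> R) y = id y" using x_Lspace y_Lspace m by auto
    then have "S \<circ> R = id" using Khom_comp[OF S(1) R(1)] by (intro Khom_ext Khom_id)
    then show ?thesis by (metis comp_apply id_apply)
  qed
  have "S (R z) = z" for z by (rule id[OF S R inv(2) T])
  then have "surj S" by (metis surjI)
  then show ?thesis using S Khom_inj[OF S(1)] by (auto simp: bij_def)
qed

text \<open>By \<open>aut_aff\<close> the images of \<open>x\<close> and \<open>y\<close> are finite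
  at \<open>p\<close>, and their values are the coordinates of \<open>T p\<close>, again on the
  curve. The inverse automorphism provides the inverse permutation.\<close>

lemma aut_to_perm:
  assumes S: "Khom S" "bij S"
  shows "\<exists>T. bij_betw T pts pts \<and> (\<forall>p\<in>pts. \<forall>r\<in>aff. ev p (S r) = ev (T p) r)"
proof -
  have ex: "\<exists>T. (\<forall>p\<in>pts. T p \<in> pts) \<and> (\<forall>p\<in>pts. \<forall>r\<in>aff. ev p (S r) = ev (T p) r)"
    if S: "Khom S" "surj S" for S
  proof -
    have A: "S r \<in> aff" if "r \<in> aff" for r using aut_aff[OF S that] .
    define T where "T p = (ev p (S x), ev p (S y))" for p
    have Tp: "T p \<in> pts" if p: "p \<in> pts" for p
    proof -
      have "h_poly n (ev p (S y)) = ev p (h_poly n (S y))"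
        unfolding h_poly_def using p A[OF y_aff] by (subst ev_sum) (auto simp: ev_power subring_power[OF aff_subring])
      also have "\<dots> = ev p (S x ^ (2 * Q + 1))"
        using Khom_h[OF S(1), of y] Khom_power[OF S(1), of x "2 * Q + 1"] curve_eq by simp
      also have "\<dots> = ev p (S x) ^ (2 * Q + 1)" by (rule ev_power[OF p A[OF x_aff]])
      finally show ?thesis using ev_mem(1)[OF p A[OF x_aff]] ev_mem(1)[OF p A[OF y_aff]] by (simp add: T_def pts_def)
    qed
    moreover have "ev p (S r) = ev (T p) r" if p: "p \<in> pts" and r: "r \<in> aff" for p r
      by (rule ev_unique[OF Tp[OF p] r, of "\<lambda>r. ev p (S r)"])
         (simp_all add: Khom_const[OF S(1)] Khom_add[OF S(1)] Khom_mult[OF S(1)] A ev_const[OF p]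
           ev_add[OF p] ev_mult[OF p] T_def)
    ultimately show ?thesis by blast
  qed
  have sS: "surj S" using S(2) by (rule bij_is_surj)
  obtain T where T: "\<And>p. p \<in> pts \<Longrightarrow> T p \<in> pts" "\<And>p r. p \<in> pts \<Longrightarrow> r \<in> aff \<Longrightarrow> ev p (S r) = ev (T p) r"
    using ex[OF S(1) sS] by blast
  let ?R = "inv_into UNIV S"
  obtain T' where T': "\<And>p. p \<in> pts \<Longrightarrow> T' p \<in> pts" "\<And>p r. p \<in> pts \<Longrightarrow> r \<in> aff \<Longrightarrow> ev p (?R r) = ev (T' p) r"
    using ex[OF Khom_inv[OF S(1) sS]] by blast
  have SR: "S (?R z) = z" "?R (S z) = z" for z
    using surj_f_inv_f[OF sS] inv_f_f[OF Khom_inj[OF S(1)]] by auto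
  have pt_eq: "p = q" if "p \<in> pts" "q \<in> pts" "ev p x = ev q x" "ev p y = ev q y" for p q
    using that by (simp add: ev_x ev_y prod_eq_iff)
  have RA: "?R r \<in> aff" and SA: "S r \<in> aff" if "r \<in> aff" for r
    using aut_aff[OF Khom_inv[OF S(1) sS] that] aut_aff[OF S(1) sS that] by auto
  have "T' (T p) = p" if p: "p \<in> pts" for p
  proof (rule pt_eq[OF T'(1)[OF T(1)[OF p]] p])
    show "ev (T' (T p)) x = ev p x" "ev (T' (T p)) y = ev p y"
      using T'(2)[OF T(1)[OF p] x_aff] T(2)[OF p RA[OF x_aff]] T'(2)[OF T(1)[OF p] y_aff] T(2)[OF p RA[OF y_aff]] SR by auto
  qed
  moreover have "T (T' p) = p" if p: "p \<in> pts" for p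
  proof (rule pt_eq[OF T(1)[OF T'(1)[OF p]] p])
    show "ev (T (T' p)) x = ev p x" "ev (T (T' p)) y = ev p y"
      using T(2)[OF T'(1)[OF p] x_aff] T'(2)[OF p SA[OF x_aff]] T(2)[OF T'(1)[OF p] y_aff] T'(2)[OF p SA[OF y_aff]] SR by auto
  qed
  ultimately have "bij_betw T pts pts" using T(1) T'(1) by (intro bij_betw_byWitness[of _ T']) auto
  then show ?thesis using T(2) by blast
qed

section \<open>The isomorphism\<close>

lemma field_Aut_carrier: "S \<in> carrier (field_Aut K) \<longleftrightarrow> bij S \<and> Khom S"
  by (auto simp: field_Aut_def Khom_def)

lemma field_Aut_Khom: "S \<in> carrier (field_Aut K) \<Longrightarrow> Khom S"
  and field_Aut_surj: "S \<in> carrier (field_Aut K) \<Longrightarrow> surj S"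
  using bij_is_surj[of S] by (auto simp: field_Aut_carrier)

definition word :: "(nat \<Rightarrow> 'a \<times> 'a) \<Rightarrow> nat \<Rightarrow> 'a \<Rightarrow> nat \<Rightarrow> 'a" where
  "word pt N f = restrict (\<lambda>i. ev (pt i) f) {1..N}"

text \<open>\<open>Rel\<close> is the graph of the isomorphism: it is total on both sides,
  determines each partner uniquely and respects composition, and \<open>\<phi>\<close> is read off
  from it.\<close>

lemma code_Aut_iso:
  fixes pt :: "nat \<Rightarrow> 'a \<times> 'a" and m N :: nat
  assumes pt: "bij_betw pt {1..N} pts" and m: "2 * Q + 1 \<le> m" "m + 3 * Q + 1 \<le> 4 * Q ^ 3"
  shows "code_Aut N (word pt N ` Lspace m) \<cong> field_Aut K"
proof -
  define C where "C = word pt N ` Lspace m"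
  \<comment> \<open>Pulling back functions along \<open>t\<close> is contravariant, so \<open>S\<close> corresponds to the inverse pullback.\<close>
  define Rel where "Rel S t \<longleftrightarrow> (\<forall>i\<in>{1..N}. \<forall>r\<in>aff. ev (pt (t i)) (S r) = ev (pt i) r)" for S :: "'a \<Rightarrow> 'a" and t
  define pi where "pi = inv_into {1..N} pt"
  have pt_in: "pt i \<in> pts" if "i \<in> {1..N}" for i using pt that by (auto simp: bij_betw_def)
  have pi_in: "pi p \<in> {1..N}" "pt (pi p) = p" if "p \<in> pts" for p
  proof -
    have "p \<in> pt ` {1..N}" using pt that by (simp add: bij_betw_def)
    then show "pi p \<in> {1..N}" "pt (pi p) = p" unfolding pi_def by (rule inv_into_into, rule f_inv_into_f)
  qed
  have pi_pt: "pi (pt i) = i" if "i \<in> {1..N}" for i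
    unfolding pi_def using pt that by (intro inv_into_f_f) (auto simp: bij_betw_def)
  have carC: "t \<in> carrier (code_Aut N C) \<longleftrightarrow> t permutes {1..N} \<and> (\<lambda>c. c \<circ> t) ` C = C" for t
    by (simp add: code_Aut_def sym_group_def)
  have pt_eq: "p = p'" if "p \<in> pts" "p' \<in> pts" "ev p x = ev p' x" "ev p y = ev p' y" for p p'
    using that by (simp add: ev_x ev_y prod_eq_iff)
  have wordD: "ev (pt i) f = word pt N f i" if "i \<in> {1..N}" for i f using that by (simp add: word_def)

  have ex_aut: "\<exists>S. S \<in> carrier (field_Aut K) \<and> Rel S t" if t: "t \<in> carrier (code_Aut N C)" for t
  proof -
    have tp: "t permutes {1..N}" and tC: "(\<lambda>c. c \<circ> t) ` C = C" using t carC by auto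
    let ?u = "inv_into UNIV t"
    have t_in: "t i \<in> {1..N}" if "i \<in> {1..N}" for i using permutes_in_image[OF tp] that by simp
    have u_in: "?u i \<in> {1..N}" if "i \<in> {1..N}" for i using permutes_in_image[OF permutes_inv[OF tp]] that by simp
    have tu: "t (?u i) = i" "?u (t i) = i" for i using permutes_inverses[OF tp] by auto
    \<comment> \<open>The inverse of \<open>t\<close> appears because \<open>Rel\<close> evaluates
      \<open>S r\<close> at the moved point: for \<open>p = pt (t i)\<close> it asks for
      \<open>ev p (S r) = ev (pt i) r\<close>.\<close>
    define T where "T p = pt (?u (pi p))" for p
    define T' where "T' p = pt (t (pi p))" for p
    have Tin: "T p \<in> pts" "T' p \<in> pts" if "p \<in> pts" for p
      using that pt_in u_in t_in pi_in(1) by (auto simp: T_def T'_def)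
    have TT: "T (T' p) = p" "T' (T p) = p" if "p \<in> pts" for p
      using pi_pt[OF t_in[OF pi_in(1)[OF that]]] pi_pt[OF u_in[OF pi_in(1)[OF that]]] tu pi_in(2)[OF that]
      by (simp_all add: T_def T'_def)
    have bT: "bij_betw T pts pts" by (rule bij_betw_byWitness[of _ T']) (use Tin TT in auto)
    have bT': "bij_betw T' pts pts" by (rule bij_betw_byWitness[of _ T]) (use Tin TT in auto)
    have pres': "\<exists>g\<in>Lspace m. \<forall>p\<in>pts. ev p g = ev (T' p) f" if f: "f \<in> Lspace m" for f
    proof -
      have "word pt N f \<circ> t \<in> C" using f tC by (auto simp: C_def)
      then obtain g where g: "g \<in> Lspace m" "word pt N f \<circ> t = word pt N g" by (auto simp: C_def)
      have "ev p g = ev (T' p) f" if p: "p \<in> pts" for p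
      proof -
        have "ev p g = word pt N g (pi p)" using wordD[OF pi_in(1)[OF p], of g] pi_in(2)[OF p] by simp
        also have "\<dots> = word pt N f (t (pi p))" using g(2) by (metis comp_apply)
        also have "\<dots> = ev (T' p) f" using wordD[OF t_in[OF pi_in(1)[OF p]], of f] by (simp add: T'_def)
        finally show ?thesis .
      qed
      then show ?thesis using g by blast
    qed
    have pres: "\<exists>g\<in>Lspace m. \<forall>p\<in>pts. ev p g = ev (T p) f" if f: "f \<in> Lspace m" for f
    proof -
      have "word pt N f \<in> (\<lambda>c. c \<circ> t) ` C" using f tC by (simp add: C_def)
      then obtain g where g: "g \<in> Lspace m" "word pt N f = word pt N g \<circ> t" by (auto simp: C_def)
      have "ev p g = ev (T p) f" if p: "p \<in> pts" for p
      proof -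
        have "ev (T p) f = word pt N f (?u (pi p))"
          using wordD[OF u_in[OF pi_in(1)[OF p]], of f] by (simp add: T_def)
        also have "\<dots> = word pt N g (pi p)" using g(2) tu by simp
        also have "\<dots> = ev p g" using wordD[OF pi_in(1)[OF p], of g] pi_in(2)[OF p] by simp
        finally show ?thesis by simp
      qed
      then show ?thesis using g by blast
    qed
    obtain S where S: "Khom S" "bij S" "\<And>p r. p \<in> pts \<Longrightarrow> r \<in> aff \<Longrightarrow> ev p (S r) = ev (T p) r"
      using perm_to_aut[OF bT bT' TT pres pres' m] by blast
    have "ev (pt (t i)) (S r) = ev (pt i) r" if i: "i \<in> {1..N}" and r: "r \<in> aff" for i r
      using S(3)[OF pt_in[OF t_in[OF i]] r] pi_pt[OF t_in[OF i]] tu by (simp add: T_def)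
    then show ?thesis using S field_Aut_carrier by (auto simp: Rel_def)
  qed

  have ex_perm: "\<exists>t. t \<in> carrier (code_Aut N C) \<and> Rel S t" if S: "S \<in> carrier (field_Aut K)" for S
  proof -
    have SK: "Khom S" and bS: "bij S" using S field_Aut_carrier by auto
    have sS: "surj S" using bS by (rule bij_is_surj)
    let ?R = "inv_into UNIV S"
    have SR: "S (?R z) = z" "?R (S z) = z" for z
      using surj_f_inv_f[OF sS] inv_f_f[OF Khom_inj[OF SK]] by auto
    have RK: "Khom ?R" "surj ?R" using Khom_inv[OF SK sS] by auto
    have bR: "bij ?R" using bS by (rule bij_imp_bij_inv)
    obtain T where T: "bij_betw T pts pts" "\<And>p r. p \<in> pts \<Longrightarrow> r \<in> aff \<Longrightarrow> ev p (?R r) = ev (T p) r"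
      using aut_to_perm[OF RK(1) bR] by blast
    \<comment> \<open>Outside the index set \<open>t\<close> is the identity, as a permutation of
      \<open>{1..N}\<close> must be; all words are \<open>undefined\<close> there, so composing with
      \<open>t\<close> does not disturb them.\<close>
    define t where "t i = (if i \<in> {1..N} then pi (T (pt i)) else i)" for i
    have Tin: "T p \<in> pts" if "p \<in> pts" for p using T(1) that by (auto simp: bij_betw_def)
    have pt_t: "pt (t i) = T (pt i)" if "i \<in> {1..N}" for i
      using that pi_in(2)[OF Tin[OF pt_in[OF that]]] by (simp add: t_def)
    have pi_bij: "bij_betw pi pts {1..N}" unfolding pi_def by (rule bij_betw_inv_into[OF pt])
    have "bij_betw (pi \<circ> (T \<circ> pt)) {1..N} {1..N}"
      by (rule bij_betw_trans[OF bij_betw_trans[OF pt T(1)] pi_bij])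
    then have "bij_betw t {1..N} {1..N}" by (rule bij_betw_cong[THEN iffD1, rotated]) (simp add: t_def)
    then have tp: "t permutes {1..N}" by (rule bij_imp_permutes) (simp only: t_def if_False)
    have t_in: "t i \<in> {1..N}" if "i \<in> {1..N}" for i using permutes_in_image[OF tp] that by simp
    have rel: "ev (pt (t i)) (S r) = ev (pt i) r" if i: "i \<in> {1..N}" and r: "r \<in> aff" for i r
      using T(2)[OF pt_in[OF i] aut_aff[OF SK sS r]] SR pt_t[OF i] by simp
    have w1: "word pt N (S f) \<circ> t = word pt N f" if f: "f \<in> Lspace m" for f
    proof
      fix i
      show "(word pt N (S f) \<circ> t) i = word pt N f i"
      proof (cases "i \<in> {1..N}")
        case True
        then show ?thesis using rel[OF True Lspace_aff[OF f]] wordD[OF t_in[OF True], of "S f"] wordD[OF True, of f] by simp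
      next
        case False
        then have "t i = i" by (simp only: t_def if_False)
        moreover have "word pt N g i = undefined" for g using False by (simp only: word_def restrict_def if_False)
        ultimately show ?thesis by simp
      qed
    qed
    have "(\<lambda>c. c \<circ> t) ` C = C"
    proof
      show "C \<subseteq> (\<lambda>c. c \<circ> t) ` C"
      proof
        fix c assume "c \<in> C"
        then obtain f where f: "f \<in> Lspace m" "c = word pt N f" by (auto simp: C_def)
        have "word pt N (S f) \<in> C" using aut_Lspace[OF SK sS f(1)] by (simp add: C_def)
        then show "c \<in> (\<lambda>c. c \<circ> t) ` C" using w1[OF f(1)] f(2) by (metis image_eqI)
      qed
      show "(\<lambda>c. c \<circ> t) ` C \<subseteq> C"
      proof
        fix c assume "c \<in> (\<lambda>c. c \<circ> t) ` C"
        then obtain f where f: "f \<in> Lspace m" "c = word pt N f \<circ> t" by (auto simp: C_def)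
        have Rf: "?R f \<in> Lspace m" using aut_Lspace[OF RK f(1)] .
        then have "c = word pt N (?R f)" using w1[OF Rf] f(2) SR by simp
        then show "c \<in> C" using Rf by (simp add: C_def)
      qed
    qed
    then have "t \<in> carrier (code_Aut N C)" using tp carC by blast
    then show ?thesis using rel by (auto simp: Rel_def)
  qed

  have uniq_aut: "S = S'"
    if S: "S \<in> carrier (field_Aut K)" "S' \<in> carrier (field_Aut K)" and t: "t \<in> carrier (code_Aut N C)"
      and R: "Rel S t" "Rel S' t" for S S' t
  proof -
    have SK: "Khom S" "surj S" "Khom S'" "surj S'" using S field_Aut_Khom field_Aut_surj by blast+
    have tp: "t permutes {1..N}" using t carC by auto
    have eq: "S r = S' r" if r: "r \<in> Lspace s" and s: "s < 4 * Q ^ 3" for r s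
    proof (rule ev_inj[OF aut_Lspace[OF SK(1,2) r] aut_Lspace[OF SK(3,4) r] s])
      fix p assume p: "p \<in> pts"
      define i where "i = inv_into UNIV t (pi p)"
      have "i \<in> {1..N}" using permutes_in_image[OF permutes_inv[OF tp]] pi_in(1)[OF p] by (simp add: i_def)
      moreover have "pt (t i) = p" using permutes_inverses(1)[OF tp] pi_in(2)[OF p] by (simp add: i_def)
      ultimately show "ev p (S r) = ev p (S' r)" using R Lspace_aff[OF r] unfolding Rel_def by metis
    qed
    have "Q < 4 * Q ^ 3" "2 * Q + 1 < 4 * Q ^ 3" using m by linarith+
    then show ?thesis using eq[OF x_Lspace] eq[OF y_Lspace] by (intro Khom_ext SK) auto
  qed
  have uniq_perm: "t = t'"
    if S: "S \<in> carrier (field_Aut K)" and t: "t \<in> carrier (code_Aut N C)" "t' \<in> carrier (code_Aut N C)"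
      and R: "Rel S t" "Rel S t'" for S t t'
  proof
    fix i
    have tp: "t permutes {1..N}" "t' permutes {1..N}" using t carC by auto
    have SK: "Khom S" "surj S" using S field_Aut_Khom field_Aut_surj by blast+
    let ?R = "inv_into UNIV S"
    have SR: "S (?R z) = z" for z using surj_f_inv_f[OF SK(2)] .
    show "t i = t' i"
    proof (cases "i \<in> {1..N}")
      case True
      have tin: "t i \<in> {1..N}" "t' i \<in> {1..N}" using permutes_in_image[OF tp(1)] permutes_in_image[OF tp(2)] True by auto
      have "ev (pt (t i)) r = ev (pt (t' i)) r" if r: "r \<in> aff" for r
        using R True aut_aff[OF Khom_inv[OF SK] r] SR unfolding Rel_def by metis
      then have "pt (t i) = pt (t' i)" using pt_eq[OF pt_in[OF tin(1)] pt_in[OF tin(2)]] x_aff y_aff by blast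
      then show ?thesis using pi_pt[OF tin(1)] pi_pt[OF tin(2)] by metis
    next
      case False
      then show ?thesis using permutes_not_in[OF tp(1)] permutes_not_in[OF tp(2)] by simp
    qed
  qed
  have Rel_comp: "Rel (S \<circ> S') (t \<circ> t')"
    if R: "Rel S t" "Rel S' t'" and S': "S' \<in> carrier (field_Aut K)" and t': "t' \<in> carrier (code_Aut N C)" for S S' t t'
    unfolding Rel_def
  proof (intro ballI)
    fix i r assume i: "i \<in> {1..N}" and r: "r \<in> aff"
    have "t' i \<in> {1..N}" using permutes_in_image[of t' "{1..N}" i] t' carC i by blast
    moreover have "S' r \<in> aff" using aut_aff[OF field_Aut_Khom[OF S'] field_Aut_surj[OF S'] r] .
    ultimately show "ev (pt ((t \<circ> t') i)) ((S \<circ> S') r) = ev (pt i) r" using R i r by (simp add: Rel_def)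
  qed
  define \<phi> where "\<phi> t = (SOME S. S \<in> carrier (field_Aut K) \<and> Rel S t)" for t
  have \<phi>: "\<phi> t \<in> carrier (field_Aut K)" "Rel (\<phi> t) t" if "t \<in> carrier (code_Aut N C)" for t
    using someI_ex[OF ex_aut[OF that]] by (auto simp: \<phi>_def)
  have multC: "mult (code_Aut N C) = (\<circ>)" by (simp add: code_Aut_def sym_group_def)
  have multF: "mult (field_Aut K) = (\<circ>)" by (simp add: field_Aut_def)
  have compC: "t \<circ> t' \<in> carrier (code_Aut N C)" if t: "t \<in> carrier (code_Aut N C)" "t' \<in> carrier (code_Aut N C)" for t t'
  proof -
    have "(\<lambda>c. c \<circ> (t \<circ> t')) ` C = (\<lambda>c. c \<circ> t') ` ((\<lambda>c. c \<circ> t) ` C)" by (simp add: image_image comp_assoc)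
    then show ?thesis using t carC permutes_compose by auto
  qed
  have compF: "S \<circ> S' \<in> carrier (field_Aut K)" if "S \<in> carrier (field_Aut K)" "S' \<in> carrier (field_Aut K)" for S S'
    using that field_Aut_carrier bij_comp Khom_comp by blast
  have "\<phi> \<in> iso (code_Aut N C) (field_Aut K)"
  proof (rule isoI)
    show "\<phi> \<in> hom (code_Aut N C) (field_Aut K)"
    proof (rule homI)
      fix t t' assume t: "t \<in> carrier (code_Aut N C)" "t' \<in> carrier (code_Aut N C)"
      show "\<phi> (t \<otimes>\<^bsub>code_Aut N C\<^esub> t') = \<phi> t \<otimes>\<^bsub>field_Aut K\<^esub> \<phi> t'"
        unfolding multC multF
        by (rule uniq_aut[OF \<phi>(1)[OF compC[OF t]] compF[OF \<phi>(1)[OF t(1)] \<phi>(1)[OF t(2)]] compC[OF t] \<phi>(2)[OF compC[OF t]]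
              Rel_comp[OF \<phi>(2)[OF t(1)] \<phi>(2)[OF t(2)] \<phi>(1)[OF t(2)] t(2)]])
    qed (rule \<phi>(1))
    show "bij_betw \<phi> (carrier (code_Aut N C)) (carrier (field_Aut K))"
      unfolding bij_betw_def
    proof
      show "inj_on \<phi> (carrier (code_Aut N C))"
      proof (rule inj_onI)
        fix t t' assume t: "t \<in> carrier (code_Aut N C)" "t' \<in> carrier (code_Aut N C)" and eq: "\<phi> t = \<phi> t'"
        show "t = t'" by (rule uniq_perm[OF \<phi>(1)[OF t(1)] t \<phi>(2)[OF t(1)]]) (use \<phi>(2)[OF t(2)] eq in simp)
      qed
      show "\<phi> ` carrier (code_Aut N C) = carrier (field_Aut K)"
      proof
        show "\<phi> ` carrier (code_Aut N C) \<subseteq> carrier (field_Aut K)" using \<phi>(1) by blast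
        show "carrier (field_Aut K) \<subseteq> \<phi> ` carrier (code_Aut N C)"
        proof
          fix S assume S: "S \<in> carrier (field_Aut K)"
          then obtain t where t: "t \<in> carrier (code_Aut N C)" "Rel S t" using ex_perm by blast
          then have "S = \<phi> t" using uniq_aut[OF S \<phi>(1)[OF t(1)] t(1) t(2) \<phi>(2)[OF t(1)]] by simp
          then show "S \<in> \<phi> ` carrier (code_Aut N C)" using t by blast
        qed
      qed
    qed
  qed
  then show ?thesis unfolding C_def by (auto simp: is_iso_def)
qed

section \<open>From coordinates of points to the list of places\<close>

lemma card_pts: "card pts = 4 * Q ^ 3"
proof -
  have "pts = Sigma K (\<lambda>a. {b \<in> K. h_poly n b = a ^ (2 * Q + 1)})" by (auto simp: pts_def)
  then have "card pts = (\<Sum>a\<in>K. card {b \<in> K. h_poly n b = a ^ (2 * Q + 1)})"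
    using finite_K by (simp add: card_SigmaI)
  also have "\<dots> = card K * Q" using fibre by simp
  finally show ?thesis by (simp add: card_K power3_eq_cube power2_eq_square)
qed

text \<open>Replacing each place of the list by its pair of coordinates turns the code into the
  words of values of functions in \<open>Lspace m\<close>.\<close>

lemma AG_code_Aut_iso:
  assumes a: "bij_betw a {1..4 * Q ^ 2} K"
    and b: "\<And>j. j \<in> {1..4 * Q ^ 2} \<Longrightarrow> bij_betw (b j) {1..Q} {c \<in> K. h_poly n c = a j ^ (2 * Q + 1)}"
    and m: "2 * Q + 1 \<le> m" "m + 3 * Q + 1 \<le> 4 * Q ^ 3"
  shows "code_Aut (4 * Q ^ 3)
      (AG_code K (place_list K x y (4 * Q ^ 2) Q a b) (point_divisor (int m) (common_pole K x y))) \<cong> field_Aut K"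
proof -
  define L where "L = concat (map (\<lambda>j. map (\<lambda>l. (a j, b j l)) [1..<Suc Q]) [1..<Suc (4 * Q ^ 2)])"
  have pl: "place_list K x y (4 * Q ^ 2) Q a b = map (\<lambda>p. common_zero K (x - fst p) (y - snd p)) L"
    by (simp add: place_list_def L_def map_concat comp_def del: upt_Suc)
  have len: "length L = 4 * Q ^ 3"
    by (simp add: L_def length_concat comp_def sum_list_triv power3_eq_cube power2_eq_square del: upt_Suc)
  have aim: "a ` {1..4 * Q ^ 2} = K" using a by (simp add: bij_betw_def)
  have bim: "b j ` {1..Q} = {c \<in> K. h_poly n c = a j ^ (2 * Q + 1)}" if "j \<in> {1..4 * Q ^ 2}" for j
    using b[OF that] by (simp add: bij_betw_def)
  have setL: "set L = pts"
  proof -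
    have "set L = (\<Union>j\<in>{1..4 * Q ^ 2}. (\<lambda>l. (a j, b j l)) ` {1..Q})"
      by (simp add: L_def atLeastLessThanSuc_atLeastAtMost del: upt_Suc)
    also have "\<dots> = (\<Union>j\<in>{1..4 * Q ^ 2}. Pair (a j) ` (b j ` {1..Q}))" by (simp add: image_image)
    also have "\<dots> = (\<Union>j\<in>{1..4 * Q ^ 2}. Pair (a j) ` {c \<in> K. h_poly n c = a j ^ (2 * Q + 1)})"
      using bim by simp
    also have "\<dots> = (\<Union>e\<in>a ` {1..4 * Q ^ 2}. Pair e ` {c \<in> K. h_poly n c = e ^ (2 * Q + 1)})" by simp
    also have "\<dots> = pts" unfolding aim by (auto simp: pts_def)
    finally show ?thesis .
  qed
  \<comment> \<open>The list runs through all of \<open>pts\<close> and its length equals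
    \<open>card pts\<close>, so nothing repeats.\<close>
  have dist: "distinct L" by (rule card_distinct) (simp add: setL card_pts len)
  define pt where "pt i = L ! (i - 1)" for i
  have bij: "bij_betw pt {1..4 * Q ^ 3} pts"
  proof -
    have "bij_betw (\<lambda>i. i - 1) {1..4 * Q ^ 3} {..<4 * Q ^ 3}"
      by (rule bij_betw_byWitness[of _ Suc]) auto
    moreover have "bij_betw ((!) L) {..<4 * Q ^ 3} pts" using bij_betw_nth[OF dist] len setL by simp
    ultimately have "bij_betw ((!) L \<circ> (\<lambda>i. i - 1)) {1..4 * Q ^ 3} pts" by (rule bij_betw_trans)
    then show ?thesis by (simp add: pt_def[abs_def] comp_def)
  qed
  have "AG_code K (place_list K x y (4 * Q ^ 2) Q a b) (point_divisor (int m) (common_pole K x y)) =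
      word pt (4 * Q ^ 3) ` Lspace m"
    unfolding AG_code_def common_pole_eq RR_space_eq pl
  proof (intro image_cong refl)
    fix f assume "f \<in> Lspace m"
    show "restrict (\<lambda>i. place_value K (map (\<lambda>p. common_zero K (x - fst p) (y - snd p)) L ! (i - 1)) f)
        {1..length (map (\<lambda>p. common_zero K (x - fst p) (y - snd p)) L)} = word pt (4 * Q ^ 3) f"
      unfolding word_def length_map len
    proof (rule restrict_ext)
      fix i assume i: "i \<in> {1..4 * Q ^ 3}"
      then have "i - 1 < length L" using len by auto
      moreover from this have "L ! (i - 1) \<in> pts" using setL nth_mem by blast
      ultimately show "place_value K (map (\<lambda>p. common_zero K (x - fst p) (y - snd p)) L ! (i - 1)) f = ev (pt i) f"
        by (simp add: common_zero_eq ev_def pt_def)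
    qed
  qed
  then show ?thesis using code_Aut_iso[OF bij m] by simp
qed

end

theorem theorem5p8:
  fixes K :: "'a::field set" and x y :: 'a
    and n q :: nat and m :: int
    and a :: "nat \<Rightarrow> 'a" and b :: "nat \<Rightarrow> nat \<Rightarrow> 'a"
  assumes "n \<ge> 2" and "q = 2 ^ n"
    and "is_subfield K" and "card K = q ^ 2"
    and "transcendental_over K x"
    and "x ^ (q + 1) = h_poly n y"
    and "is_subfield hull (K \<union> {x, y}) = UNIV"
    and "bij_betw a {1..q ^ 2} K"
    and "\<forall>j\<in>{1..q ^ 2}.
           bij_betw (b j) {1..q div 2} {c \<in> K. h_poly n c = a j ^ (q + 1)}"
    and "int q + 1 \<le> m" and "m \<le> (int q ^ 3 - 3 * int q - 2) div 2"
  shows "code_Aut (q ^ 3 div 2)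
           (AG_code K (place_list K x y (q ^ 2) (q div 2) a b)
              (point_divisor m (common_pole K x y)))
         \<cong> field_Aut K"
proof -
  define Q where "Q = (2 :: nat) ^ (n - 1)"
  have q: "q = 2 * Q" using assms(1,2) by (cases n) (auto simp: Q_def)
  have q2: "q ^ 2 = 4 * Q ^ 2" and q3: "q ^ 3 = 8 * Q ^ 3" by (simp_all add: q power2_eq_square power3_eq_cube)
  have b: "bij_betw (b j) {1..Q} {c \<in> K. h_poly n c = a j ^ (2 * Q + 1)}" if "j \<in> {1..4 * Q ^ 2}" for j
    using assms(9) that unfolding q2 q by simp
  have a: "bij_betw a {1..4 * Q ^ 2} K" using assms(8) q2 by simp
  \<comment> \<open>The enumeration \<open>b\<close> enters through \<open>fibre\<close>: over each
    \<open>c\<close> it lists exactly \<open>Q\<close> ordinates.\<close>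
  interpret curve K x y n Q
  proof
    show "card {d \<in> K. h_poly n d = c ^ (2 * Q + 1)} = Q" if c: "c \<in> K" for c
    proof -
      obtain j where "j \<in> {1..4 * Q ^ 2}" "c = a j" using bij_betw_imp_surj_on[OF a] c by blast
      then show ?thesis using bij_betw_same_card[OF b, of j] by simp
    qed
  qed (use assms q q2 Q_def in simp_all)
  define k where "k = nat m"
  have mk: "m = int k" using assms(10) by (simp add: k_def)
  have lo: "2 * Q + 1 \<le> k" using assms(10) unfolding mk q by linarith
  have "int q ^ 3 = 8 * int Q ^ 3" using q3 by (metis of_nat_mult of_nat_numeral of_nat_power)
  \<comment> \<open>The number halved in the hypothesis is \<open>8 * Q ^ 3 - 6 * Q - 2\<close>; it
    is even, so \<open>div 2\<close> loses nothing.\<close>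
  then have "2 * m \<le> 8 * int Q ^ 3 - 6 * int Q - 2" using assms(11) q by simp
  then have "int (k + 3 * Q + 1) \<le> int (4 * Q ^ 3)" using mk by simp
  then have hi: "k + 3 * Q + 1 \<le> 4 * Q ^ 3" by (simp only: of_nat_le_iff)
  show ?thesis using AG_code_Aut_iso[OF a b lo hi] by (simp add: q2 q3 mk) (simp add: q)
qed

end
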